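(* Suppose $n\geq 4$, let $g_0$ be any flat Riemannian metric on the torus $T^n$, and let $f\in C^0(T^n)$. Then there exists a sequence of Riemannian metrics $g_i$ on $T^n$ such that $\mathcal{R}(g_i)>-\frac{1}{i}$ for all $i$ and such that $d_{g_i}$ converges uniformly on $T^n\times T^n$ to the Riemannian distance $d_f$ of the metric $e^{2f}g_0$. The metrics $g_i$ are uniformly equivalent to $g_0$ in the sense that for some $C<\infty$ we have $\frac{g_0}{C}\leq g_i\leq C g_0$ for all $i$.
   Context: The metrics $g_i$ are smooth Riemannian metrics, indexed by positive integers $i$; $\mathcal{R}(g)$ denotes the scalar curvature of a metric $g$, and the lower bound on it is meant at every point. $d_g$ denotes the Riemannian distance of $g$, i.e. the infimum of $g$-lengths of piecewise $C^1$ curves joining two points; since $f$ is only continuous, $e^{2f}g_0$ is a continuous Riemannian metric and $d_f$ is defined by the same infimum of lengths. Inequalities between metrics are inequalities between symmetric bilinear forms at each point. *)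

theory Defs
  imports "HOL-Analysis.Analysis"
begin

section \<open>The torus as the quotient of Euclidean space by the integer lattice\<close>

definition lattice_rel :: "real ^ 'n \<Rightarrow> real ^ 'n \<Rightarrow> bool" where
  "lattice_rel x y \<longleftrightarrow> (\<forall>i. x $ i - y $ i \<in> \<int>)"

lemma equivp_lattice_rel: "equivp (lattice_rel :: real ^ 'n \<Rightarrow> real ^ 'n \<Rightarrow> bool)"
proof (rule equivpI)
  show "reflp (lattice_rel :: real ^ 'n \<Rightarrow> real ^ 'n \<Rightarrow> bool)"
    by (simp add: reflp_def lattice_rel_def)
  show "symp (lattice_rel :: real ^ 'n \<Rightarrow> real ^ 'n \<Rightarrow> bool)"
    unfolding symp_def lattice_rel_def by (metis Ints_minus minus_diff_eq)
  show "transp (lattice_rel :: real ^ 'n \<Rightarrow> real ^ 'n \<Rightarrow> bool)"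
  proof (rule transpI)
    fix x y z :: "real ^ 'n"
    assume "lattice_rel x y" "lattice_rel y z"
    then have "(x $ i - y $ i) + (y $ i - z $ i) \<in> \<int>" for i
      unfolding lattice_rel_def by (blast intro: Ints_add)
    then show "lattice_rel x z"
      unfolding lattice_rel_def by simp
  qed
qed

quotient_type 'n torus = "real ^ 'n::finite" / lattice_rel
  morphisms rep_torus proj_torus
  by (rule equivp_lattice_rel)

instantiation torus :: (finite) topological_space
begin

definition open_torus :: "'a torus set \<Rightarrow> bool" where
  "open_torus U \<longleftrightarrow> open (proj_torus -` U)"

instance
  by standard (auto simp: open_torus_def vimage_Union)

end

lemma proj_torus_eq_iff: "proj_torus x = proj_torus y \<longleftrightarrow> lattice_rel x y"
  by (rule torus.abs_eq_iff)

lemma proj_rep_torus: "proj_torus (rep_torus p) = p"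
  by (rule Quotient_abs_rep[OF Quotient_torus])


section \<open>Riemannian metrics\<close>

text \<open>
  The differential of the covering map \<^const>\<open>proj_torus\<close> identifies every tangent space of the
  torus with Euclidean space, compatibly with the action of the lattice. So a field of bilinear
  forms on the torus is a function of type \<open>'n tensor2\<close>, and its components in the coordinates
  given by (local inverses of) \<^const>\<open>proj_torus\<close> are functions on all of Euclidean space.
\<close>

type_synonym 'n tensor2 = "'n torus \<Rightarrow> real ^ 'n \<Rightarrow> real ^ 'n \<Rightarrow> real"

definition comp_mat :: "'n::finite tensor2 \<Rightarrow> real ^ 'n \<Rightarrow> real ^ 'n ^ 'n" where
  "comp_mat g x = (\<chi> i j. g (proj_torus x) (axis i 1) (axis j 1))"

definition partial :: "'n::finite \<Rightarrow> (real ^ 'n \<Rightarrow> real) \<Rightarrow> real ^ 'n \<Rightarrow> real" where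
  "partial j F x = deriv (\<lambda>t. F (x + t *\<^sub>R axis j 1)) 0"

fun C_k :: "nat \<Rightarrow> (real ^ 'n::finite \<Rightarrow> real) \<Rightarrow> bool" where
  "C_k 0 F \<longleftrightarrow> continuous_on UNIV F"
| "C_k (Suc k) F \<longleftrightarrow> F differentiable_on UNIV \<and> (\<forall>j. C_k k (partial j F))"

definition smooth :: "(real ^ 'n::finite \<Rightarrow> real) \<Rightarrow> bool" where
  "smooth F \<longleftrightarrow> (\<forall>k. C_k k F)"

definition riemannian_metric :: "'n::finite tensor2 \<Rightarrow> bool" where
  "riemannian_metric g \<longleftrightarrow>
     (\<forall>p. bilinear (g p) \<and> (\<forall>v w. g p v w = g p w v) \<and> (\<forall>v. v \<noteq> 0 \<longrightarrow> g p v v > 0)) \<and>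
     (\<forall>i j. smooth (\<lambda>x. comp_mat g x $ i $ j))"

definition metric_le :: "'n::finite tensor2 \<Rightarrow> 'n tensor2 \<Rightarrow> bool" where
  "metric_le g h \<longleftrightarrow> (\<forall>p v. g p v v \<le> h p v v)"


section \<open>Curvature\<close>

text \<open>
  The curvature formulas are evaluated in the coordinates given by \<^const>\<open>proj_torus\<close>. In
  \<open>christoffel g k i j\<close> the index \<open>k\<close> is the upper one; \<open>riemann g l k i j\<close> is the
  \<open>l\<close>-th component of \<open>R(\<partial>\<^sub>i, \<partial>\<^sub>j) \<partial>\<^sub>k\<close>, and the Ricci tensor is the trace over \<open>l = i\<close>, so that
  round spheres have positive scalar curvature.
\<close>

definition christoffel :: "'n::finite tensor2 \<Rightarrow> 'n \<Rightarrow> 'n \<Rightarrow> 'n \<Rightarrow> real ^ 'n \<Rightarrow> real" where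
  "christoffel g k i j x =
     (1 / 2) * (\<Sum>l\<in>UNIV. matrix_inv (comp_mat g x) $ k $ l *
        (partial i (\<lambda>y. comp_mat g y $ j $ l) x
         + partial j (\<lambda>y. comp_mat g y $ i $ l) x
         - partial l (\<lambda>y. comp_mat g y $ i $ j) x))"

definition riemann :: "'n::finite tensor2 \<Rightarrow> 'n \<Rightarrow> 'n \<Rightarrow> 'n \<Rightarrow> 'n \<Rightarrow> real ^ 'n \<Rightarrow> real" where
  "riemann g l k i j x =
     partial i (christoffel g l j k) x - partial j (christoffel g l i k) x
     + (\<Sum>m\<in>UNIV. christoffel g l i m x * christoffel g m j k x
                   - christoffel g l j m x * christoffel g m i k x)"

definition ricci :: "'n::finite tensor2 \<Rightarrow> 'n \<Rightarrow> 'n \<Rightarrow> real ^ 'n \<Rightarrow> real" where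
  "ricci g j k x = (\<Sum>i\<in>UNIV. riemann g i k i j x)"

definition scalar_curvature :: "'n::finite tensor2 \<Rightarrow> 'n torus \<Rightarrow> real" where
  "scalar_curvature g p =
     (\<Sum>j\<in>UNIV. \<Sum>k\<in>UNIV.
        matrix_inv (comp_mat g (rep_torus p)) $ j $ k * ricci g j k (rep_torus p))"

definition flat :: "'n::finite tensor2 \<Rightarrow> bool" where
  "flat g \<longleftrightarrow> (\<forall>l k i j x. riemann g l k i j x = 0)"

text \<open>The scalar curvature does not depend on the representative chosen by \<^const>\<open>rep_torus\<close>.\<close>

lemma lattice_rel_add: "lattice_rel x y \<Longrightarrow> lattice_rel (x + v) (y + v)"
  by (simp add: lattice_rel_def)

lemma comp_mat_periodic: "lattice_rel x y \<Longrightarrow> comp_mat g x = comp_mat g y"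
  by (simp add: comp_mat_def flip: proj_torus_eq_iff)

lemma partial_periodic:
  assumes "\<And>x y. lattice_rel x y \<Longrightarrow> F x = F y" "lattice_rel x y"
  shows "partial j F x = partial j F y"
proof -
  have "F (x + t *\<^sub>R axis j 1) = F (y + t *\<^sub>R axis j 1)" for t
    by (rule assms(1)) (rule lattice_rel_add[OF assms(2)])
  then show ?thesis
    by (simp add: partial_def)
qed

lemma christoffel_periodic:
  assumes "lattice_rel x y"
  shows "christoffel g k i j x = christoffel g k i j y"
proof -
  have "partial a (\<lambda>y. comp_mat g y $ b $ c) x = partial a (\<lambda>y. comp_mat g y $ b $ c) y" for a b c
    by (rule partial_periodic[OF _ assms]) (simp add: comp_mat_periodic)
  then show ?thesis
    by (simp add: christoffel_def comp_mat_periodic[OF assms])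
qed

lemma riemann_periodic:
  assumes "lattice_rel x y"
  shows "riemann g l k i j x = riemann g l k i j y"
proof -
  have "partial a (christoffel g b c d) x = partial a (christoffel g b c d) y" for a b c d
    by (rule partial_periodic[OF _ assms]) (rule christoffel_periodic)
  then show ?thesis
    by (simp add: riemann_def christoffel_periodic[OF assms])
qed

lemma scalar_curvature_proj:
  "scalar_curvature g (proj_torus x) =
     (\<Sum>j\<in>UNIV. \<Sum>k\<in>UNIV. matrix_inv (comp_mat g x) $ j $ k * ricci g j k x)"
proof -
  have r: "lattice_rel (rep_torus (proj_torus x)) x"
    by (simp add: proj_rep_torus flip: proj_torus_eq_iff)
  show ?thesis
    by (simp add: scalar_curvature_def ricci_def comp_mat_periodic[OF r] riemann_periodic[OF r])
qed


section \<open>Length and distance\<close>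

text \<open>
  A curve in the torus has velocity \<open>v\<close> at \<open>t\<close> if some lift of it near \<open>t\<close> has derivative
  \<open>v\<close> at \<open>t\<close>. Since the lift is then continuous at \<open>t\<close>, near \<open>t\<close> it is the curve read in
  the chart around \<open>\<gamma> t\<close> inverting \<^const>\<open>proj_torus\<close>.
\<close>

definition has_velocity ::
    "(real \<Rightarrow> 'n::finite torus) \<Rightarrow> real ^ 'n \<Rightarrow> real \<Rightarrow> real set \<Rightarrow> bool" where
  "has_velocity \<gamma> v t S \<longleftrightarrow>
     (\<exists>c. proj_torus (c t) = \<gamma> t \<and> (\<forall>\<^sub>F s in at t within S. proj_torus (c s) = \<gamma> s) \<and>
          (c has_vector_derivative v) (at t within S))"

definition velocity :: "(real \<Rightarrow> 'n::finite torus) \<Rightarrow> real \<Rightarrow> real ^ 'n" where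
  "velocity \<gamma> t = (THE v. has_velocity \<gamma> v t UNIV)"

definition C1_curve_on :: "real \<Rightarrow> real \<Rightarrow> (real \<Rightarrow> 'n::finite torus) \<Rightarrow> bool" where
  "C1_curve_on a b \<gamma> \<longleftrightarrow>
     (\<exists>V. continuous_on {a..b} V \<and> (\<forall>t\<in>{a..b}. has_velocity \<gamma> (V t) t {a..b}))"

text \<open>
  The curve is required to be of class \<open>C\<^sup>1\<close> on the closed pieces. This is stronger than
  \<^const>\<open>piecewise_C1_differentiable_on\<close>, which allows the derivative to be unbounded, hence
  the length integral to diverge (and to take the value 0 by convention), near break points.
\<close>

definition piecewise_C1_curve :: "(real \<Rightarrow> 'n::finite torus) \<Rightarrow> bool" where
  "piecewise_C1_curve \<gamma> \<longleftrightarrow>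
     (\<exists>(N::nat) (\<tau> :: nat \<Rightarrow> real). \<tau> 0 = 0 \<and> \<tau> N = 1 \<and>
        (\<forall>k<N. \<tau> k < \<tau> (Suc k) \<and> C1_curve_on (\<tau> k) (\<tau> (Suc k)) \<gamma>))"

definition curve_length :: "'n::finite tensor2 \<Rightarrow> (real \<Rightarrow> 'n torus) \<Rightarrow> real" where
  "curve_length g \<gamma> = integral {0..1} (\<lambda>t. sqrt (g (\<gamma> t) (velocity \<gamma> t) (velocity \<gamma> t)))"

definition riemannian_dist :: "'n::finite tensor2 \<Rightarrow> 'n torus \<Rightarrow> 'n torus \<Rightarrow> real" where
  "riemannian_dist g p q =
     Inf {curve_length g \<gamma> |\<gamma>. piecewise_C1_curve \<gamma> \<and> \<gamma> 0 = p \<and> \<gamma> 1 = q}"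

definition conformal :: "('n::finite torus \<Rightarrow> real) \<Rightarrow> 'n tensor2 \<Rightarrow> 'n tensor2" where
  "conformal f g p v w = exp (2 * f p) * g p v w"

end

theory Submission
  imports Defs "HOL-Computational_Algebra.Polynomial"
begin

text \<open>
  Starting from a large multiple \<open>h\<close> of \<open>g\<^sub>0\<close>, the metric is shortened along finitely many disjoint
  closed lines so that on each line it agrees with \<open>e\<^sup>2\<^sup>f g\<^sub>0\<close> in the direction \<open>u\<close> of the line. If
  \<open>\<tau> = \<nu> \<otimes> \<nu> / h(u, u)\<close> with \<open>\<nu> = h(u, \<cdot>)\<close>, and \<open>H = h - \<tau>\<close>, the new metric is
  \<open>e\<^sup>2\<^sup>\<beta>\<^sup>w H + e\<^sup>2\<^sup>b\<^sup>w \<tau>\<close>, where \<open>b\<close> is \<open>f\<close> minus a constant and \<open>w \<in> [0, 1]\<close> is a truncated and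
  rescaled logarithm of the distance to the line, equal to 1 on the line. To leading order its scalar
  curvature is \<open>-2 (\<beta> (n - 2) + b)\<close> times the transversal Laplacian of \<open>w\<close>. The transversal dimension
  \<open>n - 1\<close> is at least 3, so minus the logarithm is strictly superharmonic there, and this positive term
  absorbs the errors as the scale of the truncation tends to 0. Flatness of \<open>g\<^sub>0\<close> is used only through
  the vanishing of its scalar curvature, so no flat coordinates are needed: the lines are straight in
  the coordinates of the torus.

  The new metric dominates \<open>e\<^sup>2\<^sup>f g\<^sub>0\<close> approximately, which bounds its distance from below. Lines chosen
  close to the segments of finitely many polygonal approximations of nearly shortest curves bound it
  from above.
\<close>

section \<open>Smooth functions of several variables\<close>

text \<open>The obstacle is a sign. A conformal shrinking by \<open>b\<close> in all directions
  would give the leading curvature term the coefficient \<open>b (n - 1) \<le> 0\<close> in place of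
  \<open>\<beta> (n - 2) + b\<close>. So only the direction \<open>u\<close> is shrunk, and the
  orthogonal part \<open>H\<close> is stretched by a constant \<open>\<beta>\<close> so large that
  \<open>\<beta> (n - 2) + b \<ge> 1\<close>. Stretching creates no shortcuts, so it does no harm to
  the distance.

  The dimension enters through one computation. If \<open>q\<close> is modelled on the squared
  distance to the line, then \<open>\<Delta> q = 2 (n - 1)\<close> and
  \<open>|\<nabla> q|^2 = 4 q\<close>, hence \<open>\<Delta> (- ln q) = - 2 (n - 3) / q\<close>,
  which is negative exactly for \<open>n \<ge> 4\<close>.

  No estimate has to be uniform in the network of lines. The lines, the smooth replacement of
  \<open>f\<close> and the widths of the tubes are fixed before the scale \<open>exp (- L)\<close>
  of the truncation tends to 0, so only the dependence on \<open>L\<close> is controlled.\<close>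

lemma C_k_SucD: "C_k (Suc k) F \<Longrightarrow> C_k k F"
  by (induction k arbitrary: F) (auto simp: differentiable_imp_continuous_on)

lemma smooth_differentiable: "smooth F \<Longrightarrow> F differentiable (at x)"
  unfolding smooth_def by (metis C_k.simps(2) UNIV_I differentiable_on_def)

lemma smooth_continuous: "smooth F \<Longrightarrow> continuous_on S F"
  unfolding smooth_def by (meson C_k.simps(1) continuous_on_subset subset_UNIV)

lemma smooth_partial: "smooth F \<Longrightarrow> smooth (partial j F)"
  unfolding smooth_def by (metis C_k.simps(2))

text \<open>\<open>C_k\<close> asks for total differentiability and not merely for partial
  derivatives, so the derivative along \<open>u\<close> is linear in \<open>u\<close>. Used for
  derivatives along a line.\<close>

lemma smooth_directional:
  fixes F :: "real ^ 'n::finite \<Rightarrow> real"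
  assumes "smooth F"
  shows "((\<lambda>t. F (x + t *\<^sub>R u)) has_real_derivative (\<Sum>a\<in>UNIV. u $ a * partial a F x)) (at 0)"
proof -
  obtain F' where F': "(F has_derivative F') (at x)"
    using smooth_differentiable[OF assms] by (auto simp: differentiable_def)
  have d: "((\<lambda>t. F (x + t *\<^sub>R v)) has_real_derivative F' v) (at 0)" for v
  proof -
    have "((\<lambda>t. x + t *\<^sub>R v) has_derivative (\<lambda>t. t *\<^sub>R v)) (at 0)"
      by (auto intro!: derivative_eq_intros)
    from diff_chain_at[OF this, of F F'] F'
    have "((\<lambda>t. F (x + t *\<^sub>R v)) has_derivative (\<lambda>t. F' (t *\<^sub>R v))) (at 0)"
      by (simp add: o_def)
    moreover have "F' (t *\<^sub>R v) = F' v * t" for t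
      using linear_scale[OF has_derivative_linear[OF F']] by simp
    ultimately show ?thesis by (simp add: has_field_derivative_def)
  qed
  have p: "partial a F x = F' (axis a 1)" for a
    unfolding partial_def by (rule DERIV_imp_deriv) (rule d)
  have "F' u = F' (\<Sum>a\<in>UNIV. u $ a *\<^sub>R axis a 1)"
    by (simp add: basis_expansion[of u, unfolded scalar_mult_eq_scaleR])
  also have "\<dots> = (\<Sum>a\<in>UNIV. u $ a * partial a F x)"
    using has_derivative_linear[OF F'] by (simp add: linear_sum linear_scale p)
  finally show ?thesis using d[of u] by simp
qed

lemma partialI:
  "((\<lambda>t. F (x + t *\<^sub>R axis j 1)) has_real_derivative D) (at 0) \<Longrightarrow> partial j F x = D"
  unfolding partial_def by (rule DERIV_imp_deriv)

lemma differentiable_partial: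
  assumes "F differentiable (at x)"
  shows "((\<lambda>t. F (x + t *\<^sub>R axis j 1)) has_real_derivative partial j F x) (at 0)"
proof -
  obtain F' where F': "(F has_derivative F') (at x)"
    using assms by (auto simp: differentiable_def)
  have "((\<lambda>t. x + t *\<^sub>R axis j 1) has_derivative (\<lambda>t. t *\<^sub>R axis j 1)) (at 0)"
    by (auto intro!: derivative_eq_intros)
  from diff_chain_at[OF this, of F F'] F'
  have "((\<lambda>t. F (x + t *\<^sub>R axis j 1)) has_derivative (\<lambda>t. F' (t *\<^sub>R axis j 1))) (at 0)"
    by (simp add: o_def)
  moreover have "F' (t *\<^sub>R axis j 1) = F' (axis j 1) * t" for t
    using linear_scale[OF has_derivative_linear[OF F']] by simp
  ultimately have "((\<lambda>t. F (x + t *\<^sub>R axis j 1)) has_real_derivative F' (axis j 1)) (at 0)"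
    by (simp add: has_field_derivative_def)
  then show ?thesis using partialI by metis
qed

lemma smooth_DERIV:
  "smooth F \<Longrightarrow> ((\<lambda>t. F (x + t *\<^sub>R axis j 1)) has_real_derivative partial j F x) (at 0)"
  by (rule differentiable_partial[OF smooth_differentiable])

lemma partial_cong:
  assumes "open U" "x \<in> U" "\<And>y. y \<in> U \<Longrightarrow> F y = G y"
  shows "partial j F x = partial j G x"
proof -
  have "isCont (\<lambda>t::real. x + t *\<^sub>R axis j 1) 0" by (intro continuous_intros)
  then have "(\<lambda>t::real. x + t *\<^sub>R axis j 1) \<midarrow>0\<rightarrow> x" by (simp add: isCont_def)
  then have "\<forall>\<^sub>F t in at 0. x + t *\<^sub>R axis j 1 \<in> U"
    using assms(1,2) by (rule topological_tendstoD)
  then have "\<forall>\<^sub>F t in nhds 0. x + t *\<^sub>R axis j 1 \<in> U"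
    using assms by (simp add: eventually_nhds_conv_at)
  then show ?thesis unfolding partial_def
    by (intro deriv_cong_ev) (auto elim!: eventually_mono simp: assms)
qed

section \<open>Closure of \<open>C_k\<close> and \<open>smooth\<close> under algebraic operations
  and composition\<close>

lemma C_k_const: "C_k k (\<lambda>x. c)"
proof (induction k arbitrary: c)
  case (Suc k)
  have "partial j (\<lambda>x::real ^ 'a. c) = (\<lambda>x. 0)" for j by (auto simp: partial_def)
  then show ?case using Suc by auto
qed simp

lemma C_k_add: "C_k k F \<Longrightarrow> C_k k G \<Longrightarrow> C_k k (\<lambda>x. F x + G x)"
proof (induction k arbitrary: F G)
  case 0 then show ?case by (auto intro: continuous_intros)
next
  case (Suc k)
  have "partial j (\<lambda>x. F x + G x) = (\<lambda>x. partial j F x + partial j G x)" for j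
    using Suc.prems
    by (intro ext partialI DERIV_add differentiable_partial) (auto simp: differentiable_on_def)
  then show ?case using Suc by auto
qed

lemma C_k_mult: "C_k k F \<Longrightarrow> C_k k G \<Longrightarrow> C_k k (\<lambda>x. F x * G x)"
proof (induction k arbitrary: F G)
  case 0 then show ?case by (auto intro: continuous_intros)
next
  case (Suc k)
  have "partial j (\<lambda>x. F x * G x) = (\<lambda>x. partial j F x * G x + partial j G x * F x)" for j
  proof (intro ext partialI)
    fix x
    have dF: "((\<lambda>t. F (x + t *\<^sub>R axis j 1)) has_real_derivative partial j F x) (at 0)"
      and dG: "((\<lambda>t. G (x + t *\<^sub>R axis j 1)) has_real_derivative partial j G x) (at 0)"
      using Suc.prems by (auto simp: differentiable_on_def intro!: differentiable_partial)
    show "((\<lambda>t. F (x + t *\<^sub>R axis j 1) * G (x + t *\<^sub>R axis j 1)) has_real_derivative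
        partial j F x * G x + partial j G x * F x) (at 0)"
      using DERIV_mult[OF dF dG] by simp
  qed
  moreover have "C_k k F" "C_k k G" using Suc.prems C_k_SucD by blast+
  ultimately show ?case using Suc by (auto intro!: C_k_add)
qed

text \<open>The outer function comes with the sequence \<open>\<phi>\<close> of all its derivatives,
  and \<open>m\<close> stays arbitrary in the induction, because the chain rule turns
  \<open>\<phi> m\<close> into \<open>\<phi> (Suc m)\<close>.\<close>

lemma C_k_compose:
  fixes F :: "real ^ 'n::finite \<Rightarrow> real" and \<phi> :: "nat \<Rightarrow> real \<Rightarrow> real"
  assumes "\<And>m y. y \<in> S \<Longrightarrow> (\<phi> m has_real_derivative \<phi> (Suc m) y) (at y)" "\<And>x. F x \<in> S"
  shows "C_k k F \<Longrightarrow> C_k k (\<lambda>x. \<phi> m (F x))"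
proof (induction k arbitrary: m)
  case 0
  have "continuous_on S (\<phi> m)"
    by (meson DERIV_isCont assms(1) continuous_at_imp_continuous_on)
  from continuous_on_compose2[OF this, of UNIV F] 0 assms(2) show ?case by auto
next
  case (Suc k)
  have "partial j (\<lambda>x. \<phi> m (F x)) = (\<lambda>x. \<phi> (Suc m) (F x) * partial j F x)" for j
  proof (intro ext partialI)
    fix x
    have dF: "((\<lambda>t. F (x + t *\<^sub>R axis j 1)) has_real_derivative partial j F x) (at 0)"
      using Suc.prems by (auto simp: differentiable_on_def intro!: differentiable_partial)
    show "((\<lambda>t. \<phi> m (F (x + t *\<^sub>R axis j 1))) has_real_derivative
        \<phi> (Suc m) (F x) * partial j F x) (at 0)"
      using DERIV_chain2[OF _ dF, of "\<phi> m"] assms by simp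
  qed
  moreover have "(\<lambda>x. \<phi> m (F x)) differentiable_on UNIV"
    unfolding differentiable_on_def
  proof
    fix x
    have "\<phi> m differentiable (at (F x))"
      using assms has_field_derivative_def differentiable_def by blast
    moreover have "F differentiable (at x)" using Suc.prems by (auto simp: differentiable_on_def)
    ultimately show "(\<lambda>x. \<phi> m (F x)) differentiable (at x)"
      using differentiable_chain_at[of F x "\<phi> m"] by (simp add: o_def)
  qed
  moreover have "C_k k F" using Suc.prems C_k_SucD by blast
  ultimately show ?case using Suc by (auto intro!: C_k_mult)
qed

named_theorems smooth_intros

lemma smooth_const [smooth_intros]: "smooth (\<lambda>x. c)" by (simp add: smooth_def C_k_const)
lemma smooth_add [smooth_intros]: "smooth F \<Longrightarrow> smooth G \<Longrightarrow> smooth (\<lambda>x. F x + G x)"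
  by (simp add: smooth_def C_k_add)
lemma smooth_mult [smooth_intros]: "smooth F \<Longrightarrow> smooth G \<Longrightarrow> smooth (\<lambda>x. F x * G x)"
  by (simp add: smooth_def C_k_mult)
lemma smooth_uminus [smooth_intros]: "smooth F \<Longrightarrow> smooth (\<lambda>x. - F x)"
  using smooth_mult[OF smooth_const[of "-1"], of F] by simp
lemma smooth_minus [smooth_intros]: "smooth F \<Longrightarrow> smooth G \<Longrightarrow> smooth (\<lambda>x. F x - G x)"
  using smooth_add[of F "\<lambda>x. - G x"] by (auto intro: smooth_intros)
lemma smooth_sum [smooth_intros]: "(\<And>i. i \<in> A \<Longrightarrow> smooth (F i)) \<Longrightarrow> smooth (\<lambda>x. \<Sum>i\<in>A. F i x)"
  by (induction A rule: infinite_finite_induct) (auto intro: smooth_intros)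
lemma smooth_prod [smooth_intros]: "(\<And>i. i \<in> A \<Longrightarrow> smooth (F i)) \<Longrightarrow> smooth (\<lambda>x. \<Prod>i\<in>A. F i x)"
  by (induction A rule: infinite_finite_induct) (auto intro: smooth_intros)
lemma smooth_power [smooth_intros]: "smooth F \<Longrightarrow> smooth (\<lambda>x. F x ^ k)"
  by (induction k) (auto intro: smooth_intros)

lemma smooth_compose:
  assumes "\<And>m y. y \<in> S \<Longrightarrow> (\<phi> m has_real_derivative \<phi> (Suc m) y) (at y)" "\<And>x. F x \<in> S" "smooth F"
  shows "smooth (\<lambda>x. \<phi> 0 (F x))"
  using C_k_compose[of S \<phi> F _ 0] assms unfolding smooth_def by blast

lemma smooth_exp [smooth_intros]: "smooth F \<Longrightarrow> smooth (\<lambda>x. exp (F x))"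
  by (rule smooth_compose[where S = UNIV and \<phi> = "\<lambda>m. exp"]) auto

text \<open>The \<open>m\<close>-th derivative of sine is sine shifted by \<open>m\<close> quarter
  periods, which gives the sequence for \<open>smooth_compose\<close> in closed form.\<close>

lemma smooth_sin [smooth_intros]: "smooth F \<Longrightarrow> smooth (\<lambda>x. sin (F x))"
proof -
  assume F: "smooth F"
  have "((\<lambda>y. sin (y + real m * (pi / 2))) has_real_derivative sin (y + real (Suc m) * (pi / 2))) (at y)"
    for m y
  proof -
    have "sin (y + real (Suc m) * (pi / 2)) = sin (pi / 2 + (y + real m * (pi / 2)))"
      by (rule arg_cong[where f = sin]) (simp add: field_simps)
    also have "\<dots> = cos (y + real m * (pi / 2))" by (simp only: sin_add) simp
    finally show ?thesis by (auto intro!: derivative_eq_intros)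
  qed
  from smooth_compose[where S = UNIV and \<phi> = "\<lambda>m y. sin (y + real m * (pi / 2))", OF this _ F]
  show ?thesis by simp
qed

lemma smooth_cos [smooth_intros]: "smooth F \<Longrightarrow> smooth (\<lambda>x. cos (F x))"
proof -
  assume "smooth F"
  then have "smooth (\<lambda>x. sin (F x + pi / 2))" by (intro smooth_intros)
  then show ?thesis by (simp add: sin_add)
qed

lemma DERIV_inverse_power:
  fixes y :: real
  assumes "y \<noteq> 0"
  shows "((\<lambda>y. (-1) ^ m * fact m * inverse y ^ Suc m) has_real_derivative
         (-1) ^ Suc m * fact (Suc m) * inverse y ^ Suc (Suc m)) (at y)"
proof -
  have "((\<lambda>y. (-1) ^ m * fact m * inverse y ^ Suc m) has_real_derivative
     (-1) ^ m * fact m * ((1 + real m) * (- (inverse y * 1 * inverse y) * inverse y ^ m))) (at y)"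
    by (intro DERIV_cmult DERIV_power_Suc DERIV_inverse' DERIV_ident assms)
  then show ?thesis by (simp add: algebra_simps)
qed

lemma smooth_inverse [smooth_intros]: "smooth F \<Longrightarrow> (\<And>x. F x \<noteq> 0) \<Longrightarrow> smooth (\<lambda>x. inverse (F x))"
proof -
  assume F: "smooth F" "\<And>x. F x \<noteq> 0"
  have "((\<lambda>y. (-1) ^ m * fact m * inverse y ^ Suc m) has_real_derivative
         (-1) ^ Suc m * fact (Suc m) * inverse y ^ Suc (Suc m)) (at y)" if "y \<in> - {0}" for m and y :: real
    using that by (intro DERIV_inverse_power) auto
  from smooth_compose[where S = "- {0}" and \<phi> = "\<lambda>m y. (-1) ^ m * fact m * inverse y ^ Suc m", OF this _ F(1)]
  show ?thesis using F by simp
qed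

lemma smooth_divide [smooth_intros]:
  "smooth F \<Longrightarrow> smooth G \<Longrightarrow> (\<And>x. G x \<noteq> 0) \<Longrightarrow> smooth (\<lambda>x. F x / G x)"
  by (simp add: divide_inverse smooth_inverse smooth_mult)

lemma smooth_ln [smooth_intros]: "smooth F \<Longrightarrow> (\<And>x. F x > 0) \<Longrightarrow> smooth (\<lambda>x. ln (F x))"
proof -
  assume F: "smooth F" "\<And>x. F x > 0"
  \<comment> \<open>From order 1 on, the derivatives of the logarithm are those of the inverse with
    the index lowered by one.\<close>
  have "((\<lambda>y. if m = 0 then ln y else (-1) ^ (m - 1) * fact (m - 1) * inverse y ^ m) has_real_derivative
         (if Suc m = 0 then ln y else (-1) ^ (Suc m - 1) * fact (Suc m - 1) * inverse y ^ Suc m)) (at y)"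
    if "y \<in> {0<..}" for m and y :: real
  proof (cases m)
    case (Suc k)
    then show ?thesis using that DERIV_inverse_power[of y k] by simp
  qed (use that in \<open>auto intro!: derivative_eq_intros simp: field_simps\<close>)
  from smooth_compose[where S = "{0<..}" and \<phi> = "\<lambda>m y. if m = 0 then ln y else (-1) ^ (m - 1) * fact (m - 1) * inverse y ^ m", OF this _ F(1)]
  show ?thesis using F by simp
qed

lemma smooth_component [smooth_intros]: "smooth (\<lambda>x. x $ i)"
  unfolding smooth_def
proof
  fix k
  have p: "partial j (\<lambda>x. x $ i) = (\<lambda>x. axis j 1 $ i)" for j :: 'a
    by (intro ext partialI) (auto intro!: derivative_eq_intros)
  have "(\<lambda>x. x $ i) differentiable_on UNIV"
    by (simp add: bounded_linear_imp_differentiable_on bounded_linear_vec_nth)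
  then show "C_k k (\<lambda>x::real ^ 'a. x $ i)"
    by (cases k) (auto simp: p C_k_const intro: continuous_intros)
qed

lemma partial_add: "smooth F \<Longrightarrow> smooth G \<Longrightarrow> partial j (\<lambda>x. F x + G x) x = partial j F x + partial j G x"
  by (intro partialI DERIV_add smooth_DERIV)
lemma partial_cmult: "smooth F \<Longrightarrow> partial j (\<lambda>x. c * F x) x = c * partial j F x"
  by (intro partialI DERIV_cmult smooth_DERIV)
lemma partial_mult: "smooth F \<Longrightarrow> smooth G \<Longrightarrow>
    partial j (\<lambda>x. F x * G x) x = partial j F x * G x + F x * partial j G x"
  using DERIV_mult[OF smooth_DERIV smooth_DERIV, of F G x j x j]
  by (intro partialI) (simp add: algebra_simps)
lemma partial_sum: "(\<And>i. i \<in> A \<Longrightarrow> smooth (F i)) \<Longrightarrow>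
    partial j (\<lambda>x. \<Sum>i\<in>A. F i x) x = (\<Sum>i\<in>A. partial j (F i) x)"
  by (intro partialI DERIV_sum smooth_DERIV)
lemma partial_const [simp]: "partial j (\<lambda>x. c) x = 0" by (simp add: partial_def)

section \<open>Scalar curvature in terms of the metric and its derivatives\<close>

lemma det_nz_posdef:
  fixes A :: "real ^ 'n ^ 'n"
  assumes "\<And>v. v \<noteq> 0 \<Longrightarrow> v \<bullet> (A *v v) > 0"
  shows "det A \<noteq> 0"
proof -
  have "x = 0" if "A *v x = 0" for x
    using assms[of x] that by (metis inner_zero_right less_irrefl)
  then have "inj ((*v) A)"
    by (intro injI) (metis eq_iff_diff_eq_0 matrix_vector_mult_diff_distrib)
  then show ?thesis
    by (simp add: inj_matrix_vector_mult invertible_det_nz matrix_left_invertible_injective invertible_left_inverse flip: invertible_det_nz)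
qed

lemma inner_matrix_sym:
  fixes A :: "real ^ 'n ^ 'n"
  assumes "\<And>i j. A $ i $ j = A $ j $ i"
  shows "v \<bullet> (A *v w) = w \<bullet> (A *v v)"
proof -
  have "v \<bullet> (A *v w) = (\<Sum>i\<in>UNIV. \<Sum>j\<in>UNIV. v $ i * (A $ i $ j * w $ j))"
    by (simp add: inner_vec_def matrix_vector_mult_def sum_distrib_left)
  also have "\<dots> = (\<Sum>j\<in>UNIV. \<Sum>i\<in>UNIV. w $ j * (A $ j $ i * v $ i))"
  proof (subst sum.swap, intro sum.cong refl)
    fix i j
    show "v $ j * (A $ j $ i * w $ i) = w $ i * (A $ i $ j * v $ j)" using assms[of i j] by simp
  qed
  also have "\<dots> = w \<bullet> (A *v v)" by (simp add: inner_vec_def matrix_vector_mult_def sum_distrib_left)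
  finally show ?thesis .
qed

lemma matrix_inv_mult:
  fixes A :: "real ^ 'n ^ 'n"
  assumes "det A \<noteq> 0"
  shows "A ** matrix_inv A = mat 1" "matrix_inv A ** A = mat 1"
proof -
  have "\<exists>B. A ** B = mat 1 \<and> B ** A = mat 1"
    using assms by (simp add: invertible_det_nz[symmetric] invertible_def)
  from someI_ex[OF this] show "A ** matrix_inv A = mat 1" "matrix_inv A ** A = mat 1"
    unfolding matrix_inv_def by auto
qed

lemma matrix_inv_eqI:
  fixes A :: "real ^ 'n ^ 'n"
  assumes "B ** A = mat 1"
  shows "matrix_inv A = B"
proof -
  have AB: "A ** B = mat 1" using assms matrix_left_right_inverse by blast
  then have "det A \<noteq> 0" using assms invertible_det_nz[of A] by (auto simp: invertible_def)
  then have "matrix_inv A = matrix_inv A ** (A ** B)" by (simp add: AB)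
  also have "\<dots> = B" using \<open>det A \<noteq> 0\<close> by (simp add: matrix_mul_assoc matrix_inv_mult)
  finally show ?thesis .
qed

lemma sum_matrix_inv:
  fixes A :: "real ^ 'n ^ 'n"
  assumes "det A \<noteq> 0"
  shows "(\<Sum>l\<in>UNIV. A $ i $ l * matrix_inv A $ l $ j) = (if i = j then 1 else 0)"
    "(\<Sum>l\<in>UNIV. matrix_inv A $ i $ l * A $ l $ j) = (if i = j then 1 else 0)"
  using matrix_inv_mult[OF assms]
  by (simp_all add: matrix_matrix_mult_def mat_def vec_eq_iff)

text \<open>By Cramer's rule the entries are quotients of polynomials in the entries of
  \<open>A x\<close>.\<close>

lemma smooth_matrix_inv:
  fixes A :: "real ^ 'm::finite \<Rightarrow> real ^ 'n ^ 'n"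
  assumes "\<And>i j. smooth (\<lambda>x. A x $ i $ j)" "\<And>x. det (A x) \<noteq> 0"
  shows "smooth (\<lambda>x. matrix_inv (A x) $ k $ l)"
proof -
  have det: "smooth (\<lambda>x. det (B x))" if "\<And>i j. smooth (\<lambda>x. B x $ i $ j)"
    for B :: "real ^ 'm \<Rightarrow> real ^ 'n ^ 'n"
    unfolding det_def by (intro smooth_intros that)
  have "matrix_inv (A x) $ k $ l
      = det (\<chi> i j. if j = k then axis l 1 $ i else A x $ i $ j) / det (A x)" for x
  proof -
    have "A x *v (matrix_inv (A x) *v axis l 1) = axis l 1"
      by (simp add: matrix_vector_mul_assoc matrix_inv_mult assms)
    then have "matrix_inv (A x) *v axis l 1
      = (\<chi> k. det (\<chi> i j. if j = k then axis l 1 $ i else A x $ i $ j) / det (A x))"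
      by (simp add: cramer assms)
    then have "(matrix_inv (A x) *v axis l 1) $ k
      = det (\<chi> i j. if j = k then axis l 1 $ i else A x $ i $ j) / det (A x)" by simp
    then show ?thesis by (simp add: matrix_vector_mult_basis column_def)
  qed
  moreover have "smooth (\<lambda>x. (\<chi> i j. if j = k then axis l 1 $ i else A x $ i $ j) $ i $ j)" for i j
    by (cases "j = k") (simp_all add: assms smooth_const)
  ultimately show ?thesis by (simp only:) (intro smooth_divide det assms)
qed

text \<open>Differentiate \<open>A ** matrix_inv A = mat 1\<close> entrywise and multiply by the
  inverse from the left.\<close>

lemma partial_matrix_inv:
  fixes A :: "real ^ 'm::finite \<Rightarrow> real ^ 'n ^ 'n"
  assumes "\<And>i j. smooth (\<lambda>x. A x $ i $ j)" "\<And>x. det (A x) \<noteq> 0"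
  shows "partial a (\<lambda>x. matrix_inv (A x) $ k $ l) x =
    - (\<Sum>p\<in>UNIV. \<Sum>q\<in>UNIV. matrix_inv (A x) $ k $ p * partial a (\<lambda>x. A x $ p $ q) x * matrix_inv (A x) $ q $ l)"
proof -
  let ?B = "\<lambda>x. matrix_inv (A x)"
  have sB: "smooth (\<lambda>x. ?B x $ i $ j)" for i j by (rule smooth_matrix_inv[OF assms])
  have z: "(\<Sum>q\<in>UNIV. partial a (\<lambda>x. A x $ p $ q) x * ?B x $ q $ l)
      + (\<Sum>q\<in>UNIV. A x $ p $ q * partial a (\<lambda>x. ?B x $ q $ l) x) = 0" for p
  proof -
    have "partial a (\<lambda>x. \<Sum>q\<in>UNIV. A x $ p $ q * ?B x $ q $ l) x = 0"
      by (simp add: sum_matrix_inv[OF assms(2)])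
    also have "partial a (\<lambda>x. \<Sum>q\<in>UNIV. A x $ p $ q * ?B x $ q $ l) x
       = (\<Sum>q\<in>UNIV. partial a (\<lambda>x. A x $ p $ q * ?B x $ q $ l) x)"
      by (intro partial_sum smooth_mult sB assms)
    also have "\<dots> = (\<Sum>q\<in>UNIV. partial a (\<lambda>x. A x $ p $ q) x * ?B x $ q $ l + A x $ p $ q * partial a (\<lambda>x. ?B x $ q $ l) x)"
      by (intro sum.cong refl partial_mult sB assms)
    finally show ?thesis by (simp add: sum.distrib)
  qed
  have "partial a (\<lambda>x. ?B x $ k $ l) x
      = (\<Sum>q\<in>UNIV. (if k = q then 1 else 0) * partial a (\<lambda>x. ?B x $ q $ l) x)"
    by (subst sum.remove[of _ k]) (auto intro!: sum.neutral)
  also have "\<dots> = (\<Sum>q\<in>UNIV. (\<Sum>p\<in>UNIV. ?B x $ k $ p * A x $ p $ q) * partial a (\<lambda>x. ?B x $ q $ l) x)"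
    by (simp add: sum_matrix_inv[OF assms(2)])
  also have "\<dots> = (\<Sum>q\<in>UNIV. \<Sum>p\<in>UNIV. ?B x $ k $ p * (A x $ p $ q * partial a (\<lambda>x. ?B x $ q $ l) x))"
    by (simp add: sum_distrib_right mult.assoc)
  also have "\<dots> = (\<Sum>p\<in>UNIV. ?B x $ k $ p * (\<Sum>q\<in>UNIV. A x $ p $ q * partial a (\<lambda>x. ?B x $ q $ l) x))"
    by (subst sum.swap) (simp add: sum_distrib_left)
  also have "\<dots> = (\<Sum>p\<in>UNIV. ?B x $ k $ p * (- (\<Sum>q\<in>UNIV. partial a (\<lambda>x. A x $ p $ q) x * ?B x $ q $ l)))"
  proof (intro sum.cong refl arg_cong2[where f = "(*)"])
    show "(\<Sum>q\<in>UNIV. A x $ p $ q * partial a (\<lambda>x. ?B x $ q $ l) x)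
      = - (\<Sum>q\<in>UNIV. partial a (\<lambda>x. A x $ p $ q) x * ?B x $ q $ l)" for p
      using z[of p] by linarith
  qed
  also have "\<dots> = - (\<Sum>p\<in>UNIV. \<Sum>q\<in>UNIV. ?B x $ k $ p * partial a (\<lambda>x. A x $ p $ q) x * ?B x $ q $ l)"
    by (simp add: sum_negf sum_distrib_left mult.assoc)
  finally show ?thesis .
qed

text \<open>
  \<open>I\<close>, \<open>D i j l\<close> and \<open>E a i j l\<close> stand for the inverse metric, \<open>\<partial>\<^sub>i g\<^sub>j\<^sub>l\<close> and \<open>\<partial>\<^sub>a \<partial>\<^sub>i g\<^sub>j\<^sub>l\<close>. The second
  part of the scalar curvature collects the terms that are linear in the second derivatives.
\<close>

definition chr :: "('n::finite \<Rightarrow> 'n \<Rightarrow> real) \<Rightarrow> ('n \<Rightarrow> 'n \<Rightarrow> 'n \<Rightarrow> real) \<Rightarrow> 'n \<Rightarrow> 'n \<Rightarrow> 'n \<Rightarrow> real" where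
  "chr I D k i j = (1 / 2) * (\<Sum>l\<in>UNIV. I k l * (D i j l + D j i l - D l i j))"

text \<open>The product rule splits the derivative of a Christoffel symbol: here the inverse metric
  is differentiated, in \<open>dchr2\<close> the bracket of first derivatives.\<close>

definition dchr1 :: "('n::finite \<Rightarrow> 'n \<Rightarrow> real) \<Rightarrow> ('n \<Rightarrow> 'n \<Rightarrow> 'n \<Rightarrow> real) \<Rightarrow> 'n \<Rightarrow> 'n \<Rightarrow> 'n \<Rightarrow> 'n \<Rightarrow> real" where
  "dchr1 I D a k i j = (1 / 2) * (\<Sum>l\<in>UNIV. - (\<Sum>p\<in>UNIV. \<Sum>q\<in>UNIV. I k p * D a p q * I q l) * (D i j l + D j i l - D l i j))"

definition dchr2 :: "('n::finite \<Rightarrow> 'n \<Rightarrow> real) \<Rightarrow> ('n \<Rightarrow> 'n \<Rightarrow> 'n \<Rightarrow> 'n \<Rightarrow> real) \<Rightarrow> 'n \<Rightarrow> 'n \<Rightarrow> 'n \<Rightarrow> 'n \<Rightarrow> real" where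
  "dchr2 I E a k i j = (1 / 2) * (\<Sum>l\<in>UNIV. I k l * (E a i j l + E a j i l - E a l i j))"

definition scal1 :: "('n::finite \<Rightarrow> 'n \<Rightarrow> real) \<Rightarrow> ('n \<Rightarrow> 'n \<Rightarrow> 'n \<Rightarrow> real) \<Rightarrow> real" where
  "scal1 I D = (\<Sum>j\<in>UNIV. \<Sum>k\<in>UNIV. I j k * (\<Sum>i\<in>UNIV. dchr1 I D i i j k - dchr1 I D j i i k
     + (\<Sum>m\<in>UNIV. chr I D i i m * chr I D m j k - chr I D i j m * chr I D m i k)))"

definition scal2 :: "('n::finite \<Rightarrow> 'n \<Rightarrow> real) \<Rightarrow> ('n \<Rightarrow> 'n \<Rightarrow> 'n \<Rightarrow> 'n \<Rightarrow> real) \<Rightarrow> real" where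
  "scal2 I E = (\<Sum>j\<in>UNIV. \<Sum>k\<in>UNIV. I j k * (\<Sum>i\<in>UNIV. dchr2 I E i i j k - dchr2 I E j i i k))"

text \<open>Curvature of a matrix field on Euclidean space, without reference to a tensor on the
  torus. The value at \<open>x\<close> depends only on the field near \<open>x\<close>, so fields
  that agree on an open set can be exchanged.\<close>

definition curv :: "(real ^ 'n::finite \<Rightarrow> real ^ 'n ^ 'n) \<Rightarrow> real ^ 'n \<Rightarrow> real" where
  "curv m x = scal1 (\<lambda>k l. matrix_inv (m x) $ k $ l) (\<lambda>i j l. partial i (\<lambda>y. m y $ j $ l) x)
     + scal2 (\<lambda>k l. matrix_inv (m x) $ k $ l) (\<lambda>a i j l. partial a (partial i (\<lambda>y. m y $ j $ l)) x)"

lemma curv_cong: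
  assumes "open U" "x \<in> U" "\<And>y. y \<in> U \<Longrightarrow> m y = m' y"
  shows "curv m x = curv m' x"
proof -
  have 1: "partial i (\<lambda>y. m y $ j $ l) z = partial i (\<lambda>y. m' y $ j $ l) z" if "z \<in> U" for i j l z
    by (rule partial_cong[OF assms(1) that]) (simp add: assms)
  have 2: "partial a (partial i (\<lambda>y. m y $ j $ l)) x = partial a (partial i (\<lambda>y. m' y $ j $ l)) x" for a i j l
    by (rule partial_cong[OF assms(1,2)]) (rule 1)
  show ?thesis unfolding curv_def by (simp add: 1 2 assms)
qed

lemma scalar_curvature_curv:
  fixes g :: "'n::finite tensor2"
  assumes s: "\<And>i j. smooth (\<lambda>x. comp_mat g x $ i $ j)" and d: "\<And>x. det (comp_mat g x) \<noteq> 0"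
  shows "scalar_curvature g (proj_torus x) = curv (comp_mat g) x"
proof -
  let ?I = "\<lambda>x k l. matrix_inv (comp_mat g x) $ k $ l"
  let ?D = "\<lambda>x i j l. partial i (\<lambda>y. comp_mat g y $ j $ l) x"
  let ?E = "\<lambda>x a i j l. partial a (partial i (\<lambda>y. comp_mat g y $ j $ l)) x"
  have sI: "smooth (\<lambda>x. ?I x k l)" for k l by (rule smooth_matrix_inv[OF s d])
  have sD: "smooth (\<lambda>x. ?D x i j l)" for i j l by (rule smooth_partial[OF s, unfolded o_def])
  have c: "christoffel g k i j = (\<lambda>x. chr (?I x) (?D x) k i j)" for k i j
    by (rule ext) (simp add: christoffel_def chr_def)
  have dc: "partial a (christoffel g k i j) x = dchr1 (?I x) (?D x) a k i j + dchr2 (?I x) (?E x) a k i j"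
    for a k i j x
  proof -
    have sC: "smooth (\<lambda>x. ?D x i j l + ?D x j i l - ?D x l i j)" for l
      by (intro smooth_intros sD)
    have pC: "partial a (\<lambda>x. ?D x i j l + ?D x j i l - ?D x l i j) x
       = ?E x a i j l + ?E x a j i l - ?E x a l i j" for l
      by (intro partialI DERIV_add DERIV_diff) (use smooth_DERIV[OF sD] in auto)
    have "partial a (christoffel g k i j) x = (1 / 2) * (\<Sum>l\<in>UNIV.
       partial a (\<lambda>x. ?I x k l) x * (?D x i j l + ?D x j i l - ?D x l i j)
       + ?I x k l * (?E x a i j l + ?E x a j i l - ?E x a l i j))"
      unfolding c chr_def
      by (subst partial_cmult, intro smooth_intros sI sD, subst partial_sum, intro smooth_intros sI sD,
          subst partial_mult[OF sI sC]) (simp add: pC)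
    then show ?thesis
      unfolding dchr1_def dchr2_def by (simp only: partial_matrix_inv[OF s d] sum.distrib distrib_left)
  qed
  have r: "ricci g j k x
     = (\<Sum>i\<in>UNIV. dchr1 (?I x) (?D x) i i j k - dchr1 (?I x) (?D x) j i i k
     + (\<Sum>m\<in>UNIV. chr (?I x) (?D x) i i m * chr (?I x) (?D x) m j k - chr (?I x) (?D x) i j m * chr (?I x) (?D x) m i k))
     + (\<Sum>i\<in>UNIV. dchr2 (?I x) (?E x) i i j k - dchr2 (?I x) (?E x) j i i k)" for j k
    unfolding ricci_def riemann_def dc sum.distrib[symmetric] unfolding c
    by (rule sum.cong) simp_all
  show ?thesis
    unfolding scalar_curvature_proj curv_def scal1_def scal2_def r by (simp only: distrib_left sum.distrib)
qed

text \<open>This additivity separates the Hessian of the profile from the other second-derivative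
  terms in \<open>curv_line\<close>.\<close>

lemma scal2_add: "scal2 I (\<lambda>a i j l. E a i j l + E' a i j l) = scal2 I E + scal2 I E'"
proof -
  have "dchr2 I (\<lambda>a i j l. E a i j l + E' a i j l) a k i j = dchr2 I E a k i j + dchr2 I E' a k i j" for a k i j
    unfolding dchr2_def by (simp add: algebra_simps sum.distrib sum_subtractf)
  then show ?thesis
    unfolding scal2_def by (simp add: algebra_simps sum.distrib sum_subtractf)
qed

section \<open>The one-line family of metrics\<close>

lemma sum_expand4:
  fixes p q r s :: "'n \<Rightarrow> real"
  shows "(\<Sum>k\<in>A. (\<alpha> * p k + \<beta> * q k) * (\<gamma> * r k + \<delta> * s k)) =
    \<alpha> * \<gamma> * (\<Sum>k\<in>A. p k * r k) + \<alpha> * \<delta> * (\<Sum>k\<in>A. p k * s k)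
    + \<beta> * \<gamma> * (\<Sum>k\<in>A. q k * r k) + \<beta> * \<delta> * (\<Sum>k\<in>A. q k * s k)"
  by (simp add: sum_distrib_left sum.distrib[symmetric] algebra_simps)

text \<open>The second-order part of the scalar curvature is the linearisation
  \<open>div div \<gamma> - \<Delta> (tr \<gamma>)\<close>. For second derivatives of the form
  \<open>W \<otimes> \<Gamma>\<close> its first term contracts \<open>W\<close> with
  \<open>\<Gamma>\<close>, indices raised by \<open>I\<close>, and its second is the product of the
  traces. Of the six contractions below, \<open>t2\<close> equals \<open>t1\<close>,
  \<open>t5\<close> equals \<open>t3\<close>, and \<open>t6\<close> cancels
  \<open>t4\<close>.\<close>

lemma scal2_product:
  fixes I W \<Gamma> :: "'n::finite \<Rightarrow> 'n \<Rightarrow> real"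
  assumes I: "\<And>i j. I i j = I j i" and \<Gamma>: "\<And>i j. \<Gamma> i j = \<Gamma> j i"
  shows "scal2 I (\<lambda>a i j l. W a i * \<Gamma> j l) =
    (\<Sum>i\<in>UNIV. \<Sum>j\<in>UNIV. W i j * (\<Sum>l\<in>UNIV. (\<Sum>k\<in>UNIV. I j k * \<Gamma> k l) * I l i))
    - (\<Sum>i\<in>UNIV. \<Sum>j\<in>UNIV. I i j * W i j) * (\<Sum>i\<in>UNIV. \<Sum>k\<in>UNIV. I i k * \<Gamma> k i)"
proof -
  define S4 where "S4 f = (\<Sum>j\<in>UNIV. \<Sum>k\<in>UNIV. \<Sum>i\<in>UNIV. \<Sum>l\<in>UNIV. f j k i l)" for f :: "'n \<Rightarrow> 'n \<Rightarrow> 'n \<Rightarrow> 'n \<Rightarrow> real"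
  define t1 where "t1 = S4 (\<lambda>j k i l. I j k * I i l * W i j * \<Gamma> k l)"
  define t2 where "t2 = S4 (\<lambda>j k i l. I j k * I i l * W i k * \<Gamma> j l)"
  define t3 where "t3 = S4 (\<lambda>j k i l. I j k * I i l * W i l * \<Gamma> j k)"
  define t4 where "t4 = S4 (\<lambda>j k i l. I j k * I i l * W j i * \<Gamma> k l)"
  define t5 where "t5 = S4 (\<lambda>j k i l. I j k * I i l * W j k * \<Gamma> i l)"
  define t6 where "t6 = S4 (\<lambda>j k i l. I j k * I i l * W j l * \<Gamma> i k)"
  have "scal2 I (\<lambda>a i j l. W a i * \<Gamma> j l) = S4 (\<lambda>j k i l. (1/2) * (I j k * I i l * W i j * \<Gamma> k l
     + I j k * I i l * W i k * \<Gamma> j l - I j k * I i l * W i l * \<Gamma> j k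
     - I j k * I i l * W j i * \<Gamma> k l - I j k * I i l * W j k * \<Gamma> i l + I j k * I i l * W j l * \<Gamma> i k))"
    unfolding scal2_def dchr2_def S4_def
    unfolding sum_distrib_left sum_subtractf[symmetric] right_diff_distrib[symmetric]
    by (intro sum.cong refl) (simp add: field_simps)
  also have "\<dots> = (1/2) * (t1 + t2 - t3 - t4 - t5 + t6)"
    unfolding t1_def t2_def t3_def t4_def t5_def t6_def S4_def
    by (simp only: sum_distrib_left[symmetric] sum_subtractf sum.distrib)
  also have "t2 = t1"
    unfolding t1_def t2_def S4_def
    by (subst sum.swap) (intro sum.cong refl, metis I)
  also have "t6 = t4"
    unfolding t6_def t4_def S4_def
    by (rule sum.cong[OF refl], rule sum.cong[OF refl], subst sum.swap) (intro sum.cong refl, metis I \<Gamma>)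
  also have "t3 = (\<Sum>i\<in>UNIV. \<Sum>j\<in>UNIV. I i j * W i j) * (\<Sum>i\<in>UNIV. \<Sum>k\<in>UNIV. I i k * \<Gamma> k i)"
  proof -
    have "t3 = (\<Sum>j\<in>UNIV. \<Sum>k\<in>UNIV. (\<Sum>i\<in>UNIV. \<Sum>l\<in>UNIV. I i l * W i l) * (I j k * \<Gamma> k j))"
      unfolding t3_def S4_def sum_distrib_right
      by (intro sum.cong refl) (metis (no_types, lifting) \<Gamma> mult.assoc mult.commute)
    then show ?thesis by (simp only: sum_distrib_left)
  qed
  also have "t5 = (\<Sum>i\<in>UNIV. \<Sum>j\<in>UNIV. I i j * W i j) * (\<Sum>i\<in>UNIV. \<Sum>k\<in>UNIV. I i k * \<Gamma> k i)"
  proof -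
    have "t5 = (\<Sum>j\<in>UNIV. \<Sum>k\<in>UNIV. I j k * W j k * (\<Sum>i\<in>UNIV. \<Sum>l\<in>UNIV. I i l * \<Gamma> l i))"
      unfolding t5_def S4_def sum_distrib_left
      by (intro sum.cong refl) (metis (no_types, lifting) \<Gamma> mult.assoc mult.commute)
    then show ?thesis by (simp only: sum_distrib_right)
  qed
  also have "t1 = (\<Sum>i\<in>UNIV. \<Sum>j\<in>UNIV. W i j * (\<Sum>l\<in>UNIV. (\<Sum>k\<in>UNIV. I j k * \<Gamma> k l) * I l i))"
  proof -
    have "t1 = (\<Sum>j\<in>UNIV. \<Sum>i\<in>UNIV. \<Sum>k\<in>UNIV. \<Sum>l\<in>UNIV. I j k * I i l * W i j * \<Gamma> k l)"
      unfolding t1_def S4_def by (rule sum.cong[OF refl], subst sum.swap, rule refl)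
    also have "\<dots> = (\<Sum>i\<in>UNIV. \<Sum>j\<in>UNIV. \<Sum>k\<in>UNIV. \<Sum>l\<in>UNIV. I j k * I i l * W i j * \<Gamma> k l)"
      by (rule sum.swap)
    also have "\<dots> = (\<Sum>i\<in>UNIV. \<Sum>j\<in>UNIV. \<Sum>l\<in>UNIV. \<Sum>k\<in>UNIV. I j k * I i l * W i j * \<Gamma> k l)"
      by (rule sum.cong[OF refl], rule sum.cong[OF refl], subst sum.swap, rule refl)
    also have "\<dots> = (\<Sum>i\<in>UNIV. \<Sum>j\<in>UNIV. W i j * (\<Sum>l\<in>UNIV. (\<Sum>k\<in>UNIV. I j k * \<Gamma> k l) * I l i))"
      unfolding sum_distrib_left sum_distrib_right
    proof (intro sum.cong refl)
      fix i j l k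
      show "I j k * I i l * W i j * \<Gamma> k l = W i j * (I j k * \<Gamma> k l * I l i)"
        using I[of i l] by simp
    qed
    finally show ?thesis .
  qed
  finally show ?thesis by simp
qed

locale metric_field =
  fixes h :: "real ^ 'n::finite \<Rightarrow> real ^ 'n ^ 'n"
  assumes smooth_h: "smooth (\<lambda>x. h x $ i $ j)"
    and periodic_h: "lattice_rel x y \<Longrightarrow> h x = h y"
    and sym_h: "h x $ i $ j = h x $ j $ i"
    and pos_h: "v \<noteq> 0 \<Longrightarrow> v \<bullet> (h x *v v) > 0"
    and curv_h: "curv h x = 0"
begin

lemma det_h: "det (h x) \<noteq> 0"
  by (rule det_nz_posdef) (rule pos_h)

definition hinv :: "real ^ 'n \<Rightarrow> 'n \<Rightarrow> 'n \<Rightarrow> real" where "hinv x i j = matrix_inv (h x) $ i $ j"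

text \<open>Only the second-order part of the Laplacian in coordinates. The first-order terms are
  counted in the lower-order part \<open>F\<close> of the curvature.\<close>

abbreviation lap :: "(real ^ 'n \<Rightarrow> real) \<Rightarrow> real ^ 'n \<Rightarrow> real" where
  "lap q x \<equiv> \<Sum>i\<in>UNIV. \<Sum>j\<in>UNIV. hinv x i j * partial i (partial j q) x"
abbreviation grad2 :: "(real ^ 'n \<Rightarrow> real) \<Rightarrow> real ^ 'n \<Rightarrow> real" where
  "grad2 q x \<equiv> \<Sum>i\<in>UNIV. \<Sum>j\<in>UNIV. hinv x i j * (partial i q x * partial j q x)"

lemma smooth_hinv: "smooth (\<lambda>x. hinv x i j)"
  unfolding hinv_def by (rule smooth_matrix_inv[OF smooth_h det_h])

lemma sum_hinv: "(\<Sum>k\<in>UNIV. hinv x i k * h x $ k $ j) = (if i = j then 1 else 0)"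
  "(\<Sum>k\<in>UNIV. h x $ i $ k * hinv x k j) = (if i = j then 1 else 0)"
  unfolding hinv_def by (rule sum_matrix_inv[OF det_h])+

lemma sym_hinv: "hinv x i j = hinv x j i"
proof -
  have "hinv x i j = (\<Sum>k\<in>UNIV. (\<Sum>l\<in>UNIV. hinv x j l * h x $ l $ k) * hinv x i k)"
    by (simp add: sum_hinv) (subst sum.remove[of _ j]; auto intro!: sum.neutral)
  also have "\<dots> = (\<Sum>k\<in>UNIV. \<Sum>l\<in>UNIV. hinv x j l * (hinv x i k * h x $ k $ l))"
    unfolding sum_distrib_right
  proof (intro sum.cong refl)
    show "hinv x j l * h x $ l $ k * hinv x i k = hinv x j l * (hinv x i k * h x $ k $ l)" for k l
      using sym_h[of x l k] by simp
  qed
  also have "\<dots> = (\<Sum>l\<in>UNIV. hinv x j l * (\<Sum>k\<in>UNIV. hinv x i k * h x $ k $ l))"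
    by (subst sum.swap) (simp add: sum_distrib_left)
  also have "\<dots> = hinv x j i"
    by (simp add: sum_hinv) (subst sum.remove[of _ i]; auto intro!: sum.neutral)
  finally show ?thesis .
qed

end

locale line_field = metric_field h for h :: "real ^ 'n::finite \<Rightarrow> real ^ 'n ^ 'n" +
  fixes u :: "real ^ 'n" and b :: "real ^ 'n \<Rightarrow> real" and \<beta> :: real
  assumes u_nz: "u \<noteq> 0" and smooth_b: "smooth b"
begin

abbreviation hess_u :: "(real ^ 'n \<Rightarrow> real) \<Rightarrow> real ^ 'n \<Rightarrow> real" where
  "hess_u q x \<equiv> \<Sum>i\<in>UNIV. \<Sum>j\<in>UNIV. u $ i * u $ j * partial i (partial j q) x"

definition \<nu> :: "real ^ 'n \<Rightarrow> 'n \<Rightarrow> real" where "\<nu> x i = (\<Sum>j\<in>UNIV. h x $ i $ j * u $ j)"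
definition c :: "real ^ 'n \<Rightarrow> real" where "c x = (\<Sum>i\<in>UNIV. u $ i * \<nu> x i)"
definition \<tau> :: "real ^ 'n \<Rightarrow> 'n \<Rightarrow> 'n \<Rightarrow> real" where "\<tau> x i j = \<nu> x i * \<nu> x j / c x"
definition H :: "real ^ 'n \<Rightarrow> 'n \<Rightarrow> 'n \<Rightarrow> real" where "H x i j = h x $ i $ j - \<tau> x i j"
definition G where "G x t i j = exp (2 * \<beta> * t) * H x i j + exp (2 * b x * t) * \<tau> x i j"
text \<open>The tensor \<open>u \<otimes> u / c\<close> inverts \<open>\<tau>\<close> on the line
  spanned by \<open>u\<close>, so the two blocks of \<open>G\<close> are inverted
  separately.\<close>

definition Ginv where
  "Ginv x t i j = exp (- 2 * \<beta> * t) * (hinv x i j - u $ i * u $ j / c x) + exp (- 2 * b x * t) * (u $ i * u $ j / c x)"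
text \<open>The suffixes stand for derivatives in the parameter \<open>t\<close> and in the position
  at fixed \<open>t\<close>. The value of the profile is later substituted for \<open>t\<close>, and
  a total derivative is then a sum of both kinds.\<close>

definition Gt where "Gt x t i j = 2 * \<beta> * exp (2 * \<beta> * t) * H x i j + 2 * b x * exp (2 * b x * t) * \<tau> x i j"
definition Gtt where "Gtt x t i j = 4 * \<beta>\<^sup>2 * exp (2 * \<beta> * t) * H x i j + 4 * (b x)\<^sup>2 * exp (2 * b x * t) * \<tau> x i j"
definition Gx where "Gx x t a i j = exp (2 * \<beta> * t) * partial a (\<lambda>x. H x i j) x
   + exp (2 * b x * t) * (2 * partial a b x * t * \<tau> x i j + partial a (\<lambda>x. \<tau> x i j) x)"
definition Gxt where "Gxt x t a i j = 2 * \<beta> * exp (2 * \<beta> * t) * partial a (\<lambda>x. H x i j) x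
   + exp (2 * b x * t) * (2 * b x * (2 * partial a b x * t * \<tau> x i j + partial a (\<lambda>x. \<tau> x i j) x) + 2 * partial a b x * \<tau> x i j)"
definition Gxx where "Gxx x t a k i j = exp (2 * \<beta> * t) * partial a (partial k (\<lambda>x. H x i j)) x
   + exp (2 * b x * t) * (2 * partial a b x * t * (2 * partial k b x * t * \<tau> x i j + partial k (\<lambda>x. \<tau> x i j) x)
     + 2 * partial a (partial k b) x * t * \<tau> x i j + 2 * partial k b x * t * partial a (\<lambda>x. \<tau> x i j) x
     + partial a (partial k (\<lambda>x. \<tau> x i j)) x)"

section \<open>Algebra of the splitting into the direction \<open>u\<close> and its orthogonal
  complement\<close>

lemma c_pos: "c x > 0"
proof -
  have "c x = u \<bullet> (h x *v u)" by (simp add: c_def \<nu>_def inner_vec_def matrix_vector_mult_def)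
  then show ?thesis using pos_h[OF u_nz] by simp
qed

lemma c_nz [simp]: "c x \<noteq> 0" using c_pos[of x] by simp

lemma smooth_\<nu>: "smooth (\<lambda>x. \<nu> x i)" unfolding \<nu>_def by (intro smooth_intros smooth_h)
lemma smooth_c: "smooth c" unfolding c_def by (intro smooth_intros smooth_\<nu>)
lemma smooth_\<tau>: "smooth (\<lambda>x. \<tau> x i j)" unfolding \<tau>_def by (intro smooth_intros smooth_\<nu> smooth_c) simp
lemma smooth_H: "smooth (\<lambda>x. H x i j)" unfolding H_def by (intro smooth_intros smooth_h smooth_\<tau>)

lemma sym_\<tau>: "\<tau> x i j = \<tau> x j i" by (simp add: \<tau>_def)
lemma sym_H: "H x i j = H x j i" using sym_\<tau>[of x i j] sym_h[of x i j] by (simp add: H_def)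
lemma sym_Gt: "Gt x t i j = Gt x t j i" using sym_\<tau>[of x i j] sym_H[of x i j] by (simp add: Gt_def)
lemma sym_Ginv: "Ginv x t i j = Ginv x t j i" using sym_hinv[of x i j] by (simp add: Ginv_def mult.commute)

lemma sum_hinv_\<nu>: "(\<Sum>k\<in>UNIV. hinv x i k * \<nu> x k) = u $ i"
proof -
  have "(\<Sum>k\<in>UNIV. hinv x i k * \<nu> x k) = (\<Sum>j\<in>UNIV. (\<Sum>k\<in>UNIV. hinv x i k * h x $ k $ j) * u $ j)"
    unfolding \<nu>_def sum_distrib_left sum_distrib_right by (subst sum.swap) (simp add: ac_simps)
  also have "\<dots> = u $ i"
    by (simp add: sum_hinv) (subst sum.remove[of _ i]; auto intro!: sum.neutral)
  finally show ?thesis .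
qed

lemma sum_u_h: "(\<Sum>k\<in>UNIV. u $ k * h x $ k $ j) = \<nu> x j"
  unfolding \<nu>_def by (intro sum.cong refl) (simp add: sym_h[of x j])

lemma sum_u_\<nu>: "(\<Sum>k\<in>UNIV. u $ k * \<nu> x k) = c x"
  by (simp add: c_def)

lemma sum_\<nu>_hinv: "(\<Sum>k\<in>UNIV. \<nu> x k * hinv x k i) = u $ i"
  using sum_hinv_\<nu>[of x i] by (simp add: sym_hinv[of x i] mult.commute)

text \<open>Both factors are block diagonal for the splitting, so the product combines the identity
  with the projection \<open>u \<otimes> \<nu> / c\<close> onto \<open>u\<close>.\<close>

lemma sum_Ginv_comb:
  "(\<Sum>k\<in>UNIV. Ginv x t i k * (e1 * H x k j + e2 * \<tau> x k j)) =
   (if i = j then exp (- 2 * \<beta> * t) * e1 else 0) + u $ i * \<nu> x j / c x * (exp (- 2 * b x * t) * e2 - exp (- 2 * \<beta> * t) * e1)"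
proof -
  let ?f1 = "exp (- 2 * \<beta> * t)" and ?f2 = "exp (- 2 * b x * t)"
  have "(\<Sum>k\<in>UNIV. Ginv x t i k * (e1 * H x k j + e2 * \<tau> x k j)) =
    (\<Sum>k\<in>UNIV. (?f1 * hinv x i k + ((?f2 - ?f1) * u $ i / c x) * u $ k) * (e1 * h x $ k $ j + ((e2 - e1) * \<nu> x j / c x) * \<nu> x k))"
    by (intro sum.cong refl) (simp add: Ginv_def H_def \<tau>_def field_simps)
  also have "\<dots> = (if i = j then ?f1 * e1 else 0) + u $ i * \<nu> x j / c x * (?f2 * e2 - ?f1 * e1)"
    unfolding sum_expand4 sum_hinv sum_u_h sum_u_\<nu> sum_hinv_\<nu> by (simp add: field_simps)
  finally show ?thesis .
qed

lemma sum_Ginv_G: "(\<Sum>k\<in>UNIV. Ginv x t i k * G x t k j) = (if i = j then 1 else 0)"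
  unfolding G_def sum_Ginv_comb by (simp add: exp_add[symmetric])

lemma sum_Ginv_Gt: "(\<Sum>k\<in>UNIV. Ginv x t i k * Gt x t k j)
    = (if i = j then 2 * \<beta> else 0) + (2 * b x - 2 * \<beta>) * u $ i * \<nu> x j / c x"
  unfolding Gt_def sum_Ginv_comb by (simp add: mult.assoc exp_add[symmetric] exp_minus field_simps)

lemma matrix_inv_G: "matrix_inv (\<chi> i j. G x t i j) $ i $ j = Ginv x t i j"
proof -
  have "(\<chi> i j. Ginv x t i j) ** (\<chi> i j. G x t i j) = mat 1"
    by (simp add: matrix_matrix_mult_def vec_eq_iff mat_def sum_Ginv_G)
  from matrix_inv_eqI[OF this] show ?thesis by simp
qed

lemma sum_\<nu>_Ginv: "(\<Sum>k\<in>UNIV. \<nu> x k * Ginv x t k j) = exp (- 2 * b x * t) * u $ j"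
proof -
  let ?f1 = "exp (- 2 * \<beta> * t)" and ?f2 = "exp (- 2 * b x * t)"
  have "(\<Sum>k\<in>UNIV. \<nu> x k * Ginv x t k j)
     = (\<Sum>k\<in>UNIV. (1 * \<nu> x k + 0 * 0) * (?f1 * hinv x k j + ((?f2 - ?f1) * u $ j / c x) * u $ k))"
    by (intro sum.cong refl) (simp add: Ginv_def field_simps)
  also have "\<dots> = ?f2 * u $ j"
    unfolding sum_expand4 sum_\<nu>_hinv by (simp add: c_def[symmetric] mult.commute[of "\<nu> x _"] sum_u_\<nu>)
      (simp add: field_simps)
  finally show ?thesis .
qed

text \<open>The matrix \<open>W\<close> will be the Hessian of the profile function.\<close>

lemma scal2_line:
  "scal2 (Ginv x t) (\<lambda>a i j l. W a i * Gt x t j l) =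
    - 2 * (\<beta> * (real CARD('n) - 2) + b x) * (\<Sum>i\<in>UNIV. \<Sum>j\<in>UNIV. Ginv x t i j * W i j)
    - 2 * (\<beta> - b x) * exp (- 2 * b x * t) / c x * (\<Sum>i\<in>UNIV. \<Sum>j\<in>UNIV. u $ i * u $ j * W i j)"
proof -
  have X: "(\<Sum>l\<in>UNIV. (\<Sum>k\<in>UNIV. Ginv x t j k * Gt x t k l) * Ginv x t l i)
    = 2 * \<beta> * Ginv x t i j - 2 * (\<beta> - b x) * exp (- 2 * b x * t) / c x * (u $ i * u $ j)" for i j
  proof -
    have "(\<Sum>l\<in>UNIV. (\<Sum>k\<in>UNIV. Ginv x t j k * Gt x t k l) * Ginv x t l i) =
      (\<Sum>l\<in>UNIV. (if j = l then 2 * \<beta> * Ginv x t l i else 0) + (2 * b x - 2 * \<beta>) * u $ j / c x * (\<nu> x l * Ginv x t l i))"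
      unfolding sum_Ginv_Gt by (intro sum.cong refl) (simp add: algebra_simps)
    also have "\<dots> = 2 * \<beta> * Ginv x t j i + (2 * b x - 2 * \<beta>) * u $ j / c x * (exp (- 2 * b x * t) * u $ i)"
      unfolding sum.distrib sum_distrib_left[symmetric] sum_\<nu>_Ginv by simp
    finally show ?thesis by (simp add: sym_Ginv[of x t j] field_simps)
  qed
  \<comment> \<open>This trace and the summand \<open>2 * \<beta> * Ginv\<close> in \<open>X\<close>
    produce the coefficient \<open>2 * \<beta> * n + 2 * b x - 2 * \<beta> - 2 * \<beta>\<close>,
    which is where \<open>n - 2\<close> comes from.\<close>
  have T: "(\<Sum>i\<in>UNIV. \<Sum>k\<in>UNIV. Ginv x t i k * Gt x t k i) = 2 * \<beta> * real CARD('n) + (2 * b x - 2 * \<beta>)"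
  proof -
    have "(\<Sum>i\<in>UNIV. (2 * b x - 2 * \<beta>) * u $ i * \<nu> x i / c x) = (2 * b x - 2 * \<beta>) * (\<Sum>i\<in>UNIV. u $ i * \<nu> x i) / c x"
      by (simp add: sum_distrib_left sum_divide_distrib ac_simps)
    then show ?thesis unfolding sum_Ginv_Gt by (simp add: sum.distrib sum_u_\<nu>)
  qed
  have S: "(\<Sum>i\<in>UNIV. \<Sum>j\<in>UNIV. W i j * (2 * \<beta> * Ginv x t i j - K * (u $ i * u $ j)))
    = 2 * \<beta> * (\<Sum>i\<in>UNIV. \<Sum>j\<in>UNIV. Ginv x t i j * W i j) - K * (\<Sum>i\<in>UNIV. \<Sum>j\<in>UNIV. u $ i * u $ j * W i j)" for K
    by (simp add: sum_distrib_left sum_subtractf algebra_simps)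
  show ?thesis
    unfolding scal2_product[OF sym_Ginv sym_Gt] X T S by (simp add: algebra_simps)
qed

lemma sum_Ginv_W:
  "(\<Sum>i\<in>UNIV. \<Sum>j\<in>UNIV. Ginv x t i j * W i j) =
    exp (- 2 * \<beta> * t) * (\<Sum>i\<in>UNIV. \<Sum>j\<in>UNIV. hinv x i j * W i j)
    + (exp (- 2 * b x * t) - exp (- 2 * \<beta> * t)) / c x * (\<Sum>i\<in>UNIV. \<Sum>j\<in>UNIV. u $ i * u $ j * W i j)"
proof -
  have "Ginv x t i j * W i j = exp (- 2 * \<beta> * t) * (hinv x i j * W i j)
     + (exp (- 2 * b x * t) - exp (- 2 * \<beta> * t)) / c x * (u $ i * u $ j * W i j)" for i j
    by (simp add: Ginv_def field_simps)
  then show ?thesis by (simp add: sum.distrib sum_distrib_left)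
qed

text \<open>Everything in the scalar curvature of the new metric except the Hessian term of
  \<open>w\<close>, as a function of the point, the value \<open>t\<close> and the gradient
  \<open>p\<close> of \<open>w\<close>. With these as independent variables, bounds on compact sets
  hold for all profiles at once.\<close>

definition F where
  "F x t p = scal1 (Ginv x t) (\<lambda>i j l. Gx x t i j l + p i * Gt x t j l)
    + scal2 (Ginv x t) (\<lambda>a i j l. Gxx x t a i j l + p a * Gxt x t i j l + p i * Gxt x t a j l + p a * p i * Gtt x t j l)"

lemma DERIV_G:
  assumes w: "smooth w"
  shows "partial i (\<lambda>y. G y (w y) j l) x = Gx x (w x) i j l + partial i w x * Gt x (w x) j l"
    "partial a (\<lambda>y. Gx y (w y) i j l) x = Gxx x (w x) a i j l + partial a w x * Gxt x (w x) i j l"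
    "partial a (\<lambda>y. Gt y (w y) j l) x = Gxt x (w x) a j l + partial a w x * Gtt x (w x) j l"
proof -
  note d = smooth_DERIV[OF w] smooth_DERIV[OF smooth_b] smooth_DERIV[OF smooth_H] smooth_DERIV[OF smooth_\<tau>]
    smooth_DERIV[OF smooth_partial[OF smooth_b]] smooth_DERIV[OF smooth_partial[OF smooth_H]] smooth_DERIV[OF smooth_partial[OF smooth_\<tau>]]
  show "partial i (\<lambda>y. G y (w y) j l) x = Gx x (w x) i j l + partial i w x * Gt x (w x) j l"
    unfolding G_def
    by (rule partialI, rule DERIV_cong, (rule d derivative_intros)+) (simp add: Gx_def Gt_def algebra_simps)
  show "partial a (\<lambda>y. Gx y (w y) i j l) x = Gxx x (w x) a i j l + partial a w x * Gxt x (w x) i j l"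
    unfolding Gx_def
    by (rule partialI, rule DERIV_cong, (rule d derivative_intros)+) (simp add: Gxx_def Gxt_def algebra_simps)
  show "partial a (\<lambda>y. Gt y (w y) j l) x = Gxt x (w x) a j l + partial a w x * Gtt x (w x) j l"
    unfolding Gt_def
    by (rule partialI, rule DERIV_cong, (rule d derivative_intros)+) (simp add: Gtt_def Gxt_def power2_eq_square algebra_simps)
qed

lemma smooth_G: "smooth w \<Longrightarrow> smooth (\<lambda>x. G x (w x) i j)"
  unfolding G_def by (intro smooth_intros smooth_b smooth_H smooth_\<tau>)
lemma smooth_Gx: "smooth w \<Longrightarrow> smooth (\<lambda>x. Gx x (w x) a i j)"
  unfolding Gx_def by (intro smooth_intros smooth_b smooth_H smooth_\<tau> smooth_partial)
lemma smooth_Gt: "smooth w \<Longrightarrow> smooth (\<lambda>x. Gt x (w x) i j)"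
  unfolding Gt_def by (intro smooth_intros smooth_b smooth_H smooth_\<tau> smooth_partial)

lemma curv_line:
  assumes w: "smooth w"
  shows "curv (\<lambda>x. \<chi> i j. G x (w x) i j) x =
    F x (w x) (\<lambda>i. partial i w x) + scal2 (Ginv x (w x)) (\<lambda>a i j l. partial a (partial i w) x * Gt x (w x) j l)"
proof -
  have 1: "partial i (\<lambda>y. G y (w y) j l) = (\<lambda>x. Gx x (w x) i j l + partial i w x * Gt x (w x) j l)" for i j l
    by (rule ext) (rule DERIV_G[OF w])
  have inv: "(\<lambda>k l. matrix_inv (\<chi> i j. G x (w x) i j) $ k $ l) = Ginv x (w x)"
    by (intro ext matrix_inv_G)
  have 2: "partial a (partial i (\<lambda>y. G y (w y) j l)) x =
     (Gxx x (w x) a i j l + partial a w x * Gxt x (w x) i j l + partial i w x * Gxt x (w x) a j l + partial a w x * partial i w x * Gtt x (w x) j l)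
     + partial a (partial i w) x * Gt x (w x) j l" for a i j l
    unfolding 1
    by (subst partial_add, intro smooth_Gx w, intro smooth_mult smooth_partial smooth_Gt w,
        subst partial_mult, intro smooth_partial w, intro smooth_Gt w)
       (simp add: DERIV_G[OF w] algebra_simps)
  show ?thesis
    unfolding curv_def F_def by (simp only: vec_lambda_beta inv 2) (simp only: 1 scal2_add)
qed

end

section \<open>Quadratic dependence on the gradient\<close>

definition affine_fn :: "(real \<Rightarrow> real) \<Rightarrow> bool" where
  "affine_fn f \<longleftrightarrow> (\<exists>a b. \<forall>s. f s = a + b * s)"
definition quad_fn :: "(real \<Rightarrow> real) \<Rightarrow> bool" where
  "quad_fn f \<longleftrightarrow> (\<exists>a b c. \<forall>s. f s = a + b * s + c * s\<^sup>2)"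

named_theorems quad_intros

lemma affine_fn_const [quad_intros]: "affine_fn (\<lambda>s. c)"
  unfolding affine_fn_def by (rule exI[of _ c], rule exI[of _ 0]) simp
lemma affine_fn_scale [quad_intros]: "affine_fn (\<lambda>s. s * c)"
  unfolding affine_fn_def by (rule exI[of _ 0], rule exI[of _ c]) simp
lemma affine_fn_add [quad_intros]: "affine_fn f \<Longrightarrow> affine_fn g \<Longrightarrow> affine_fn (\<lambda>s. f s + g s)"
  unfolding affine_fn_def
proof (elim exE)
  fix a b a' b' assume "\<forall>s. f s = a + b * s" "\<forall>s. g s = a' + b' * s"
  then show "\<exists>a b. \<forall>s. f s + g s = a + b * s"
    by (intro exI[of _ "a + a'"] exI[of _ "b + b'"]) (simp add: algebra_simps)
qed
lemma affine_fn_cmult [quad_intros]: "affine_fn f \<Longrightarrow> affine_fn (\<lambda>s. c * f s)"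
  unfolding affine_fn_def
proof (elim exE)
  fix a b assume "\<forall>s. f s = a + b * s"
  then show "\<exists>a b. \<forall>s. c * f s = a + b * s"
    by (intro exI[of _ "c * a"] exI[of _ "c * b"]) (simp add: algebra_simps)
qed
lemma affine_fn_multc [quad_intros]: "affine_fn f \<Longrightarrow> affine_fn (\<lambda>s. f s * c)"
  using affine_fn_cmult[of f c] by (simp add: mult.commute)
lemma affine_fn_minus [quad_intros]: "affine_fn f \<Longrightarrow> affine_fn (\<lambda>s. - f s)"
  using affine_fn_cmult[of f "-1"] by simp
lemma affine_fn_diff [quad_intros]: "affine_fn f \<Longrightarrow> affine_fn g \<Longrightarrow> affine_fn (\<lambda>s. f s - g s)"
  using affine_fn_add[OF _ affine_fn_minus, of f g] by simp
lemma affine_fn_sum [quad_intros]: "(\<And>i. i \<in> A \<Longrightarrow> affine_fn (f i)) \<Longrightarrow> affine_fn (\<lambda>s. \<Sum>i\<in>A. f i s)"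
  by (induction A rule: infinite_finite_induct) (auto intro: affine_fn_const affine_fn_add)

lemma quad_fn_affine: "affine_fn f \<Longrightarrow> quad_fn f"
  unfolding affine_fn_def quad_fn_def
proof (elim exE)
  fix a b assume "\<forall>s. f s = a + b * s"
  then show "\<exists>a b c. \<forall>s. f s = a + b * s + c * s\<^sup>2"
    by (intro exI[of _ a] exI[of _ b] exI[of _ 0]) simp
qed
lemma quad_fn_mult: "affine_fn f \<Longrightarrow> affine_fn g \<Longrightarrow> quad_fn (\<lambda>s. f s * g s)"
  unfolding affine_fn_def quad_fn_def
proof (elim exE)
  fix a b a' b' assume "\<forall>s. f s = a + b * s" "\<forall>s. g s = a' + b' * s"
  then show "\<exists>a b c. \<forall>s. f s * g s = a + b * s + c * s\<^sup>2"
    by (intro exI[of _ "a * a'"] exI[of _ "a * b' + b * a'"] exI[of _ "b * b'"])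
       (simp add: algebra_simps power2_eq_square)
qed
lemma quad_fn_add: "quad_fn f \<Longrightarrow> quad_fn g \<Longrightarrow> quad_fn (\<lambda>s. f s + g s)"
  unfolding quad_fn_def
proof (elim exE)
  fix a b c a' b' c' assume "\<forall>s. f s = a + b * s + c * s\<^sup>2" "\<forall>s. g s = a' + b' * s + c' * s\<^sup>2"
  then show "\<exists>a b c. \<forall>s. f s + g s = a + b * s + c * s\<^sup>2"
    by (intro exI[of _ "a + a'"] exI[of _ "b + b'"] exI[of _ "c + c'"]) (simp add: algebra_simps)
qed
lemma quad_fn_cmult: "quad_fn f \<Longrightarrow> quad_fn (\<lambda>s. k * f s)"
  unfolding quad_fn_def
proof (elim exE)
  fix a b c assume "\<forall>s. f s = a + b * s + c * s\<^sup>2"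
  then show "\<exists>a b c. \<forall>s. k * f s = a + b * s + c * s\<^sup>2"
    by (intro exI[of _ "k * a"] exI[of _ "k * b"] exI[of _ "k * c"]) (simp add: algebra_simps)
qed
lemma quad_fn_diff: "quad_fn f \<Longrightarrow> quad_fn g \<Longrightarrow> quad_fn (\<lambda>s. f s - g s)"
  using quad_fn_add[OF _ quad_fn_cmult, of f g "-1"] by simp
lemma quad_fn_sum: "(\<And>i. i \<in> A \<Longrightarrow> quad_fn (f i)) \<Longrightarrow> quad_fn (\<lambda>s. \<Sum>i\<in>A. f i s)"
  by (induction A rule: infinite_finite_induct) (auto intro: quad_fn_affine affine_fn_const quad_fn_add)

text \<open>A quadratic polynomial is determined by its values at 0, 1 and -1, so these bound its
  coefficients.\<close>

lemma quad_fn_bound: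
  assumes q: "quad_fn f" and B: "\<bar>f 0\<bar> \<le> B" "\<bar>f 1\<bar> \<le> B" "\<bar>f (-1)\<bar> \<le> B"
  shows "\<bar>f s - f 0\<bar> \<le> 2 * B * (\<bar>s\<bar> + s\<^sup>2)"
proof -
  obtain a b c where f: "\<And>s. f s = a + b * s + c * s\<^sup>2" using q unfolding quad_fn_def by blast
  have "b = (f 1 - f (-1)) / 2" "c = (f 1 + f (-1)) / 2 - f 0" by (simp_all add: f field_simps)
  then have b: "\<bar>b\<bar> \<le> 2 * B" and c: "\<bar>c\<bar> \<le> 2 * B" using B by (simp_all add: abs_le_iff field_simps)
  have "\<bar>f s - f 0\<bar> = \<bar>b * s + c * s\<^sup>2\<bar>" by (simp add: f)
  also have "\<dots> \<le> \<bar>b\<bar> * \<bar>s\<bar> + \<bar>c\<bar> * s\<^sup>2"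
    by (metis abs_mult abs_power2 abs_triangle_ineq)
  also have "\<dots> \<le> 2 * B * \<bar>s\<bar> + 2 * B * s\<^sup>2"
    using b c by (intro add_mono mult_right_mono) auto
  finally show ?thesis by (simp add: algebra_simps)
qed

lemma affine_fn_chr: "(\<And>i j l. affine_fn (\<lambda>s. D s i j l)) \<Longrightarrow> affine_fn (\<lambda>s. chr I (D s) k i j)"
  unfolding chr_def by (intro quad_intros)

lemma quad_fn_scal1:
  assumes "\<And>i j l. affine_fn (\<lambda>s. D s i j l)"
  shows "quad_fn (\<lambda>s. scal1 I (D s))"
  unfolding scal1_def dchr1_def
  by (intro quad_fn_sum quad_fn_cmult quad_fn_add quad_fn_diff quad_fn_mult quad_intros affine_fn_chr assms)

lemma quad_fn_scal2:
  assumes "\<And>a i j l. quad_fn (\<lambda>s. E s a i j l)"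
  shows "quad_fn (\<lambda>s. scal2 I (E s))"
  unfolding scal2_def dchr2_def
  by (intro quad_fn_sum quad_fn_cmult quad_fn_add quad_fn_diff assms)

lemma continuous_on_scal1:
  fixes I :: "'z::topological_space \<Rightarrow> 'n::finite \<Rightarrow> 'n \<Rightarrow> real"
  assumes "\<And>i j. continuous_on S (\<lambda>z. I z i j)" "\<And>i j l. continuous_on S (\<lambda>z. D z i j l)"
  shows "continuous_on S (\<lambda>z. scal1 (I z) (D z))"
  unfolding scal1_def dchr1_def chr_def by (intro continuous_intros assms)

lemma continuous_on_scal2:
  fixes I :: "'z::topological_space \<Rightarrow> 'n::finite \<Rightarrow> 'n \<Rightarrow> real"
  assumes "\<And>i j. continuous_on S (\<lambda>z. I z i j)" "\<And>a i j l. continuous_on S (\<lambda>z. E z a i j l)"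
  shows "continuous_on S (\<lambda>z. scal2 (I z) (E z))"
  unfolding scal2_def dchr2_def by (intro continuous_intros assms)

lemma smooth_continuous_fst:
  "smooth F \<Longrightarrow> continuous_on S (\<lambda>z. F (fst z))"
  by (rule continuous_on_compose2[OF smooth_continuous[of F UNIV]]) (auto intro: continuous_intros)

context line_field begin

text \<open>Along a ray in \<open>p\<close> the first derivatives of the metric are affine and enter
  \<open>scal1\<close> at most in products of two, while the second derivatives are quadratic and
  enter \<open>scal2\<close> linearly.\<close>

lemma quad_fn_F: "quad_fn (\<lambda>s. F x t (\<lambda>i. s * p i))"
proof -
  have "affine_fn (\<lambda>s. Gx x t i j l + s * p i * Gt x t j l)" for i j l
    by (intro quad_intros)
  moreover have "quad_fn (\<lambda>s. Gxx x t a i j l + s * p a * Gxt x t i j l + s * p i * Gxt x t a j l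
      + s * p a * (s * p i) * Gtt x t j l)" for a i j l
  proof -
    have "affine_fn (\<lambda>s. Gxx x t a i j l + s * p a * Gxt x t i j l + s * p i * Gxt x t a j l)"
      by (intro quad_intros)
    moreover have "quad_fn (\<lambda>s. (s * p a * (s * p i)) * Gtt x t j l)"
      using quad_fn_cmult[OF quad_fn_mult[OF affine_fn_scale affine_fn_scale], of "Gtt x t j l" "p a" "p i"]
      by (simp add: mult.commute)
    ultimately show ?thesis using quad_fn_add quad_fn_affine by blast
  qed
  ultimately show ?thesis
    unfolding F_def by (rule quad_fn_add[OF quad_fn_scal1 quad_fn_scal2])
qed

lemma continuous_on_F:
  "continuous_on S (\<lambda>z. F (fst z) (fst (snd z)) (\<lambda>i. snd (snd z) $ i))"
proof -
  note s = smooth_continuous_fst[OF smooth_b] smooth_continuous_fst[OF smooth_H] smooth_continuous_fst[OF smooth_\<tau>]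
    smooth_continuous_fst[OF smooth_partial[OF smooth_b]] smooth_continuous_fst[OF smooth_partial[OF smooth_H]]
    smooth_continuous_fst[OF smooth_partial[OF smooth_\<tau>]] smooth_continuous_fst[OF smooth_c]
    smooth_continuous_fst[OF smooth_partial[OF smooth_partial[OF smooth_b]]]
    smooth_continuous_fst[OF smooth_partial[OF smooth_partial[OF smooth_H]]]
    smooth_continuous_fst[OF smooth_partial[OF smooth_partial[OF smooth_\<tau>]]]
    smooth_continuous_fst[OF smooth_hinv]
  have 1: "continuous_on S (\<lambda>z. Ginv (fst z) (fst (snd z)) i j)" for i j
    unfolding Ginv_def by (intro continuous_intros s) simp_all
  have 2: "continuous_on S (\<lambda>z. Gx (fst z) (fst (snd z)) a i j)" for a i j
    unfolding Gx_def by (intro continuous_intros s)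
  have 3: "continuous_on S (\<lambda>z. Gt (fst z) (fst (snd z)) i j)" for i j
    unfolding Gt_def by (intro continuous_intros s)
  have 4: "continuous_on S (\<lambda>z. Gtt (fst z) (fst (snd z)) i j)" for i j
    unfolding Gtt_def by (intro continuous_intros s)
  have 5: "continuous_on S (\<lambda>z. Gxt (fst z) (fst (snd z)) a i j)" for a i j
    unfolding Gxt_def by (intro continuous_intros s)
  have 6: "continuous_on S (\<lambda>z. Gxx (fst z) (fst (snd z)) a k i j)" for a k i j
    unfolding Gxx_def by (intro continuous_intros s)
  show ?thesis
    unfolding F_def
    by (intro continuous_on_add continuous_on_scal1 continuous_on_scal2 continuous_on_mult 1 2 3 4 5 6)
       (intro continuous_intros)+
qed

text \<open>A quadratic polynomial in \<open>p\<close> is controlled by its values on the unit ball.\<close>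

lemma F_diff_bound:
  assumes "compact K"
  obtains C where "C \<ge> 0"
    "\<And>x t p. x \<in> K \<Longrightarrow> 0 \<le> t \<Longrightarrow> t \<le> 1 \<Longrightarrow>
       \<bar>F x t (\<lambda>i. p $ i) - F x t (\<lambda>i. 0)\<bar> \<le> C * (norm p + (norm p)\<^sup>2)"
proof -
  let ?A = "K \<times> {0..1::real} \<times> (cball 0 1 :: (real ^ 'n) set)"
  let ?F = "\<lambda>z. F (fst z) (fst (snd z)) (\<lambda>i. snd (snd z) $ i)"
  have "compact ?A" by (intro compact_Times assms) auto
  then have "bounded (?F ` ?A)"
    by (intro compact_imp_bounded compact_continuous_image continuous_on_F)
  then obtain B where B: "B > 0" "\<And>z. z \<in> ?A \<Longrightarrow> \<bar>?F z\<bar> \<le> B"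
    unfolding bounded_pos by auto
  show ?thesis
  proof
    show "0 \<le> 2 * B" using B by simp
    fix x and t :: real and p :: "real ^ 'n" assume x: "x \<in> K" "0 \<le> t" "t \<le> 1"
    let ?e = "p /\<^sub>R norm p"
    have e: "norm ?e \<le> 1" by (cases "p = 0") auto
    have "\<bar>F x t (\<lambda>i. norm p * ?e $ i) - F x t (\<lambda>i. 0 * ?e $ i)\<bar> \<le> 2 * B * (\<bar>norm p\<bar> + (norm p)\<^sup>2)"
    proof (rule quad_fn_bound[OF quad_fn_F])
      show "\<bar>F x t (\<lambda>i. 0 * ?e $ i)\<bar> \<le> B" using B(2)[of "(x, t, 0)"] x by simp
      show "\<bar>F x t (\<lambda>i. 1 * ?e $ i)\<bar> \<le> B" using B(2)[of "(x, t, ?e)"] x e by simp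
      show "\<bar>F x t (\<lambda>i. - 1 * ?e $ i)\<bar> \<le> B" using B(2)[of "(x, t, - ?e)"] x e by simp
    qed
    moreover have "(\<lambda>i. norm p * ?e $ i) = (\<lambda>i. p $ i)" by (cases "p = 0") auto
    ultimately show "\<bar>F x t (\<lambda>i. p $ i) - F x t (\<lambda>i. 0)\<bar> \<le> 2 * B * (norm p + (norm p)\<^sup>2)" by simp
  qed
qed

text \<open>The constant profile 0 gives back \<open>h\<close>, whose scalar curvature
  vanishes.\<close>

lemma F_zero: "F x 0 (\<lambda>i. 0) = 0"
proof -
  have "(\<lambda>x. \<chi> i j. G x 0 i j) = h"
    by (intro ext) (simp add: G_def H_def vec_eq_iff)
  moreover have "scal2 (Ginv x 0) (\<lambda>a i j l. 0) = 0"
    by (simp add: scal2_def dchr2_def)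
  moreover have "partial i (\<lambda>x. 0) = (\<lambda>x. 0)" for i :: 'n by (rule ext) simp
  ultimately show ?thesis using curv_line[OF smooth_const[of 0], of x] by (simp add: curv_h)
qed

lemma F0_bound:
  assumes "compact K"
  obtains C where "\<And>x t. x \<in> K \<Longrightarrow> 0 \<le> t \<Longrightarrow> t \<le> 1 \<Longrightarrow> \<bar>F x t (\<lambda>i. 0)\<bar> \<le> C"
proof -
  let ?A = "K \<times> {0..1::real} \<times> {0 :: real ^ 'n}"
  let ?F = "\<lambda>z. F (fst z) (fst (snd z)) (\<lambda>i. snd (snd z) $ i)"
  have "compact ?A" by (intro compact_Times assms) auto
  then have "bounded (?F ` ?A)"
    by (intro compact_imp_bounded compact_continuous_image continuous_on_F)
  then obtain B where B0: "\<forall>y\<in>?F ` ?A. norm y \<le> B"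
    unfolding bounded_iff by blast
  have B: "\<bar>?F z\<bar> \<le> B" if "z \<in> ?A" for z
    using bspec[OF B0 imageI[OF that, of ?F]] unfolding real_norm_def .
  show ?thesis
  proof (rule that)
    fix x t assume "x \<in> K" "0 \<le> t" "t \<le> (1::real)"
    then show "\<bar>F x t (\<lambda>i. 0)\<bar> \<le> B" using B[of "(x, t, 0)"] by simp
  qed
qed

text \<open>Uniform continuity on a compact set, compared with the value 0 at
  \<open>t = 0\<close>.\<close>

lemma F0_small:
  assumes "compact K" "e > 0"
  obtains d where "d > 0" "\<And>x t. x \<in> K \<Longrightarrow> 0 \<le> t \<Longrightarrow> t \<le> 1 \<Longrightarrow> t < d \<Longrightarrow> \<bar>F x t (\<lambda>i. 0)\<bar> < e"
proof -
  let ?A = "K \<times> {0..1::real} \<times> {0 :: real ^ 'n}"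
  let ?F = "\<lambda>z. F (fst z) (fst (snd z)) (\<lambda>i. snd (snd z) $ i)"
  have "compact ?A" by (intro compact_Times assms) auto
  then have "uniformly_continuous_on ?A ?F"
    by (intro compact_uniformly_continuous continuous_on_F)
  then obtain d where d: "d > 0" "\<And>z z'. z \<in> ?A \<Longrightarrow> z' \<in> ?A \<Longrightarrow> dist z' z < d \<Longrightarrow> dist (?F z') (?F z) < e"
    unfolding uniformly_continuous_on_def using assms(2) by metis
  show ?thesis
  proof
    show "d > 0" by fact
    fix x t assume x: "x \<in> K" "0 \<le> t" "t \<le> 1" "t < d"
    then have "dist (?F (x, t, 0)) (?F (x, 0, 0)) < e"
      by (intro d(2)) (auto simp: dist_Pair_Pair)
    then show "\<bar>F x t (\<lambda>i. 0)\<bar> < e" by (simp add: dist_real_def F_zero)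
  qed
qed

end

section \<open>The radial profile\<close>

text \<open>A family that contains \<open>exp (- 1 / t)\<close>, extended by 0, and is closed under
  differentiation: in the variable \<open>y = 1 / t\<close> the derivative replaces \<open>p\<close>
  by \<open>y^2 (p - p')\<close>.\<close>

definition fE :: "real poly \<Rightarrow> real \<Rightarrow> real" where
  "fE p t = (if t > 0 then poly p (1 / t) * exp (- 1 / t) else 0)"

lemma tendsto_poly_exp: "((\<lambda>y. poly p y * exp (- y)) \<longlongrightarrow> (0::real)) at_top"
proof -
  have "((\<lambda>y. \<Sum>i\<le>degree p. coeff p i * (y ^ i / exp y)) \<longlongrightarrow> (\<Sum>i\<le>degree p. coeff p i * 0)) at_top"
    by (intro tendsto_intros tendsto_power_div_exp_0)
  then show ?thesis by (simp add: poly_altdef sum_distrib_right exp_minus divide_inverse mult.assoc)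
qed

lemma tendsto_fE_right: "((\<lambda>t. poly p (1 / t) * exp (- 1 / t)) \<longlongrightarrow> (0::real)) (at_right 0)"
  using filterlim_compose[OF tendsto_poly_exp filterlim_inverse_at_top_right, of p]
  by (simp add: inverse_eq_divide)

lemma DERIV_fE: "(fE p has_real_derivative fE ([:0, 0, 1:] * (p - pderiv p)) t) (at t)"
proof -
  consider "t > 0" | "t < 0" | "t = 0" by linarith
  then show ?thesis
  proof cases
    case 1
    have "((\<lambda>t. poly p (1 / t) * exp (- 1 / t)) has_real_derivative
       fE ([:0, 0, 1:] * (p - pderiv p)) t) (at t)"
      using 1 by (auto intro!: derivative_eq_intros DERIV_chain2[OF poly_DERIV]
          simp: fE_def field_simps power2_eq_square)
    then show ?thesis
    proof (rule has_field_derivative_transform_within_open[of _ _ _ "{0<..}"])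
    qed (use 1 in \<open>auto simp: fE_def\<close>)
  next
    case 2
    have "((\<lambda>t. 0) has_real_derivative fE ([:0, 0, 1:] * (p - pderiv p)) t) (at t)"
      using 2 by (auto simp: fE_def)
    then show ?thesis
    proof (rule has_field_derivative_transform_within_open[of _ _ _ "{..<0}"])
    qed (use 2 in \<open>auto simp: fE_def\<close>)
  next
    case 3
    \<comment> \<open>Division by \<open>s\<close> multiplies the polynomial by its variable
      \<open>1 / s\<close>, so the difference quotient at 0 is again of the form covered by
      \<open>tendsto_fE_right\<close>.\<close>
    have r: "((\<lambda>s. fE p s / s) \<longlongrightarrow> 0) (at_right 0)"
    proof (rule Lim_transform_eventually[OF tendsto_fE_right[of "[:0, 1:] * p"]])
      show "\<forall>\<^sub>F t in at_right 0. poly ([:0, 1:] * p) (1 / t) * exp (- 1 / t) = fE p t / t"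
        by (auto simp: fE_def eventually_at_right_field intro!: exI[of _ 1])
    qed
    have l: "((\<lambda>s. fE p s / s) \<longlongrightarrow> 0) (at_left 0)"
    proof (rule Lim_transform_eventually[OF tendsto_const])
      show "\<forall>\<^sub>F t in at_left 0. 0 = fE p t / t"
        by (auto simp: fE_def eventually_at_left_field intro!: exI[of _ "-1"])
    qed
    have "((\<lambda>s. fE p s / s) \<longlongrightarrow> 0) (at 0)"
      using filterlim_split_at[OF l r] .
    then show ?thesis using 3 by (simp add: has_field_derivative_iff fE_def)
  qed
qed

text \<open>The profile \<open>t e\<^sup>-\<^sup>1\<^sup>/\<^sup>t\<close> is smooth, vanishes for \<open>t \<le> 0\<close> and has slope tending to 1.\<close>

definition prof :: "real \<Rightarrow> real" where "prof t = t * fE 1 t"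
definition prof1 :: "real \<Rightarrow> real" where "prof1 t = fE [:1, 1:] t"
definition prof2 :: "real \<Rightarrow> real" where "prof2 t = fE [:0, 0, 0, 1:] t"

lemma DERIV_prof: "(prof has_real_derivative prof1 t) (at t)"
proof -
  have "(prof has_real_derivative 1 * fE 1 t + fE ([:0, 0, 1:] * (1 - pderiv 1)) t * t) (at t)"
    unfolding prof_def by (intro DERIV_mult DERIV_ident DERIV_fE)
  then show ?thesis
    by (rule DERIV_cong) (auto simp: prof1_def fE_def field_simps)
qed

lemma DERIV_prof1: "(prof1 has_real_derivative prof2 t) (at t)"
proof -
  have "(prof1 has_real_derivative fE ([:0, 0, 1:] * ([:1, 1:] - pderiv [:1, 1:])) t) (at t)"
    unfolding prof1_def by (rule DERIV_fE)
  then show ?thesis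
    by (rule DERIV_cong) (auto simp: prof2_def fE_def pderiv_pCons field_simps)
qed

lemma smooth_fE: "smooth F \<Longrightarrow> smooth (\<lambda>x. fE p (F x))"
proof -
  assume F: "smooth F"
  define P where "P = rec_nat p (\<lambda>_ p. [:0, 0, 1:] * (p - pderiv p))"
  have "(fE (P m) has_real_derivative fE (P (Suc m)) y) (at y)" for m y
    using DERIV_fE[of "P m" y] by (simp add: P_def)
  from smooth_compose[where S = UNIV and \<phi> = "\<lambda>m. fE (P m)", OF this _ F]
  show ?thesis by (simp add: P_def)
qed

lemma smooth_prof: "smooth F \<Longrightarrow> smooth (\<lambda>x. prof (F x))"
  unfolding prof_def by (intro smooth_intros smooth_fE)
lemma prof_nonpos [simp]: "t \<le> 0 \<Longrightarrow> prof t = 0" by (simp add: prof_def fE_def)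
lemma prof_pos: "t > 0 \<Longrightarrow> prof t > 0" by (simp add: prof_def fE_def)
lemma prof_nonneg: "prof t \<ge> 0" using prof_pos[of t] by (cases "t > 0") auto
lemma prof_le: "t \<ge> 0 \<Longrightarrow> prof t \<le> t"
  by (auto simp: prof_def fE_def intro!: mult_left_le)
lemma prof1_nonneg: "prof1 t \<ge> 0" by (simp add: prof1_def fE_def)
lemma prof1_le: "prof1 t \<le> 1"
proof (cases "t > 0")
  case True
  have "(1 + 1 / t) * exp (- 1 / t) \<le> exp (1 / t) * exp (- 1 / t)"
    by (intro mult_right_mono exp_ge_add_one_self) auto
  then show ?thesis using True by (simp add: prof1_def fE_def exp_add[symmetric])
qed (simp add: prof1_def fE_def)
lemma prof_mono: "s \<le> t \<Longrightarrow> prof s \<le> prof t"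
  using DERIV_prof prof1_nonneg by (metis DERIV_nonneg_imp_nondecreasing)
lemma prof_ge: "t \<ge> 1 \<Longrightarrow> prof t \<ge> t / 3"
proof -
  assume t: "t \<ge> 1"
  have "(1::real) / 3 \<le> 1 / exp 1" using exp_le by (simp add: field_simps)
  also have "\<dots> = exp (-1)" by (simp add: exp_minus inverse_eq_divide)
  also have "\<dots> \<le> exp (- 1 / t)" using t by simp
  finally show ?thesis using mult_left_mono[of "1/3" "exp (- 1 / t)" t] t by (simp add: prof_def fE_def)
qed
lemma prof1_ge: "t \<ge> 3 \<Longrightarrow> prof1 t \<ge> 2 / 3"
proof -
  assume t: "t \<ge> 3"
  have "2 / 3 \<le> 1 + (- 1 / t)" using t by (simp add: field_simps)
  also have "\<dots> \<le> exp (- 1 / t)" by (rule exp_ge_add_one_self)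
  also have "\<dots> \<le> (1 + 1 / t) * exp (- 1 / t)" using t by (simp add: field_simps)
  finally show ?thesis using t by (simp add: prof1_def fE_def)
qed
lemma prof2_nonneg: "prof2 t \<ge> 0" by (simp add: prof2_def fE_def)
text \<open>The second derivative of the profile enlarges the unfavourable gradient term. The factor
  18 keeps \<open>19 / 18 * (9 / 2) = 19 / 4\<close> below \<open>11 / 2\<close> in
  \<open>w_lap_inside\<close>.\<close>

lemma prof2_le_prof1: "t \<ge> 3 \<Longrightarrow> 18 * prof2 t \<le> prof1 t"
proof -
  assume t: "t \<ge> 3"
  have y: "0 \<le> 1 / t" "1 / t \<le> 1 / 3" using t by auto
  have "(1 / t) ^ 3 \<le> (1 / 3) ^ 3" by (rule power_mono) (use y in auto)
  then have "18 * (1 / t) ^ 3 \<le> 1" by (simp add: power3_eq_cube)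
  then have "18 * (1 / t) ^ 3 \<le> 1 + 1 / t" using y by linarith
  then have "(18 * (1 / t) ^ 3) * exp (- 1 / t) \<le> (1 + 1 / t) * exp (- 1 / t)" by (intro mult_right_mono) auto
  then show ?thesis using t by (simp add: prof2_def prof1_def fE_def power3_eq_cube mult.assoc)
qed
text \<open>The cube of \<open>y / 3 \<le> exp (y / 3)\<close> with \<open>y = 1 / t\<close> bounds
  \<open>y ^ 3 * exp (- y)\<close> by 27.\<close>

lemma prof2_le: "prof2 t \<le> 27"
proof (cases "t > 0")
  case True
  let ?y = "1 / t"
  have "(?y / 3) ^ 3 \<le> exp (?y / 3) ^ 3"
    using True exp_ge_add_one_self[of "?y / 3"] by (intro power_mono) (auto simp del: exp_ge_add_one_self)
  also have "\<dots> = exp ?y" by (simp add: exp_of_nat_mult[symmetric])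
  finally have "?y ^ 3 \<le> 27 * exp ?y" by (simp add: power_divide)
  then have "?y ^ 3 * exp (- 1 / t) \<le> 27 * exp ?y * exp (- 1 / t)" by (intro mult_right_mono) auto
  also have "\<dots> = 27" by (simp add: mult.assoc exp_add[symmetric])
  finally show ?thesis using True by (simp add: prof2_def fE_def power3_eq_cube mult.assoc)
qed (simp add: prof2_def fE_def)

section \<open>The curvature estimate near one line\<close>

lemma compact_pos_lower_bound:
  fixes f :: "'a::topological_space \<Rightarrow> real"
  assumes "compact K" "continuous_on K f" "\<And>x. x \<in> K \<Longrightarrow> f x > 0"
  obtains m where "m > 0" "\<And>x. x \<in> K \<Longrightarrow> f x \<ge> m"
proof (cases "K = {}")
  case True then show ?thesis using that[of 1] by auto
next
  case False
  then obtain z where "z \<in> K" "\<And>x. x \<in> K \<Longrightarrow> f z \<le> f x"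
    using continuous_attains_inf[OF assms(1) _ assms(2)] by blast
  then show ?thesis using that[of "f z"] assms(3) by auto
qed

lemma compact_abs_bound:
  fixes f :: "'a::topological_space \<Rightarrow> real"
  assumes "compact K" "continuous_on K f"
  obtains C where "C \<ge> 0" "\<And>x. x \<in> K \<Longrightarrow> \<bar>f x\<bar> \<le> C"
proof -
  have "bounded (f ` K)" by (intro compact_imp_bounded compact_continuous_image assms)
  then obtain B where B: "B > 0" "\<forall>y\<in>f ` K. norm y \<le> B" unfolding bounded_pos by blast
  show ?thesis using that[of B] B by auto
qed

text \<open>The inequality of arithmetic and geometric means for
  \<open>\<kappa> * sqrt (C / Q)\<close>. The weight \<open>\<eta>\<close> will be chosen so small
  that the part of order \<open>\<kappa> / Q\<close> is absorbed by the positive curvature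
  term.\<close>

lemma mixed_sum_le:
  fixes \<kappa> :: real
  assumes "N\<^sup>2 \<le> \<kappa>\<^sup>2 * C / Q" "Q > 0" "\<kappa> \<ge> 0" "\<eta> > 0"
  shows "N \<le> \<kappa> * (\<eta> / Q + C / (4 * \<eta>))"
proof (cases "C \<ge> 0")
  case True
  have "4 * a * b \<le> (a + b)\<^sup>2" for a b :: real
    using zero_le_power2[of "a - b"] by (simp add: power2_eq_square algebra_simps)
  then have "4 * (\<eta> / Q) * (C / (4 * \<eta>)) \<le> (\<eta> / Q + C / (4 * \<eta>))\<^sup>2" .
  moreover have "4 * (\<eta> / Q) * (C / (4 * \<eta>)) = C / Q" using assms by simp
  ultimately have "\<kappa>\<^sup>2 * (C / Q) \<le> \<kappa>\<^sup>2 * (\<eta> / Q + C / (4 * \<eta>))\<^sup>2"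
    by (intro mult_left_mono) auto
  with assms have "N\<^sup>2 \<le> (\<kappa> * (\<eta> / Q + C / (4 * \<eta>)))\<^sup>2" by (simp add: power_mult_distrib)
  then show ?thesis
    by (rule power2_le_imp_le) (use assms True in auto)
next
  case False
  then have "\<kappa>\<^sup>2 * C / Q \<le> 0" using assms by (simp add: divide_nonpos_pos mult_nonneg_nonpos)
  with assms(1) have "N\<^sup>2 \<le> 0" by linarith
  then have N: "N = 0" by simp
  show ?thesis
  proof (cases "\<kappa> = 0")
    case False
    with assms have "\<kappa>\<^sup>2 * C / Q < 0" using \<open>\<not> 0 \<le> C\<close> by (simp add: divide_neg_pos mult_pos_neg)
    with assms(1) N show ?thesis by simp
  qed (simp add: N)
qed

text \<open>Abstract properties of a squared distance to the line. For the function
  \<open>qf\<close> used later, \<open>lap\<close> is \<open>2 * (n - 1) \<ge> 6\<close> on the line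
  and \<open>grad2\<close> is close to \<open>4 * q\<close>; the constants \<open>11 / 2\<close> and
  \<open>9 / 2\<close> give away a little of both so as to hold for \<open>q < \<delta>\<close>. The
  lower bound on \<open>\<beta>\<close> makes the leading coefficient
  \<open>2 * (\<beta> * (n - 2) + b x)\<close> at least 2.\<close>

locale tube = line_field h u b \<beta> for h :: "real ^ 'n::finite \<Rightarrow> real ^ 'n ^ 'n" and u b \<beta> +
  fixes q :: "real ^ 'n \<Rightarrow> real" and K :: "(real ^ 'n) set" and M Cq \<delta> :: real
  assumes smooth_q: "smooth q" and q_nonneg: "q x \<ge> 0" and compact_K: "compact K"
    and b_range: "- M \<le> b x" "b x \<le> 0"
    and \<beta>: "\<beta> \<ge> 0" "\<beta> * (real CARD('n) - 2) \<ge> M + 1"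
    and Cq: "Cq \<ge> 0"
    and q_grad: "x \<in> K \<Longrightarrow> (\<Sum>i\<in>UNIV. (partial i q x)\<^sup>2) \<le> Cq * q x"
    and q_u: "x \<in> K \<Longrightarrow> \<bar>\<Sum>i\<in>UNIV. u $ i * partial i q x\<bar> \<le> Cq * q x"
    and q_uu: "x \<in> K \<Longrightarrow> \<bar>hess_u q x\<bar> \<le> Cq * q x"
    and \<delta>: "\<delta> > 0"
    and q_lap: "x \<in> K \<Longrightarrow> q x < \<delta> \<Longrightarrow> (lap q x) \<ge> 11 / 2"
    and q_hgrad: "x \<in> K \<Longrightarrow> q x < \<delta> \<Longrightarrow> (grad2 q x) \<le> 9 / 2 * q x"
begin

text \<open>The shift by \<open>\<delta> * exp (- L)\<close> truncates the logarithm: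
  \<open>T\<close> is \<open>ln (\<delta> / Q)\<close>, equal to \<open>L\<close> where
  \<open>q\<close> vanishes and nonpositive where \<open>Q \<ge> \<delta>\<close>. Composition with
  \<open>prof\<close> smooths the cut-off at \<open>T = 0\<close>.\<close>

definition Q :: "real \<Rightarrow> real ^ 'n \<Rightarrow> real" where "Q L x = q x + \<delta> * exp (- L)"
definition T :: "real \<Rightarrow> real ^ 'n \<Rightarrow> real" where "T L x = ln \<delta> - ln (Q L x)"
definition w :: "real \<Rightarrow> real ^ 'n \<Rightarrow> real" where "w L x = (1 / prof L) * prof (T L x)"

abbreviation metric :: "real \<Rightarrow> real ^ 'n \<Rightarrow> real ^ 'n ^ 'n" where
  "metric L \<equiv> \<lambda>x. \<chi> i j. G x (w L x) i j"

lemma Q_pos: "Q L x > 0" using q_nonneg[of x] \<delta> by (simp add: Q_def add_nonneg_pos)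

lemma smooth_Q: "smooth (Q L)" unfolding Q_def by (intro smooth_intros smooth_q)
lemma smooth_T: "smooth (T L)" unfolding T_def by (intro smooth_intros smooth_Q Q_pos)
lemma smooth_w: "smooth (w L)" unfolding w_def by (intro smooth_intros smooth_prof smooth_T)

lemma T_le: "T L x \<le> L"
proof -
  have "ln (\<delta> * exp (- L)) \<le> ln (Q L x)"
    using q_nonneg[of x] \<delta> by (subst ln_le_cancel_iff) (auto simp: Q_def add_nonneg_pos)
  then show ?thesis using \<delta> by (simp add: T_def ln_mult)
qed

lemma w_range: "L > 0 \<Longrightarrow> 0 \<le> w L x" "L > 0 \<Longrightarrow> w L x \<le> 1"
proof -
  assume L: "L > 0"
  show "0 \<le> w L x" using prof_nonneg by (simp add: w_def)
  have "prof (T L x) \<le> prof L" by (rule prof_mono[OF T_le])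
  then show "w L x \<le> 1" using prof_pos[OF L] by (simp add: w_def divide_simps)
qed

lemma w_core: "L > 0 \<Longrightarrow> q x = 0 \<Longrightarrow> w L x = 1"
  using prof_pos[of L] \<delta> by (simp add: w_def T_def Q_def ln_mult)

lemma w_outside: "Q L x \<ge> \<delta> \<Longrightarrow> w L x = 0"
proof -
  assume "Q L x \<ge> \<delta>"
  then have "ln \<delta> \<le> ln (Q L x)" using \<delta> Q_pos[of L x] by simp
  then show ?thesis by (simp add: w_def T_def)
qed

lemma DERIV_Q: "((\<lambda>t. Q L (x + t *\<^sub>R axis i 1)) has_real_derivative partial i q x) (at 0)"
  using DERIV_add[OF smooth_DERIV[OF smooth_q, of x i] DERIV_const[of "\<delta> * exp (- L)"]]
  by (simp add: Q_def)

lemma partial_T: "partial i (T L) x = - (partial i q x / Q L x)"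
proof -
  have "((\<lambda>t. ln \<delta> - ln (Q L (x + t *\<^sub>R axis i 1))) has_real_derivative - (partial i q x / Q L x)) (at 0)"
    by (rule DERIV_cong, (rule DERIV_Q derivative_intros)+) (use Q_pos[of L x] DERIV_Q in auto)
  then show ?thesis unfolding T_def by (rule partialI)
qed

lemma partial_w: "partial i (w L) x = (1 / prof L) * (prof1 (T L x) * - (partial i q x / Q L x))"
proof -
  have "((\<lambda>t. prof (T L (x + t *\<^sub>R axis i 1))) has_real_derivative prof1 (T L x) * - (partial i q x / Q L x)) (at 0)"
    using DERIV_chain2[OF _ smooth_DERIV[OF smooth_T], of prof "prof1 (T L x)" L x i] DERIV_prof[of "T L x"]
    by (simp add: partial_T)
  then show ?thesis unfolding w_def by (intro partialI DERIV_cmult)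
qed

lemma partial2_w: "partial a (partial i (w L)) x =
   (1 / prof L) * ((prof2 (T L x) + prof1 (T L x)) / (Q L x)\<^sup>2 * (partial a q x * partial i q x)
      - prof1 (T L x) / Q L x * partial a (partial i q) x)"
proof -
  have e: "partial i (w L) = (\<lambda>x. (1 / prof L) * (prof1 (T L x) * - (partial i q x / Q L x)))"
    by (rule ext) (rule partial_w)
  have 1: "((\<lambda>t. prof1 (T L (x + t *\<^sub>R axis a 1))) has_real_derivative prof2 (T L x) * - (partial a q x / Q L x)) (at 0)"
    using DERIV_chain2[OF _ smooth_DERIV[OF smooth_T], of prof1 "prof2 (T L x)" L x a] DERIV_prof1[of "T L x"]
    by (simp add: partial_T)
  note 2 = DERIV_Q
  note 3 = smooth_DERIV[OF smooth_partial[OF smooth_q]]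
  show ?thesis
    unfolding e
    by (rule partialI, rule DERIV_cong, (rule 1 2 3 derivative_intros)+)
       (use Q_pos[of L x] in \<open>cases "prof L = 0"; simp add: field_simps power2_eq_square\<close>)+
qed

lemma sum_partial2_w:
  "(\<Sum>i\<in>UNIV. \<Sum>j\<in>UNIV. A i j * partial i (partial j (w L)) x) =
   (1 / prof L) * ((prof2 (T L x) + prof1 (T L x)) / (Q L x)\<^sup>2 * (\<Sum>i\<in>UNIV. \<Sum>j\<in>UNIV. A i j * (partial i q x * partial j q x))
      - prof1 (T L x) / Q L x * (\<Sum>i\<in>UNIV. \<Sum>j\<in>UNIV. A i j * partial i (partial j q) x))"
proof -
  have "A i j * partial i (partial j (w L)) x = (1 / prof L) * ((prof2 (T L x) + prof1 (T L x)) / (Q L x)\<^sup>2 * (A i j * (partial i q x * partial j q x))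
      - prof1 (T L x) / Q L x * (A i j * partial i (partial j q) x))" for i j
    by (simp add: partial2_w algebra_simps)
  then show ?thesis by (simp only: sum_distrib_left[symmetric] sum_subtractf)
qed

text \<open>The gradient of \<open>q\<close> is of order \<open>sqrt q\<close>, so that of
  \<open>ln Q\<close> is of order \<open>1 / sqrt Q\<close>. The squared gradient of
  \<open>w\<close> thus has the order \<open>1 / Q\<close> of the Laplacian, but with one more
  factor \<open>1 / prof L\<close>.\<close>

lemma norm_grad_w:
  assumes "x \<in> K" "L > 0"
  shows "(norm (\<chi> i. partial i (w L) x))\<^sup>2 \<le> (1 / prof L)\<^sup>2 * Cq / Q L x"
proof -
  have "(norm (\<chi> i. partial i (w L) x))\<^sup>2 = (\<Sum>i\<in>UNIV. (partial i (w L) x)\<^sup>2)"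
    unfolding norm_eq_sqrt_inner inner_vec_def by (simp add: sum_nonneg power2_eq_square)
  also have "\<dots> = (1 / prof L)\<^sup>2 * ((prof1 (T L x))\<^sup>2 / (Q L x)\<^sup>2 * (\<Sum>i\<in>UNIV. (partial i q x)\<^sup>2))"
    by (simp add: partial_w sum_distrib_left power_mult_distrib power_divide)
  also have "\<dots> \<le> (1 / prof L)\<^sup>2 * (1 / (Q L x)\<^sup>2 * (Cq * Q L x))"
  proof (intro mult_left_mono mult_mono)
    show "(prof1 (T L x))\<^sup>2 / (Q L x)\<^sup>2 \<le> 1 / (Q L x)\<^sup>2"
      using prof1_le[of "T L x"] prof1_nonneg[of "T L x"] by (intro divide_right_mono power_le_one) auto
    have "Cq * q x \<le> Cq * Q L x" using Cq \<delta> by (intro mult_left_mono) (auto simp: Q_def)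
    then show "(\<Sum>i\<in>UNIV. (partial i q x)\<^sup>2) \<le> Cq * Q L x" using q_grad[OF assms(1)] by linarith
  qed (auto intro: sum_nonneg)
  also have "\<dots> = (1 / prof L)\<^sup>2 * Cq / Q L x" using Q_pos[of L x] by (simp add: power2_eq_square)
  finally show ?thesis .
qed

lemma prof12_le: "prof2 t + prof1 t \<le> 28" "0 \<le> prof2 t + prof1 t"
  using prof2_le[of t] prof1_le[of t] prof2_nonneg[of t] prof1_nonneg[of t] by linarith+

text \<open>Along \<open>u\<close> the first and second derivatives of \<open>q\<close> are of order
  \<open>q\<close>, so the second derivative of \<open>ln Q\<close> along \<open>u\<close> stays
  bounded. Hence the \<open>u\<close>-Hessian terms of the curvature are errors of order
  \<open>1 / prof L\<close>, without a factor \<open>1 / Q\<close>.\<close>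

lemma w_uu:
  assumes "x \<in> K" "L > 0"
  shows "\<bar>hess_u (w L) x\<bar> \<le> (1 / prof L) * (28 * Cq\<^sup>2 + Cq)"
proof -
  let ?p1 = "prof1 (T L x)" and ?p2 = "prof2 (T L x)" and ?Q = "Q L x"
  define X where "X = (\<Sum>i\<in>UNIV. \<Sum>j\<in>UNIV. u $ i * u $ j * (partial i q x * partial j q x))"
  define Y where "Y = (hess_u q x)"
  have Q: "q x \<le> ?Q" "0 < ?Q" using \<delta> Q_pos by (auto simp: Q_def)
  have "X = (\<Sum>i\<in>UNIV. u $ i * partial i q x) * (\<Sum>i\<in>UNIV. u $ i * partial i q x)"
    unfolding X_def sum_product by (intro sum.cong refl) (simp add: ac_simps)
  then have "X = (\<Sum>i\<in>UNIV. u $ i * partial i q x)\<^sup>2" by (simp add: power2_eq_square)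
  also have "\<dots> \<le> (Cq * ?Q)\<^sup>2"
  proof (rule abs_le_square_iff[THEN iffD1])
    have "Cq * q x \<le> Cq * ?Q" using Cq Q by (intro mult_left_mono) auto
    then show "\<bar>\<Sum>i\<in>UNIV. u $ i * partial i q x\<bar> \<le> \<bar>Cq * ?Q\<bar>" using q_u[OF assms(1)] by linarith
  qed
  finally have X: "X \<le> Cq\<^sup>2 * ?Q\<^sup>2" by (simp add: power_mult_distrib)
  have X0: "0 \<le> X" using \<open>X = (\<Sum>i\<in>UNIV. u $ i * partial i q x)\<^sup>2\<close> by simp
  have Y: "\<bar>Y\<bar> \<le> Cq * ?Q"
    using q_uu[OF assms(1)] mult_left_mono[OF Q(1) Cq] by (simp add: Y_def)
  have "\<bar>(?p2 + ?p1) / ?Q\<^sup>2 * X\<bar> \<le> 28 / ?Q\<^sup>2 * (Cq\<^sup>2 * ?Q\<^sup>2)"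
    using prof12_le[of "T L x"] X X0 by (simp only: abs_mult) (intro mult_mono; simp add: divide_right_mono)
  also have "\<dots> = 28 * Cq\<^sup>2" using Q by simp
  finally have 1: "\<bar>(?p2 + ?p1) / ?Q\<^sup>2 * X\<bar> \<le> 28 * Cq\<^sup>2" .
  have "\<bar>?p1 / ?Q * Y\<bar> \<le> 1 / ?Q * (Cq * ?Q)"
    using prof1_le[of "T L x"] prof1_nonneg[of "T L x"] Y Q
    by (simp only: abs_mult) (intro mult_mono; simp add: divide_right_mono)
  also have "\<dots> = Cq" using Q by simp
  finally have 2: "\<bar>?p1 / ?Q * Y\<bar> \<le> Cq" .
  have "\<bar>(?p2 + ?p1) / ?Q\<^sup>2 * X - ?p1 / ?Q * Y\<bar> \<le> 28 * Cq\<^sup>2 + Cq" using 1 2 by linarith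
  then show ?thesis
    unfolding sum_partial2_w X_def[symmetric] Y_def[symmetric]
    using prof_pos[OF assms(2)] by (simp add: abs_mult divide_right_mono)
qed

text \<open>Superharmonicity. With \<open>p1\<close> and \<open>p2\<close> for the derivatives of
  \<open>prof\<close>, and up to the factor \<open>1 / prof L\<close>, the gradient part is at most
  \<open>19 / 4 * (p1 / Q)\<close> and the Laplacian part at least \<open>11 / 2 * (p1 / Q)\<close>.
  The difference \<open>3 / 4 * (p1 / Q)\<close> is at least \<open>1 / (2 * Q)\<close> because
  \<open>p1 \<ge> 2 / 3\<close>.\<close>

lemma w_lap_inside:
  assumes "x \<in> K" "L > 0" "T L x \<ge> 3"
  shows "(lap (w L) x) \<le> - (1 / prof L) / (2 * Q L x)"
proof -
  let ?p1 = "prof1 (T L x)" and ?p2 = "prof2 (T L x)" and ?Q = "Q L x"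
  define X where "X = (grad2 q x)"
  define Y where "Y = (lap q x)"
  have Q: "q x \<le> ?Q" "0 < ?Q" using \<delta> Q_pos by (auto simp: Q_def)
  have "ln ?Q < ln \<delta>" using assms(3) by (simp add: T_def)
  then have "?Q < \<delta>" using Q \<delta> by simp
  then have q: "q x < \<delta>" using Q by simp
  have X: "X \<le> 9 / 2 * ?Q" using q_hgrad[OF assms(1) q] Q by (simp add: X_def)
  have Y: "Y \<ge> 11 / 2" using q_lap[OF assms(1) q] by (simp add: Y_def)
  have p: "2 / 3 \<le> ?p1" "?p2 \<le> ?p1 / 18" "0 \<le> ?p2"
    using prof1_ge[OF assms(3)] prof2_le_prof1[OF assms(3)] prof2_nonneg by simp_all
  have "(?p2 + ?p1) / ?Q\<^sup>2 * X \<le> (?p2 + ?p1) / ?Q\<^sup>2 * (9 / 2 * ?Q)"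
    using p X by (intro mult_left_mono) auto
  also have "\<dots> \<le> (19 / 18 * ?p1) / ?Q\<^sup>2 * (9 / 2 * ?Q)"
    using p Q by (intro mult_right_mono divide_right_mono) auto
  also have "\<dots> = 19 / 4 * (?p1 / ?Q)" using Q by (simp add: power2_eq_square)
  finally have 1: "(?p2 + ?p1) / ?Q\<^sup>2 * X \<le> 19 / 4 * (?p1 / ?Q)" .
  have 2: "?p1 / ?Q * (11 / 2) \<le> ?p1 / ?Q * Y"
    using p Q Y by (intro mult_left_mono) auto
  have 3: "(2 / 3) / ?Q \<le> ?p1 / ?Q" using p Q by (intro divide_right_mono) auto
  have "(?p2 + ?p1) / ?Q\<^sup>2 * X - ?p1 / ?Q * Y \<le> - (1 / (2 * ?Q))"
  proof -
    have "(2 / 3) / ?Q = 4 / 3 * (1 / (2 * ?Q))" by simp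
    then show ?thesis using 1 2 3 by argo
  qed
  from mult_left_mono[OF this, of "1 / prof L"] show ?thesis
    unfolding sum_partial2_w X_def[symmetric] Y_def[symmetric]
    using prof_pos[OF assms(2)] by simp
qed

text \<open>For \<open>T \<le> 3\<close> the second derivative of \<open>prof\<close> may dominate
  and no sign is available. But there \<open>Q\<close> is at least
  \<open>\<delta> * exp (- 3)\<close>, so everything apart from the factor \<open>1 / prof L\<close>
  is bounded on \<open>K\<close>.\<close>

lemma w_lap_outside:
  obtains C where "C \<ge> 0" "\<And>x L. x \<in> K \<Longrightarrow> L > 0 \<Longrightarrow> T L x \<le> 3 \<Longrightarrow>
     \<bar>lap (w L) x\<bar> \<le> (1 / prof L) * C"
proof -
  have "continuous_on K (\<lambda>x. grad2 q x)"
    by (intro smooth_continuous smooth_intros smooth_hinv smooth_partial smooth_q)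
  then obtain C1 where C1: "C1 \<ge> 0" "\<And>x. x \<in> K \<Longrightarrow> \<bar>grad2 q x\<bar> \<le> C1"
    using compact_abs_bound[OF compact_K] by blast
  have "continuous_on K (\<lambda>x. lap q x)"
    by (intro smooth_continuous smooth_intros smooth_hinv smooth_partial smooth_q)
  then obtain C2 where C2: "C2 \<ge> 0" "\<And>x. x \<in> K \<Longrightarrow> \<bar>lap q x\<bar> \<le> C2"
    using compact_abs_bound[OF compact_K] by blast
  define r where "r = \<delta> * exp (- 3)"
  have r: "r > 0" using \<delta> by (simp add: r_def)
  show ?thesis
  proof
    show "0 \<le> 28 / r\<^sup>2 * C1 + 1 / r * C2" using C1 C2 r by simp
    fix x L assume x: "x \<in> K" "L > (0::real)" "T L x \<le> 3"
    let ?p1 = "prof1 (T L x)" and ?p2 = "prof2 (T L x)" and ?Q = "Q L x"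
    have "ln r \<le> ln ?Q" using x(3) \<delta> by (simp add: r_def T_def ln_mult)
    then have rQ: "r \<le> ?Q" using r Q_pos[of L x] by simp
    define X where "X = (grad2 q x)"
    define Y where "Y = (lap q x)"
    have "\<bar>(?p2 + ?p1) / ?Q\<^sup>2 * X\<bar> \<le> 28 / r\<^sup>2 * C1"
      unfolding abs_mult
    proof (rule mult_mono)
      show "\<bar>(?p2 + ?p1) / ?Q\<^sup>2\<bar> \<le> 28 / r\<^sup>2"
        using prof12_le[of "T L x"] rQ r by (auto intro!: frac_le power_mono)
      show "\<bar>X\<bar> \<le> C1" using C1(2)[OF x(1)] by (simp add: X_def)
    qed (use r in auto)
    moreover have "\<bar>?p1 / ?Q * Y\<bar> \<le> 1 / r * C2"
      unfolding abs_mult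
    proof (rule mult_mono)
      show "\<bar>?p1 / ?Q\<bar> \<le> 1 / r"
        using prof1_nonneg[of "T L x"] prof1_le[of "T L x"] rQ r by (auto intro!: frac_le)
      show "\<bar>Y\<bar> \<le> C2" using C2(2)[OF x(1)] by (simp add: Y_def)
    qed (use r in auto)
    ultimately have "\<bar>(?p2 + ?p1) / ?Q\<^sup>2 * X - ?p1 / ?Q * Y\<bar> \<le> 28 / r\<^sup>2 * C1 + 1 / r * C2" by linarith
    from mult_left_mono[OF this, of "1 / prof L"]
    show "\<bar>lap (w L) x\<bar> \<le> (1 / prof L) * (28 / r\<^sup>2 * C1 + 1 / r * C2)"
      unfolding sum_partial2_w X_def[symmetric] Y_def[symmetric]
      using prof_pos[OF x(2)] by (simp add: abs_mult)
  qed
qed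

text \<open>The coefficient \<open>g\<close> is
  \<open>2 * (\<beta> * (n - 2) + b x) * exp (- 2 * \<beta> * w)\<close>; only its bounds, which do
  not depend on \<open>L\<close>, are kept. The Hessian along \<open>u\<close> has no sign and goes
  into \<open>CB\<close> by \<open>w_uu\<close>.\<close>

lemma curv_lower_bound:
  obtains CB CF where "CB \<ge> 0" "CF \<ge> 0"
    "\<And>x L. x \<in> K \<Longrightarrow> L > 0 \<Longrightarrow>
      \<exists>g. 2 * exp (- 2 * \<beta>) \<le> g \<and> g \<le> 2 * \<beta> * real CARD('n) \<and>
      curv (metric L) x \<ge> F x (w L x) (\<lambda>i. 0)
        - CF * (norm (\<chi> i. partial i (w L) x) + (norm (\<chi> i. partial i (w L) x))\<^sup>2)
        - g * (lap (w L) x) - CB * (1 / prof L)"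
proof -
  obtain CF where CF: "CF \<ge> 0" "\<And>x t p. x \<in> K \<Longrightarrow> 0 \<le> t \<Longrightarrow> t \<le> 1 \<Longrightarrow>
       \<bar>F x t (\<lambda>i. p $ i) - F x t (\<lambda>i. 0)\<bar> \<le> CF * (norm p + (norm p)\<^sup>2)"
    using F_diff_bound[OF compact_K] by blast
  obtain cm where cm: "cm > 0" "\<And>x. x \<in> K \<Longrightarrow> c x \<ge> cm"
    using compact_pos_lower_bound[OF compact_K smooth_continuous[OF smooth_c]] c_pos by blast
  let ?n = "real CARD('n)"
  \<comment> \<open>Bounds the total coefficient \<open>kk\<close> of the second derivative of
    \<open>w\<close> along \<open>u\<close>.\<close>
  define D where "D = (2 * \<beta> * ?n * exp (2 * M) + 2 * (\<beta> + M) * exp (2 * M)) / cm"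
  have M: "M \<ge> 0" using b_range[of 0] by linarith
  have D: "D \<ge> 0" unfolding D_def using \<beta> M cm by simp
  show ?thesis
  proof
    show "0 \<le> D * (28 * Cq\<^sup>2 + Cq)" using D Cq by simp
    show "CF \<ge> 0" by fact
    fix x L assume x: "x \<in> K" "L > (0::real)"
    let ?W = "\<lambda>i j. partial i (partial j (w L)) x"
    define A where "A = (\<Sum>i\<in>UNIV. \<Sum>j\<in>UNIV. hinv x i j * ?W i j)"
    define B where "B = (\<Sum>i\<in>UNIV. \<Sum>j\<in>UNIV. u $ i * u $ j * ?W i j)"
    define a where "a = 2 * (\<beta> * (?n - 2) + b x)"
    define t where "t = w L x"
    have t: "0 \<le> t" "t \<le> 1" unfolding t_def using w_range x by auto
    have a: "2 \<le> a" "a \<le> 2 * \<beta> * ?n" using \<beta> b_range[of x] by (auto simp: a_def algebra_simps)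
    have bt: "- 2 * b x * t \<le> 2 * M"
    proof -
      have "- b x * t \<le> M * 1" using b_range[of x] t M by (intro mult_mono) auto
      then show ?thesis by (simp add: mult.commute)
    qed
    define e1 where "e1 = exp (- 2 * \<beta> * t)"
    define e2 where "e2 = exp (- 2 * b x * t)"
    have e1: "exp (- 2 * \<beta>) \<le> e1" "e1 \<le> 1" using \<beta> t by (auto simp: e1_def mult_left_le)
    have e2: "0 < e2" "e2 \<le> exp (2 * M)" using bt by (auto simp: e2_def)
    have "\<bar>e2 - e1\<bar> \<le> exp (2 * M)"
    proof -
      have "1 \<le> exp (2 * M)" "0 < e1" using M by (auto simp: e1_def)
      then show ?thesis using e1 e2 by linarith
    qed
    define kk where "kk = a * ((e2 - e1) / c x) + 2 * (\<beta> - b x) * e2 / c x"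
    have kk: "\<bar>kk\<bar> \<le> D"
    proof -
      have "\<bar>a * (e2 - e1)\<bar> \<le> 2 * \<beta> * ?n * exp (2 * M)"
        unfolding abs_mult using a \<open>\<bar>e2 - e1\<bar> \<le> exp (2 * M)\<close> \<beta> by (intro mult_mono) auto
      moreover have "\<bar>2 * (\<beta> - b x) * e2\<bar> \<le> 2 * (\<beta> + M) * exp (2 * M)"
        unfolding abs_mult[of _ e2] using \<beta> b_range[of x] e2 M by (intro mult_mono) auto
      ultimately have "\<bar>a * (e2 - e1) + 2 * (\<beta> - b x) * e2\<bar> \<le> 2 * \<beta> * ?n * exp (2 * M) + 2 * (\<beta> + M) * exp (2 * M)"
        by linarith
      moreover have "kk = (a * (e2 - e1) + 2 * (\<beta> - b x) * e2) / c x"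
        by (simp add: kk_def add_divide_distrib)
      ultimately show ?thesis
        unfolding D_def using cm(1) cm(2)[OF x(1)] c_pos[of x] by (auto intro!: frac_le)
    qed
    have "curv (metric L) x = F x t (\<lambda>i. partial i (w L) x)
       - a * (e1 * A + (e2 - e1) / c x * B) - 2 * (\<beta> - b x) * e2 / c x * B"
      unfolding curv_line[OF smooth_w] scal2_line sum_Ginv_W A_def B_def a_def t_def e1_def e2_def
      by (simp add: algebra_simps add_divide_distrib diff_divide_distrib)
    also have "\<dots> = F x t (\<lambda>i. partial i (w L) x) - a * e1 * A - kk * B"
      unfolding kk_def by (simp add: algebra_simps)
    finally have c1: "curv (metric L) x = F x t (\<lambda>i. partial i (w L) x) - a * e1 * A - kk * B" .
    have "\<bar>kk * B\<bar> \<le> D * ((1 / prof L) * (28 * Cq\<^sup>2 + Cq))"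
      unfolding abs_mult using kk w_uu[OF x] D by (intro mult_mono) (auto simp: B_def)
    moreover have "\<bar>F x t (\<lambda>i. partial i (w L) x) - F x t (\<lambda>i. 0)\<bar>
        \<le> CF * (norm (\<chi> i. partial i (w L) x) + (norm (\<chi> i. partial i (w L) x))\<^sup>2)"
      using CF(2)[OF x(1) t, of "\<chi> i. partial i (w L) x"] by simp
    ultimately have "curv (metric L) x \<ge> F x t (\<lambda>i. 0)
        - CF * (norm (\<chi> i. partial i (w L) x) + (norm (\<chi> i. partial i (w L) x))\<^sup>2)
        - (a * e1) * A - D * ((1 / prof L) * (28 * Cq\<^sup>2 + Cq))"
      unfolding c1 by linarith
    moreover have "2 * exp (- 2 * \<beta>) \<le> a * e1" using a e1 by (intro mult_mono) auto
    moreover have "a * e1 \<le> 2 * \<beta> * ?n * 1" using a e1 \<beta> by (intro mult_mono) (auto simp: e1_def)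
    ultimately show "\<exists>g. 2 * exp (- 2 * \<beta>) \<le> g \<and> g \<le> 2 * \<beta> * real CARD('n) \<and>
      curv (metric L) x \<ge> F x (w L x) (\<lambda>i. 0)
        - CF * (norm (\<chi> i. partial i (w L) x) + (norm (\<chi> i. partial i (w L) x))\<^sup>2)
        - g * (\<Sum>i\<in>UNIV. \<Sum>j\<in>UNIV. hinv x i j * ?W i j) - D * (28 * Cq\<^sup>2 + Cq) * (1 / prof L)"
      unfolding A_def t_def by (intro exI[of _ "a * e1"]) (simp add: algebra_simps)
  qed
qed

text \<open>
  With \<open>\<kappa> = 1 / prof L\<close>, the positive term is of order \<open>\<kappa> / Q\<close> and absorbs the terms in the gradient of
  \<open>w\<close>. The zeroth order error \<open>F x (w L x) 0\<close> is small where \<open>w\<close> is small; where \<open>w\<close> is not small, \<open>Q\<close> is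
  exponentially small in \<open>1 / \<kappa>\<close>.
\<close>

lemma curv_eventually:
  assumes "\<epsilon> > 0"
  obtains L0 where "L0 \<ge> 1"
    "\<And>x L. x \<in> K \<Longrightarrow> L \<ge> L0 \<Longrightarrow> curv (metric L) x > - \<epsilon>"
proof -
  obtain CB CF where C: "CB \<ge> 0" "CF \<ge> 0"
    and curv: "\<And>x L. x \<in> K \<Longrightarrow> L > 0 \<Longrightarrow>
      \<exists>g. 2 * exp (- 2 * \<beta>) \<le> g \<and> g \<le> 2 * \<beta> * real CARD('n) \<and>
      curv (metric L) x \<ge> F x (w L x) (\<lambda>i. 0)
        - CF * (norm (\<chi> i. partial i (w L) x) + (norm (\<chi> i. partial i (w L) x))\<^sup>2)
        - g * (lap (w L) x) - CB * (1 / prof L)"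
    using curv_lower_bound by blast
  obtain CA where CA: "CA \<ge> 0" "\<And>x L. x \<in> K \<Longrightarrow> L > 0 \<Longrightarrow> T L x \<le> 3 \<Longrightarrow>
     \<bar>lap (w L) x\<bar> \<le> (1 / prof L) * CA"
    using w_lap_outside by blast
  obtain C0 where C0: "\<And>x t. x \<in> K \<Longrightarrow> 0 \<le> t \<Longrightarrow> t \<le> 1 \<Longrightarrow> \<bar>F x t (\<lambda>i. 0)\<bar> \<le> C0"
    using F0_bound[OF compact_K] by blast
  have "\<epsilon> / 2 > 0" using assms by simp
  then obtain d where d: "d > 0" "\<And>x t. x \<in> K \<Longrightarrow> 0 \<le> t \<Longrightarrow> t \<le> 1 \<Longrightarrow> t < d \<Longrightarrow> \<bar>F x t (\<lambda>i. 0)\<bar> < \<epsilon> / 2"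
    using F0_small[OF compact_K] by blast
  define e where "e = exp (- 2 * \<beta>)"
  define n where "n = 2 * \<beta> * real CARD('n)"
  \<comment> \<open>With this weight the linear gradient term costs at most a quarter of
    \<open>e * (\<kappa> / q')\<close>, apart from a term of order \<open>\<kappa>\<close>. The
    quadratic one costs another quarter for small \<open>\<kappa>\<close>, so half of the positive
    term survives.\<close>
  define \<eta> where "\<eta> = e / (4 * (CF + 1))"
  define r where "r = \<delta> * exp (- 3)"
  define C3 where "C3 = 1 / r + Cq / 4"
  define C2 where "C2 = CF * (Cq / (4 * \<eta>)) + CB"
  define C4 where "C4 = CF * (C3 + C3\<^sup>2) + n * CA + CB"
  have e: "e > 0" "e \<le> 1" using \<beta> by (simp_all add: e_def)
  have n: "n \<ge> 0" using \<beta> by (simp add: n_def)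
  have \<eta>: "\<eta> > 0" using e C by (simp add: \<eta>_def)
  have r: "r > 0" using \<delta> by (simp add: r_def)
  have C3: "C3 \<ge> 0" using r Cq by (simp add: C3_def)
  have "\<forall>\<^sub>F \<kappa> in at_right 0. \<kappa> * C2 < \<epsilon> / 2 \<and> \<kappa> * C4 < \<epsilon> / 2 \<and> \<kappa> * 3 < d \<and> \<kappa> * (CF * Cq) < e / 4
     \<and> \<kappa> * (2 * \<delta> * (C0 + 1)) < e / 2 * d\<^sup>2 \<and> \<kappa> < 1"
  proof (intro eventually_conj)
    have *: "\<forall>\<^sub>F \<kappa> in at_right 0. \<kappa> * a < b" if "b > 0" for a b :: real
    proof -
      have "((\<lambda>\<kappa>. \<kappa> * a) \<longlongrightarrow> 0 * a) (at_right 0)" by (intro tendsto_intros)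
      then show ?thesis by (rule order_tendstoD(2)) (use that in simp)
    qed
    show "\<forall>\<^sub>F \<kappa> in at_right 0. \<kappa> * C2 < \<epsilon> / 2" "\<forall>\<^sub>F \<kappa> in at_right 0. \<kappa> * C4 < \<epsilon> / 2"
      "\<forall>\<^sub>F \<kappa> in at_right 0. \<kappa> * 3 < d" "\<forall>\<^sub>F \<kappa> in at_right 0. \<kappa> * (CF * Cq) < e / 4"
      "\<forall>\<^sub>F \<kappa> in at_right 0. \<kappa> * (2 * \<delta> * (C0 + 1)) < e / 2 * d\<^sup>2"
      by (rule *, use assms d(1) e in simp)+
    show "\<forall>\<^sub>F \<kappa> in at_right (0::real). \<kappa> < 1" using *[of 1 1] by simp
  qed
  then obtain \<kappa>0 where \<kappa>0: "\<kappa>0 > 0" "\<And>\<kappa>. 0 < \<kappa> \<Longrightarrow> \<kappa> < \<kappa>0 \<Longrightarrow> \<kappa> * C2 < \<epsilon> / 2 \<and> \<kappa> * C4 < \<epsilon> / 2 \<and> \<kappa> * 3 < d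
     \<and> \<kappa> * (CF * Cq) < e / 4 \<and> \<kappa> * (2 * \<delta> * (C0 + 1)) < e / 2 * d\<^sup>2 \<and> \<kappa> < 1"
    unfolding eventually_at_right_field by blast
  show ?thesis
  proof
    \<comment> \<open>Since \<open>prof L \<ge> L / 3\<close> for \<open>L \<ge> 1\<close>, the
      bound \<open>L \<ge> 4 / \<kappa>0\<close> gives
      \<open>1 / prof L < \<kappa>0\<close>.\<close>
    show "max 1 (4 / \<kappa>0) \<ge> 1" by simp
    fix x L assume x: "x \<in> K" "max 1 (4 / \<kappa>0) \<le> L"
    then have L: "L \<ge> 1" "L > 0" "4 / \<kappa>0 \<le> L" by auto
    define \<kappa> where "\<kappa> = 1 / prof L"
    have pL: "prof L > 0" by (rule prof_pos[OF L(2)])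
    then have k0: "\<kappa> > 0" by (simp add: \<kappa>_def)
    have "1 / prof L \<le> 1 / (L / 3)" using prof_ge[OF L(1)] L by (intro divide_left_mono) auto
    also have "\<dots> < \<kappa>0" using L \<kappa>0(1) by (simp add: field_simps)
    finally have k1: "\<kappa> < \<kappa>0" by (simp add: \<kappa>_def)
    note k = \<kappa>0(2)[OF k0 k1]
    define N where "N = norm (\<chi> i. partial i (w L) x)"
    define A where "A = (lap (w L) x)"
    define R where "R = curv (metric L) x"
    define F0 where "F0 = F x (w L x) (\<lambda>i. 0)"
    define q' where "q' = Q L x"
    obtain g where g: "2 * e \<le> g" "g \<le> n" and R: "R \<ge> F0 - CF * (N + N\<^sup>2) - g * A - CB * \<kappa>"
      using curv[OF x(1) L(2)] unfolding e_def n_def R_def F0_def N_def A_def \<kappa>_def by blast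
    have q': "q' > 0" unfolding q'_def by (rule Q_pos)
    have N0: "N \<ge> 0" by (simp add: N_def)
    have N2: "N\<^sup>2 \<le> \<kappa>\<^sup>2 * Cq / q'" using norm_grad_w[OF x(1) L(2)] by (simp add: N_def \<kappa>_def q'_def)
    have w: "0 \<le> w L x" "w L x \<le> 1" using w_range[OF L(2)] by auto
    have F0: "\<bar>F0\<bar> \<le> C0" "w L x < d \<Longrightarrow> \<bar>F0\<bar> < \<epsilon> / 2" using C0[OF x(1) w] d(2)[OF x(1) w] by (auto simp: F0_def)
    have wT: "w L x \<le> \<kappa> * max 0 (T L x)"
    proof (cases "T L x \<ge> 0")
      case True
      then show ?thesis using prof_le[OF True] pL by (simp add: w_def \<kappa>_def divide_right_mono)
    qed (simp add: w_def)
    show "curv (metric L) x > - \<epsilon>"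
    proof (cases "T L x \<ge> 3")
      case False
      then have T: "T L x \<le> 3" by simp
      then have "ln r \<le> ln q'" using \<delta> by (simp add: r_def q'_def T_def ln_mult)
      then have rq: "r \<le> q'" using r q' by simp
      have "w L x \<le> \<kappa> * 3" using wT mult_left_mono[of "max 0 (T L x)" 3 \<kappa>] T k0 by linarith
      then have f: "\<bar>F0\<bar> < \<epsilon> / 2" using F0(2) k by linarith
      have "N \<le> \<kappa> * (1 / q' + Cq / (4 * 1))" by (rule mixed_sum_le[OF N2 q']) (use k0 in auto)
      also have "\<dots> \<le> \<kappa> * C3" unfolding C3_def using rq r q' k0 by (intro mult_left_mono add_mono) (auto simp: frac_le)
      finally have N3: "N \<le> \<kappa> * C3" .
      have "N\<^sup>2 \<le> (\<kappa> * C3)\<^sup>2" using N3 N0 by (rule power_mono)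
      also have "\<dots> = \<kappa> * (\<kappa> * C3\<^sup>2)" by (simp add: power2_eq_square)
      also have "\<dots> \<le> \<kappa> * (1 * C3\<^sup>2)" using k k0 by (intro mult_left_mono mult_right_mono) auto
      finally have "N + N\<^sup>2 \<le> \<kappa> * (C3 + C3\<^sup>2)" using N3 by (simp add: algebra_simps)
      then have "CF * (N + N\<^sup>2) \<le> CF * (\<kappa> * (C3 + C3\<^sup>2))" using C by (intro mult_left_mono) auto
      moreover have "g * A \<le> n * (\<kappa> * CA)"
      proof -
        have "g * A \<le> g * (\<kappa> * CA)" using CA(2)[OF x(1) L(2) T] g e by (intro mult_left_mono) (auto simp: A_def \<kappa>_def)
        also have "\<dots> \<le> n * (\<kappa> * CA)" using g k0 CA(1) by (intro mult_right_mono) auto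
        finally show ?thesis .
      qed
      moreover have "\<kappa> * C4 = CF * (\<kappa> * (C3 + C3\<^sup>2)) + n * (\<kappa> * CA) + CB * \<kappa>" by (simp add: C4_def algebra_simps)
      ultimately have "R > - \<epsilon>" using R f k by linarith
      then show ?thesis by (simp add: R_def)
    next
      case True
      have A: "A \<le> - \<kappa> / (2 * q')" using w_lap_inside[OF x(1) L(2) True] by (simp add: A_def \<kappa>_def q'_def)
      have gA: "e * (\<kappa> / q') \<le> - (g * A)"
      proof -
        have "2 * e * (\<kappa> / (2 * q')) \<le> g * (- A)" using g A e k0 q' by (intro mult_mono) auto
        then show ?thesis by simp
      qed
      have "N \<le> \<kappa> * (\<eta> / q' + Cq / (4 * \<eta>))" by (rule mixed_sum_le[OF N2 q']) (use k0 \<eta> in auto)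
      then have "CF * N \<le> CF * (\<kappa> * (\<eta> / q' + Cq / (4 * \<eta>)))" using C by (intro mult_left_mono) auto
      also have "\<dots> = (CF * \<eta>) * (\<kappa> / q') + \<kappa> * (CF * (Cq / (4 * \<eta>)))" by (simp add: algebra_simps)
      also have "(CF * \<eta>) * (\<kappa> / q') \<le> (e / 4) * (\<kappa> / q')"
        using C e k0 q' by (intro mult_right_mono) (auto simp: \<eta>_def field_simps)
      finally have N1: "CF * N \<le> (e / 4) * (\<kappa> / q') + \<kappa> * (CF * (Cq / (4 * \<eta>)))" by simp
      have "CF * N\<^sup>2 \<le> CF * (\<kappa>\<^sup>2 * Cq / q')" using N2 C by (intro mult_left_mono) auto
      also have "\<dots> = (\<kappa> * (CF * Cq)) * (\<kappa> / q')" by (simp add: power2_eq_square)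
      also have "\<dots> \<le> (e / 4) * (\<kappa> / q')" using k k0 q' by (intro mult_right_mono) auto
      finally have N2': "CF * N\<^sup>2 \<le> (e / 4) * (\<kappa> / q')" .
      have "\<kappa> * C2 = \<kappa> * (CF * (Cq / (4 * \<eta>))) + CB * \<kappa>" by (simp add: C2_def algebra_simps)
      then have R2: "R \<ge> F0 + (e / 2) * (\<kappa> / q') - \<kappa> * C2" using R gA N1 N2' by (simp add: distrib_left) argo
      have "R > - \<epsilon>"
      proof (cases "w L x < d")
        case True
        have "(e / 2) * (\<kappa> / q') \<ge> 0" using e k0 q' by simp
        then show ?thesis using R2 F0(2)[OF True] k by linarith
      next
        case False
        \<comment> \<open>Here \<open>T\<close> is at least \<open>d / \<kappa>\<close>, and the
          quadratic Taylor bound of the exponential gives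
          \<open>1 / Q \<ge> (d / \<kappa>)^2 / (2 * \<delta>)\<close>. The positive term is
          therefore at least of order \<open>1 / \<kappa>\<close> and beats the fixed bound
          \<open>C0\<close>.\<close>
        then have "d \<le> \<kappa> * T L x" using wT True by simp
        then have dT: "d / \<kappa> \<le> T L x" using k0 by (simp add: field_simps)
        have "q' = \<delta> * exp (- T L x)"
          unfolding T_def q'_def using \<delta> Q_pos[of L x] by (simp add: exp_diff exp_minus)
        then have "1 / q' = exp (T L x) / \<delta>" using \<delta> q' by (auto simp: exp_minus divide_simps mult.commute)
        moreover have "(d / \<kappa>)\<^sup>2 / 2 \<le> exp (T L x)"
        proof -
          have "(d / \<kappa>)\<^sup>2 / 2 \<le> (T L x)\<^sup>2 / 2" using dT d k0 by (intro divide_right_mono power_mono) auto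
          also have "\<dots> \<le> exp (T L x)"
            using exp_lower_Taylor_quadratic[of "T L x"] True by simp
          finally show ?thesis .
        qed
        ultimately have "(d / \<kappa>)\<^sup>2 / 2 / \<delta> \<le> 1 / q'" using \<delta> by (simp only: divide_right_mono less_imp_le)
        then have "\<kappa> * ((d / \<kappa>)\<^sup>2 / 2 / \<delta>) \<le> \<kappa> * (1 / q')" using k0 by (intro mult_left_mono) auto
        moreover have "\<kappa> * ((d / \<kappa>)\<^sup>2 / 2 / \<delta>) = d\<^sup>2 / (2 * \<delta> * \<kappa>)" using k0 by (simp add: power2_eq_square field_simps)
        ultimately have "(e / 2) * (d\<^sup>2 / (2 * \<delta> * \<kappa>)) \<le> (e / 2) * (\<kappa> / q')" using e by (intro mult_left_mono) auto
        moreover have "C0 + 1 < (e / 2) * (d\<^sup>2 / (2 * \<delta> * \<kappa>))"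
        proof -
          have "C0 + 1 < (e / 2 * d\<^sup>2) / (\<kappa> * (2 * \<delta>))"
            using k k0 \<delta> by (subst pos_less_divide_eq) (auto simp: ac_simps)
          then show ?thesis by (simp add: ac_simps)
        qed
        ultimately show ?thesis using R2 F0(1) k assms by linarith
      qed
      then show ?thesis by (simp add: R_def)
    qed
  qed
qed

end

section \<open>A periodic function vanishing quadratically on a closed line\<close>

text \<open>On the compact set where \<open>\<bar>f\<bar> \<ge> e\<close> the function
  \<open>q\<close> has no zero, hence a positive lower bound.\<close>

lemma small_near_zeros:
  fixes f q :: "'a::metric_space \<Rightarrow> real"
  assumes "compact K" "continuous_on K f" "continuous_on K q" "\<And>x. x \<in> K \<Longrightarrow> q x \<ge> 0"
    and "\<And>x. x \<in> K \<Longrightarrow> q x = 0 \<Longrightarrow> f x = 0" and "e > 0"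
  obtains d where "d > 0" "\<And>x. x \<in> K \<Longrightarrow> q x < d \<Longrightarrow> \<bar>f x\<bar> < e"
proof -
  let ?A = "K \<inter> (\<lambda>x. \<bar>f x\<bar>) -` {e..}"
  have "compact ?A"
    by (rule closedin_compact[OF assms(1) continuous_closedin_preimage])
       (auto intro: continuous_intros assms)
  moreover have "continuous_on ?A q" using assms(3) continuous_on_subset by blast
  moreover have "q x > 0" if "x \<in> ?A" for x
  proof -
    have "x \<in> K" "f x \<noteq> 0" using that assms(6) by auto
    then show "q x > 0" using assms(4)[of x] assms(5)[of x] by (cases "q x = 0") auto
  qed
  ultimately obtain m where m: "m > 0" "\<And>x. x \<in> ?A \<Longrightarrow> q x \<ge> m"
    using compact_pos_lower_bound[of ?A q] by blast
  show ?thesis using that[OF m(1)] m(2) by force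
qed

definition Oq :: "'a set \<Rightarrow> ('a \<Rightarrow> real) \<Rightarrow> ('a \<Rightarrow> real) \<Rightarrow> bool" where
  "Oq K q f \<longleftrightarrow> (\<exists>C\<ge>0. \<forall>x\<in>K. \<bar>f x\<bar> \<le> C * q x)"

lemma Oq_add: "Oq K q f \<Longrightarrow> Oq K q g \<Longrightarrow> Oq K q (\<lambda>x. f x + g x)"
  unfolding Oq_def
proof (elim exE conjE)
  fix C D assume "0 \<le> C" "0 \<le> D" "\<forall>x\<in>K. \<bar>f x\<bar> \<le> C * q x" "\<forall>x\<in>K. \<bar>g x\<bar> \<le> D * q x"
  then show "\<exists>C\<ge>0. \<forall>x\<in>K. \<bar>f x + g x\<bar> \<le> C * q x"
    by (intro exI[of _ "C + D"]) (fastforce simp: algebra_simps)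
qed

lemma Oq_mult:
  fixes K :: "'a::topological_space set"
  assumes "compact K" "continuous_on K g" "Oq K q f"
  shows "Oq K q (\<lambda>x. g x * f x)"
proof -
  obtain C where C: "C \<ge> 0" "\<And>x. x \<in> K \<Longrightarrow> \<bar>g x\<bar> \<le> C" using compact_abs_bound[OF assms(1,2)] by blast
  obtain D where D: "D \<ge> 0" "\<And>x. x \<in> K \<Longrightarrow> \<bar>f x\<bar> \<le> D * q x" using assms(3) unfolding Oq_def by blast
  have "\<bar>g x * f x\<bar> \<le> C * D * q x" if "x \<in> K" for x
    using mult_mono[OF C(2)[OF that] D(2)[OF that]] C(1) by (simp add: abs_mult mult.assoc)
  then show ?thesis unfolding Oq_def using C(1) D(1) by (intro exI[of _ "C * D"]) auto
qed

lemma Oq_zero: "(\<And>x. x \<in> K \<Longrightarrow> q x \<ge> 0) \<Longrightarrow> Oq K q (\<lambda>x. 0)"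
  unfolding Oq_def by (intro exI[of _ 0]) auto

lemma Oq_sum:
  assumes "\<And>x. x \<in> K \<Longrightarrow> q x \<ge> 0" "\<And>i. i \<in> A \<Longrightarrow> Oq K q (f i)"
  shows "Oq K q (\<lambda>x. \<Sum>i\<in>A. f i x)"
  using assms(2) by (induction A rule: infinite_finite_induct) (auto intro: Oq_zero[OF assms(1)] Oq_add)

text \<open>Functions whose squares are of order \<open>q\<close> have the size of the distance to
  the line, and \<open>2 * a * b \<le> a^2 + b^2\<close> bounds a product of two of them by
  \<open>q\<close>.\<close>

lemma Oq_square_prod:
  assumes "Oq K q (\<lambda>x. (f x)\<^sup>2)" "Oq K q (\<lambda>x. (g x)\<^sup>2)"
  shows "Oq K q (\<lambda>x. f x * g x)"
proof -
  obtain C D where C: "C \<ge> 0" "\<And>x. x \<in> K \<Longrightarrow> (f x)\<^sup>2 \<le> C * q x" and D: "D \<ge> 0" "\<And>x. x \<in> K \<Longrightarrow> (g x)\<^sup>2 \<le> D * q x"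
    using assms unfolding Oq_def by auto
  have "\<bar>f x * g x\<bar> \<le> (C + D) * q x" if "x \<in> K" for x
  proof -
    have "2 * \<bar>f x * g x\<bar> \<le> (f x)\<^sup>2 + (g x)\<^sup>2"
      using sum_squares_bound[of "\<bar>f x\<bar>" "\<bar>g x\<bar>"] by (simp add: abs_mult)
    then show ?thesis using C(2)[OF that] D(2)[OF that] by (simp add: algebra_simps)
  qed
  then show ?thesis unfolding Oq_def using C D by (intro exI[of _ "C + D"]) auto
qed

lemma partial_prod_zero:
  assumes "smooth g" "smooth f1" "smooth f2" "f1 x = 0" "f2 x = 0"
  shows "partial a (\<lambda>x. g x * (f1 x * f2 x)) x = 0"
  by (simp add: partial_mult smooth_mult assms)

context line_field begin

definition piv :: 'n where "piv = (SOME i. u $ i \<noteq> 0)"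

lemma u_piv: "u $ piv \<noteq> 0"
  unfolding piv_def by (rule someI_ex) (use u_nz in \<open>auto simp: vec_eq_iff\<close>)

text \<open>Coordinates transversal to \<open>u\<close>, invariant under translation along
  \<open>u\<close>. They are cleared of denominators: if \<open>u\<close> has integer entries, a
  lattice translation changes them by integers, so their sines and cosines below are
  periodic.\<close>

definition \<theta> :: "real ^ 'n \<Rightarrow> 'n \<Rightarrow> real ^ 'n \<Rightarrow> real" where
  "\<theta> p j x = u $ piv * (x $ j - p $ j) - u $ j * (x $ piv - p $ piv)"
definition S :: "real ^ 'n \<Rightarrow> 'n \<Rightarrow> real ^ 'n \<Rightarrow> real" where
  "S p j x = sin (2 * pi * \<theta> p j x) / (2 * pi * u $ piv)"
definition kos :: "real ^ 'n \<Rightarrow> 'n \<Rightarrow> real ^ 'n \<Rightarrow> real" where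
  "kos p j x = 1 - cos (2 * pi * \<theta> p j x)"
text \<open>Matrix of the projection along \<open>u\<close> onto the hyperplane where the
  \<open>piv\<close> component vanishes.\<close>

definition proj :: "'n \<Rightarrow> 'n \<Rightarrow> real" where
  "proj j a = axis a 1 $ j - u $ j * axis a 1 $ piv / u $ piv"

text \<open>
  \<open>S\<close> approximates the displacement from the line modulo \<open>u\<close> near the zeros of \<open>\<theta>\<close> modulo 1; the second sum
  in \<open>qf\<close> removes the zeros of \<open>S\<close> where some \<open>\<theta>\<close> is a half-integer. The zero set is a finite union of
  closed lines parallel to \<open>u\<close>.
\<close>

definition qf :: "real ^ 'n \<Rightarrow> real ^ 'n \<Rightarrow> real" where
  "qf p x = (\<Sum>i\<in>UNIV. \<Sum>j\<in>UNIV. H x i j * (S p i x * S p j x)) + (\<Sum>j\<in>UNIV. (kos p j x)\<^sup>2)"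

lemma smooth_\<theta>: "smooth (\<theta> p j)" unfolding \<theta>_def by (intro smooth_intros)
lemma smooth_S: "smooth (S p j)" unfolding S_def using u_piv by (intro smooth_intros smooth_\<theta>) auto
lemma smooth_kos: "smooth (kos p j)" unfolding kos_def by (intro smooth_intros smooth_\<theta>)
lemma smooth_qf: "smooth (qf p)" unfolding qf_def by (intro smooth_intros smooth_H smooth_S smooth_kos)

lemma \<theta>_shift: "\<theta> p j (x + t *\<^sub>R u) = \<theta> p j x"
  by (simp add: \<theta>_def algebra_simps)
lemma S_shift: "S p j (x + t *\<^sub>R u) = S p j x" by (simp add: S_def \<theta>_shift)
lemma kos_shift: "kos p j (x + t *\<^sub>R u) = kos p j x" by (simp add: kos_def \<theta>_shift)
lemma S_piv: "S p piv x = 0" by (simp add: S_def \<theta>_def)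

lemma DERIV_\<theta>: "((\<lambda>t. \<theta> p j (x + t *\<^sub>R axis a 1)) has_real_derivative u $ piv * proj j a) (at 0)"
  unfolding \<theta>_def proj_def using u_piv
  by (auto intro!: derivative_eq_intros simp: field_simps)

lemma partial_S: "partial a (S p j) x = (1 - kos p j x) * proj j a"
  unfolding S_def kos_def
  by (rule partialI, rule DERIV_cong, (rule DERIV_\<theta> derivative_intros)+)
     (use u_piv in \<open>auto simp: field_simps\<close>)

lemma partial_kos: "partial a (kos p j) x = (2 * pi * u $ piv)\<^sup>2 * proj j a * S p j x"
  unfolding S_def kos_def
  by (rule partialI, rule DERIV_cong, (rule DERIV_\<theta> derivative_intros)+)
     (use u_piv in \<open>auto simp: field_simps power2_eq_square\<close>)

lemma sum_u_H: "(\<Sum>i\<in>UNIV. u $ i * H x i j) = 0"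
proof -
  have "(\<Sum>i\<in>UNIV. u $ i * H x i j) = (\<Sum>i\<in>UNIV. u $ i * h x $ i $ j - (u $ i * \<nu> x i) * (\<nu> x j / c x))"
    by (intro sum.cong refl) (simp add: H_def \<tau>_def algebra_simps)
  also have "\<dots> = 0" unfolding sum_subtractf sum_u_h sum_distrib_right[symmetric] sum_u_\<nu> by simp
  finally show ?thesis .
qed

text \<open>\<open>proj\<close> differs from the identity by multiples of \<open>u\<close>, which
  \<open>H\<close> annihilates.\<close>

lemma sum_H_proj: "(\<Sum>i\<in>UNIV. H x i j * proj i a) = H x a j"
proof -
  have "(\<Sum>i\<in>UNIV. H x i j * proj i a) = (\<Sum>i\<in>UNIV. (if i = a then H x i j else 0) - (u $ i * H x i j) * (axis a 1 $ piv / u $ piv))"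
    by (intro sum.cong refl) (simp add: proj_def axis_def algebra_simps)
  also have "\<dots> = H x a j" unfolding sum_subtractf sum_distrib_right[symmetric] sum_u_H by simp
  finally show ?thesis .
qed

lemma sum_hinv_H: "(\<Sum>k\<in>UNIV. hinv x i k * H x k j) = (if i = j then 1 else 0) - u $ i * \<nu> x j / c x"
proof -
  have "(\<Sum>k\<in>UNIV. hinv x i k * H x k j) = (\<Sum>k\<in>UNIV. hinv x i k * h x $ k $ j - (hinv x i k * \<nu> x k) * (\<nu> x j / c x))"
    by (intro sum.cong refl) (simp add: H_def \<tau>_def algebra_simps)
  also have "\<dots> = (if i = j then 1 else 0) - u $ i * \<nu> x j / c x"
    unfolding sum_subtractf sum_hinv sum_distrib_right[symmetric] sum_hinv_\<nu> by simp
  finally show ?thesis .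
qed

text \<open>In every summand two factors vanish on the zero set of \<open>qf\<close>, so
  \<open>rem\<close> is of order \<open>qf\<close> on compact sets and its first derivatives vanish
  on that set. The rest of the gradient of \<open>qf\<close>, namely \<open>2 * H S\<close>, is as
  for a squared distance.\<close>

definition rem :: "real ^ 'n \<Rightarrow> 'n \<Rightarrow> real ^ 'n \<Rightarrow> real" where
  "rem p a x = (\<Sum>i\<in>UNIV. \<Sum>j\<in>UNIV. partial a (\<lambda>x. H x i j) x * (S p i x * S p j x))
    + (\<Sum>i\<in>UNIV. \<Sum>j\<in>UNIV. (- 2 * H x i j * proj i a) * (S p j x * kos p i x))
    + (\<Sum>j\<in>UNIV. (2 * (2 * pi * u $ piv)\<^sup>2 * proj j a) * (S p j x * kos p j x))"

lemma smooth_rem: "smooth (rem p a)"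
  unfolding rem_def by (intro smooth_intros smooth_H smooth_S smooth_kos smooth_partial)

lemma partial_qf: "partial a (qf p) x = 2 * (\<Sum>j\<in>UNIV. H x a j * S p j x) + rem p a x"
proof -
  have 1: "partial a (\<lambda>x. H x i j * (S p i x * S p j x)) x =
     partial a (\<lambda>x. H x i j) x * (S p i x * S p j x)
     + (- H x i j * proj i a) * (S p j x * kos p i x) + (- H x j i * proj j a) * (S p i x * kos p j x)
     + (H x i j * proj i a) * S p j x + (H x j i * proj j a) * S p i x" for i j
    by (subst partial_mult, rule smooth_H, intro smooth_mult smooth_S, subst partial_mult[OF smooth_S smooth_S])
       (simp add: partial_S sym_H[of x j i] algebra_simps)
  have 2: "partial a (\<lambda>x. (kos p j x)\<^sup>2) x = (2 * (2 * pi * u $ piv)\<^sup>2 * proj j a) * (S p j x * kos p j x)" for j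
    unfolding power2_eq_square[of "kos p j _"]
    by (subst partial_mult[OF smooth_kos smooth_kos]) (simp add: partial_kos algebra_simps)
  have sw: "(\<Sum>i\<in>UNIV. \<Sum>j\<in>UNIV. f j i) = (\<Sum>i\<in>UNIV. \<Sum>j\<in>UNIV. f i j)" for f :: "'n \<Rightarrow> 'n \<Rightarrow> real"
    by (rule sum.swap)
  have 3: "(\<Sum>i\<in>UNIV. \<Sum>j\<in>UNIV. (H x i j * proj i a) * S p j x) = (\<Sum>j\<in>UNIV. H x a j * S p j x)"
    by (subst sum.swap) (simp add: sum_distrib_right[symmetric] sum_H_proj)
  have "partial a (qf p) x = (\<Sum>i\<in>UNIV. \<Sum>j\<in>UNIV. partial a (\<lambda>x. H x i j * (S p i x * S p j x)) x)
      + (\<Sum>j\<in>UNIV. partial a (\<lambda>x. (kos p j x)\<^sup>2) x)"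
    unfolding qf_def
    by (subst partial_add, (intro smooth_intros smooth_H smooth_S smooth_kos)+, subst partial_sum,
        (intro smooth_intros smooth_H smooth_S smooth_kos)+, subst partial_sum,
        (intro smooth_intros smooth_H smooth_S smooth_kos)+, subst partial_sum,
        (intro smooth_intros smooth_H smooth_S smooth_kos)+, rule refl)
  also have "\<dots> = (\<Sum>i\<in>UNIV. \<Sum>j\<in>UNIV. partial a (\<lambda>x. H x i j) x * (S p i x * S p j x))
     + 2 * (\<Sum>i\<in>UNIV. \<Sum>j\<in>UNIV. (- H x i j * proj i a) * (S p j x * kos p i x))
     + 2 * (\<Sum>i\<in>UNIV. \<Sum>j\<in>UNIV. (H x i j * proj i a) * S p j x)
     + (\<Sum>j\<in>UNIV. (2 * (2 * pi * u $ piv)\<^sup>2 * proj j a) * (S p j x * kos p j x))"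
    unfolding 1 2 sum.distrib
    using sw[of "\<lambda>i j. (- H x i j * proj i a) * (S p j x * kos p i x)"] sw[of "\<lambda>i j. (H x i j * proj i a) * S p j x"]
    by linarith
  finally show ?thesis unfolding 3 rem_def by (simp add: sum_distrib_left algebra_simps)
qed

lemma h_inner_sym: "v \<bullet> (h x *v z) = z \<bullet> (h x *v v)"
  by (rule inner_matrix_sym) (rule sym_h)

lemma H_form: "(\<Sum>i\<in>UNIV. \<Sum>j\<in>UNIV. H x i j * (v $ i * v $ j)) = v \<bullet> (h x *v v) - (\<Sum>i\<in>UNIV. \<nu> x i * v $ i)\<^sup>2 / c x"
proof -
  have "(\<Sum>i\<in>UNIV. \<Sum>j\<in>UNIV. H x i j * (v $ i * v $ j)) =
    (\<Sum>i\<in>UNIV. \<Sum>j\<in>UNIV. v $ i * (h x $ i $ j * v $ j) - (\<nu> x i * v $ i) * (\<nu> x j * v $ j) / c x)"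
    by (intro sum.cong refl) (simp add: H_def \<tau>_def algebra_simps)
  also have "\<dots> = v \<bullet> (h x *v v) - (\<Sum>i\<in>UNIV. \<nu> x i * v $ i)\<^sup>2 / c x"
  proof -
    have "(\<Sum>i\<in>UNIV. \<nu> x i * v $ i)\<^sup>2 / c x = (\<Sum>i\<in>UNIV. \<Sum>j\<in>UNIV. (\<nu> x i * v $ i) * (\<nu> x j * v $ j) / c x)"
      by (simp only: power2_eq_square sum_product sum_divide_distrib)
    moreover have "v \<bullet> (h x *v v) = (\<Sum>i\<in>UNIV. \<Sum>j\<in>UNIV. v $ i * (h x $ i $ j * v $ j))"
      by (simp add: inner_vec_def matrix_vector_mult_def sum_distrib_left)
    ultimately show ?thesis by (simp only: sum_subtractf)
  qed
  finally show ?thesis .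
qed

text \<open>\<open>H\<close> is the square of the length of the component orthogonal to \<open>u\<close>.\<close>

lemma H_form_orth:
  defines "\<alpha> \<equiv> \<lambda>x v. (\<Sum>i\<in>UNIV. \<nu> x i * v $ i) / c x"
  shows "(\<Sum>i\<in>UNIV. \<Sum>j\<in>UNIV. H x i j * (v $ i * v $ j))
     = (v - \<alpha> x v *\<^sub>R u) \<bullet> (h x *v (v - \<alpha> x v *\<^sub>R u))"
proof -
  have hu: "h x *v u = (\<chi> i. \<nu> x i)" by (simp add: vec_eq_iff matrix_vector_mult_def \<nu>_def)
  have vu: "v \<bullet> (h x *v u) = \<alpha> x v * c x"
    by (simp add: hu inner_vec_def \<alpha>_def mult.commute)
  have uu: "u \<bullet> (h x *v u) = c x" by (simp add: hu inner_vec_def c_def)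
  have "(v - \<alpha> x v *\<^sub>R u) \<bullet> (h x *v (v - \<alpha> x v *\<^sub>R u)) = v \<bullet> (h x *v v) - (\<alpha> x v)\<^sup>2 * c x"
    by (simp add: matrix_vector_mult_diff_distrib matrix_vector_mult_scaleR inner_diff_left inner_diff_right vu uu
        h_inner_sym[of u x v] power2_eq_square)
  then show ?thesis unfolding H_form by (simp add: \<alpha>_def power2_eq_square)
qed

lemma H_form_nonneg: "(\<Sum>i\<in>UNIV. \<Sum>j\<in>UNIV. H x i j * (v $ i * v $ j)) \<ge> 0"
  unfolding H_form_orth
  by (cases "v - ((\<Sum>i\<in>UNIV. \<nu> x i * v $ i) / c x) *\<^sub>R u = 0") (simp, simp add: pos_h less_imp_le del: right_minus_eq)

lemma h_lower:
  assumes "compact K"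
  obtains m where "m > 0" "\<And>x v. x \<in> K \<Longrightarrow> v \<bullet> (h x *v v) \<ge> m * (norm v)\<^sup>2"
proof -
  let ?A = "K \<times> (sphere 0 1 :: (real ^ 'n) set)"
  let ?f = "\<lambda>z. snd z \<bullet> (h (fst z) *v snd z)"
  have "compact ?A" by (intro compact_Times assms) auto
  moreover have "continuous_on ?A ?f"
    unfolding inner_vec_def matrix_vector_mult_def
    by (simp, intro continuous_intros smooth_continuous_fst smooth_h)
  moreover have "?f z > 0" if "z \<in> ?A" for z
    using that by (intro pos_h) auto
  ultimately obtain m where m: "m > 0" "\<And>z. z \<in> ?A \<Longrightarrow> ?f z \<ge> m"
    using compact_pos_lower_bound[of ?A ?f] by blast
  show ?thesis
  proof
    show "m > 0" by fact
    fix x v assume x: "x \<in> K"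
    show "v \<bullet> (h x *v v) \<ge> m * (norm v)\<^sup>2"
    proof (cases "v = 0")
      case False
      have "m \<le> ?f (x, v /\<^sub>R norm v)" by (rule m(2)) (use x False in auto)
      also have "\<dots> = (v \<bullet> (h x *v v)) / (norm v)\<^sup>2"
        by (simp add: matrix_vector_mult_scaleR power2_eq_square divide_inverse)
      finally show ?thesis using False by (simp add: field_simps)
    qed simp
  qed
qed

text \<open>\<open>H\<close> annihilates \<open>u\<close> and is coercive only transversally. If the
  \<open>piv\<close> component of \<open>v\<close> vanishes, the multiple of \<open>u\<close>
  removed in passing to the orthogonal component \<open>z\<close> can be read off from
  \<open>z $ piv\<close>, so \<open>v\<close> is bounded by \<open>z\<close>. The vector with
  entries \<open>S p j x\<close> is of this kind.\<close>

lemma H_lower: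
  assumes "compact K"
  obtains C where "C \<ge> 0"
    "\<And>x v. x \<in> K \<Longrightarrow> v $ piv = 0 \<Longrightarrow> (norm v)\<^sup>2 \<le> C * (\<Sum>i\<in>UNIV. \<Sum>j\<in>UNIV. H x i j * (v $ i * v $ j))"
proof -
  obtain m where m: "m > 0" "\<And>x v. x \<in> K \<Longrightarrow> v \<bullet> (h x *v v) \<ge> m * (norm v)\<^sup>2"
    using h_lower[OF assms] by blast
  define k where "k = 1 + norm u / \<bar>u $ piv\<bar>"
  show ?thesis
  proof
    show "0 \<le> k\<^sup>2 / m" using m by simp
    fix x and v :: "real ^ 'n" assume x: "x \<in> K" "v $ piv = 0"
    define \<alpha> where "\<alpha> = (\<Sum>i\<in>UNIV. \<nu> x i * v $ i) / c x"
    define z where "z = v - \<alpha> *\<^sub>R u"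
    have "\<bar>z $ piv\<bar> \<le> norm z" by (rule component_le_norm_cart)
    then have "\<bar>\<alpha>\<bar> * \<bar>u $ piv\<bar> \<le> norm z" using x(2) by (simp add: z_def abs_mult)
    then have "\<bar>\<alpha>\<bar> \<le> norm z / \<bar>u $ piv\<bar>" using u_piv by (simp add: field_simps)
    then have "\<bar>\<alpha>\<bar> * norm u \<le> norm z / \<bar>u $ piv\<bar> * norm u" by (intro mult_right_mono) auto
    moreover have "norm v \<le> norm z + \<bar>\<alpha>\<bar> * norm u"
      using norm_triangle_ineq[of z "\<alpha> *\<^sub>R u"] by (simp add: z_def)
    ultimately have "norm v \<le> k * norm z" by (simp add: k_def algebra_simps)
    then have "(norm v)\<^sup>2 \<le> (k * norm z)\<^sup>2" by (rule power_mono) simp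
    also have "\<dots> = k\<^sup>2 / m * (m * (norm z)\<^sup>2)" using m by (simp add: power_mult_distrib)
    also have "\<dots> \<le> k\<^sup>2 / m * (z \<bullet> (h x *v z))" using m x by (intro mult_left_mono) auto
    finally show "(norm v)\<^sup>2 \<le> k\<^sup>2 / m * (\<Sum>i\<in>UNIV. \<Sum>j\<in>UNIV. H x i j * (v $ i * v $ j))"
      unfolding H_form_orth z_def \<alpha>_def .
  qed
qed

lemma qf_parts: "(\<Sum>i\<in>UNIV. \<Sum>j\<in>UNIV. H x i j * (S p i x * S p j x)) \<le> qf p x" "(kos p j x)\<^sup>2 \<le> qf p x"
  "0 \<le> qf p x"
proof -
  have 1: "0 \<le> (\<Sum>i\<in>UNIV. \<Sum>j\<in>UNIV. H x i j * (S p i x * S p j x))"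
    using H_form_nonneg[of x "\<chi> i. S p i x"] by simp
  have 2: "(kos p j x)\<^sup>2 \<le> (\<Sum>j\<in>UNIV. (kos p j x)\<^sup>2)" by (rule member_le_sum) auto
  have 3: "0 \<le> (\<Sum>j\<in>UNIV. (kos p j x)\<^sup>2)" by (intro sum_nonneg) auto
  show "(\<Sum>i\<in>UNIV. \<Sum>j\<in>UNIV. H x i j * (S p i x * S p j x)) \<le> qf p x" "(kos p j x)\<^sup>2 \<le> qf p x" "0 \<le> qf p x"
    unfolding qf_def using 1 2 3 by linarith+
qed

lemma qf_zero_iff: "qf p x = 0 \<longleftrightarrow> (\<forall>j. \<theta> p j x \<in> \<int>)"
proof
  assume z: "qf p x = 0"
  show "\<forall>j. \<theta> p j x \<in> \<int>"
  proof
    fix j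
    have "(kos p j x)\<^sup>2 \<le> 0" using qf_parts(2)[of p j x] z by simp
    then have "cos (2 * pi * \<theta> p j x) = 1" by (simp add: kos_def)
    then obtain n :: int where "2 * pi * \<theta> p j x = of_int n * 2 * pi"
      using cos_one_2pi_int[of "2 * pi * \<theta> p j x"] by auto
    then have "\<theta> p j x = of_int n" by simp
    then show "\<theta> p j x \<in> \<int>" by simp
  qed
next
  assume z: "\<forall>j. \<theta> p j x \<in> \<int>"
  have "S p j x = 0 \<and> kos p j x = 0" for j
  proof -
    obtain n where n: "\<theta> p j x = of_int n" using z by (auto elim: Ints_cases)
    have "sin (2 * pi * \<theta> p j x) = 0" "cos (2 * pi * \<theta> p j x) = 1"
      unfolding n by (simp_all add: sin_int_2pin cos_int_2pin)
    then show ?thesis by (simp add: S_def kos_def)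
  qed
  then show "qf p x = 0" by (simp add: qf_def)
qed

lemma qf_zero_imp: "qf p x = 0 \<Longrightarrow> S p j x = 0" "qf p x = 0 \<Longrightarrow> kos p j x = 0"
proof -
  assume z: "qf p x = 0"
  have "(kos p j x)\<^sup>2 \<le> 0" using qf_parts(2)[of p j x] z by simp
  then show k: "kos p j x = 0" by simp
  then have "cos (2 * pi * \<theta> p j x) = 1" by (simp add: kos_def)
  then have "sin (2 * pi * \<theta> p j x) = 0" using sin_cos_squared_add[of "2 * pi * \<theta> p j x"] by simp
  then show "S p j x = 0" by (simp add: S_def)
qed

lemma qf_line: "qf p (p + t *\<^sub>R u) = 0"
  unfolding qf_zero_iff by (simp add: \<theta>_def)

lemma S_sq_le:
  assumes "compact K"
  shows "Oq K (qf p) (\<lambda>x. (S p j x)\<^sup>2)"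
proof -
  obtain C where C: "C \<ge> 0"
    "\<And>x v. x \<in> K \<Longrightarrow> v $ piv = 0 \<Longrightarrow> (norm v)\<^sup>2 \<le> C * (\<Sum>i\<in>UNIV. \<Sum>j\<in>UNIV. H x i j * (v $ i * v $ j))"
    using H_lower[OF assms] by blast
  have "(S p j x)\<^sup>2 \<le> C * qf p x" if "x \<in> K" for x
  proof -
    let ?v = "\<chi> j. S p j x"
    have "\<bar>?v $ j\<bar> \<le> norm ?v" by (rule component_le_norm_cart)
    then have "\<bar>?v $ j\<bar>\<^sup>2 \<le> (norm ?v)\<^sup>2" by (rule power_mono) simp
    also have "\<dots> \<le> C * (\<Sum>i\<in>UNIV. \<Sum>j\<in>UNIV. H x i j * (?v $ i * ?v $ j))"
      by (rule C(2)[OF that]) (simp add: S_piv)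
    also have "\<dots> \<le> C * qf p x" using qf_parts(1)[of x p] C(1) by (intro mult_left_mono) auto
    finally show ?thesis by simp
  qed
  then show ?thesis unfolding Oq_def using C(1) by (intro exI[of _ C]) auto
qed

lemma kos_sq_le: "Oq K (qf p) (\<lambda>x. (kos p j x)\<^sup>2)"
  unfolding Oq_def using qf_parts(2) by (intro exI[of _ 1]) auto

section \<open>Bounds for \<open>qf\<close> and its derivatives on a compact set\<close>

context
  fixes K :: "(real ^ 'n) set" and p :: "real ^ 'n"
  assumes K: "compact K"
begin

lemma Oq_SS: "Oq K (qf p) (\<lambda>x. S p i x * S p j x)"
  by (intro Oq_square_prod S_sq_le K)
lemma Oq_Sk: "Oq K (qf p) (\<lambda>x. S p i x * kos p j x)"
  by (intro Oq_square_prod S_sq_le kos_sq_le K)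

lemma Oq_rem: "Oq K (qf p) (rem p a)"
proof -
  have "Oq K (qf p) (\<lambda>x. rem p a x)"
    unfolding rem_def
    by (intro Oq_add Oq_sum qf_parts(3);
        (rule Oq_mult[OF K], intro smooth_continuous smooth_intros smooth_H smooth_partial, rule Oq_SS Oq_Sk))
  then show ?thesis .
qed

lemma Oq_grad: "Oq K (qf p) (\<lambda>x. \<Sum>a\<in>UNIV. (partial a (qf p) x)\<^sup>2)"
proof (rule Oq_sum)
  fix a :: 'n
  have e: "(partial a (qf p) x)\<^sup>2 =
    (\<Sum>j\<in>UNIV. \<Sum>i\<in>UNIV. (4 * H x a j * H x a i) * (S p j x * S p i x))
    + (\<Sum>j\<in>UNIV. (4 * H x a j * S p j x) * rem p a x) + rem p a x * rem p a x" for x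
  proof -
    have 1: "(\<Sum>j\<in>UNIV. \<Sum>i\<in>UNIV. (4 * H x a j * H x a i) * (S p j x * S p i x))
       = 4 * (\<Sum>j\<in>UNIV. H x a j * S p j x)\<^sup>2"
      by (simp add: power2_eq_square sum_product sum_distrib_left algebra_simps)
    have 2: "(\<Sum>j\<in>UNIV. (4 * H x a j * S p j x) * rem p a x) = 4 * (\<Sum>j\<in>UNIV. H x a j * S p j x) * rem p a x"
      by (simp add: sum_distrib_left sum_distrib_right algebra_simps)
    show ?thesis unfolding partial_qf 1 2 by (simp add: power2_eq_square algebra_simps)
  qed
  show "Oq K (qf p) (\<lambda>x. (partial a (qf p) x)\<^sup>2)"
    unfolding e
    by (intro Oq_add Oq_sum qf_parts(3);
        (rule Oq_mult[OF K], intro smooth_continuous smooth_intros smooth_H smooth_S smooth_rem, rule Oq_SS Oq_rem))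
qed (rule qf_parts)

text \<open>\<open>S\<close> and \<open>kos\<close> are constant along \<open>u\<close>, so only the
  coefficients \<open>H\<close> are differentiated and both factors \<open>S\<close> survive. This,
  and the same argument once more in \<open>qf_uu\<close>, makes the derivatives along
  \<open>u\<close> of order \<open>qf\<close>.\<close>

lemma qf_u: "(\<Sum>a\<in>UNIV. u $ a * partial a (qf p) x)
   = (\<Sum>i\<in>UNIV. \<Sum>j\<in>UNIV. (\<Sum>a\<in>UNIV. u $ a * partial a (\<lambda>x. H x i j) x) * (S p i x * S p j x))"
proof -
  have "((\<lambda>t. qf p (x + t *\<^sub>R u)) has_real_derivative
      (\<Sum>i\<in>UNIV. \<Sum>j\<in>UNIV. (\<Sum>a\<in>UNIV. u $ a * partial a (\<lambda>x. H x i j) x) * (S p i x * S p j x)) + 0) (at 0)"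
    unfolding qf_def S_shift kos_shift
    by (intro DERIV_add DERIV_sum DERIV_cmult_right smooth_directional[OF smooth_H] DERIV_const)
  from DERIV_unique[OF smooth_directional[OF smooth_qf] this] show ?thesis by simp
qed

lemma qf_uu: "(hess_u (qf p) x)
   = (\<Sum>i\<in>UNIV. \<Sum>j\<in>UNIV. (\<Sum>a\<in>UNIV. u $ a * partial a (\<lambda>x. \<Sum>b\<in>UNIV. u $ b * partial b (\<lambda>x. H x i j) x) x) * (S p i x * S p j x))"
proof -
  have s: "smooth (\<lambda>x. \<Sum>b\<in>UNIV. u $ b * partial b (\<lambda>x. H x i j) x)" for i j
    by (intro smooth_intros smooth_partial smooth_H)
  have s': "smooth (\<lambda>x. \<Sum>a\<in>UNIV. u $ a * partial a (qf p) x)"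
    by (intro smooth_intros smooth_partial smooth_qf)
  have "(hess_u (qf p) x)
     = (\<Sum>i\<in>UNIV. u $ i * partial i (\<lambda>x. \<Sum>j\<in>UNIV. u $ j * partial j (qf p) x) x)"
    by (subst partial_sum, intro smooth_intros smooth_partial smooth_qf,
        subst partial_cmult, intro smooth_intros smooth_partial smooth_qf)
       (simp add: sum_distrib_left mult.assoc)
  moreover have *: "((\<lambda>t. (\<lambda>x. \<Sum>a\<in>UNIV. u $ a * partial a (qf p) x) (x + t *\<^sub>R u)) has_real_derivative
      (\<Sum>i\<in>UNIV. \<Sum>j\<in>UNIV. (\<Sum>a\<in>UNIV. u $ a * partial a (\<lambda>x. \<Sum>b\<in>UNIV. u $ b * partial b (\<lambda>x. H x i j) x) x) * (S p i x * S p j x))) (at 0)"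
    unfolding qf_u S_shift by (intro DERIV_sum DERIV_cmult_right smooth_directional[OF s])
  ultimately show ?thesis using DERIV_unique[OF smooth_directional[OF s', of x u] *] by simp
qed

lemma Oq_u: "Oq K (qf p) (\<lambda>x. \<Sum>a\<in>UNIV. u $ a * partial a (qf p) x)"
  unfolding qf_u
  by (intro Oq_sum qf_parts(3);
      (rule Oq_mult[OF K], intro smooth_continuous smooth_intros smooth_H smooth_partial, rule Oq_SS))

lemma Oq_uu: "Oq K (qf p) (\<lambda>x. hess_u (qf p) x)"
  unfolding qf_uu
  by (intro Oq_sum qf_parts(3);
      (rule Oq_mult[OF K], intro smooth_continuous smooth_intros smooth_H smooth_partial, rule Oq_SS))

text \<open>On the zero set the derivative of \<open>S\<close> is \<open>proj\<close> and that of
  \<open>rem\<close> vanishes. What remains is \<open>2 * H\<close> composed with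
  \<open>proj\<close>, which is \<open>2 * H\<close>.\<close>

lemma hess_qf_zero:
  assumes z: "qf p x = 0"
  shows "partial a (partial k (qf p)) x = 2 * H x k a"
proof -
  have e: "partial k (qf p) = (\<lambda>x. (\<Sum>j\<in>UNIV. 2 * (H x k j * S p j x)) + rem p k x)"
    by (rule ext) (simp add: partial_qf sum_distrib_left)
  have r: "partial a (rem p k) x = 0"
  proof -
    have "partial a (\<lambda>x. rem p k x) x = 0"
      unfolding rem_def
      by (subst partial_add, (intro smooth_intros smooth_H smooth_S smooth_kos smooth_partial)+,
          subst partial_add, (intro smooth_intros smooth_H smooth_S smooth_kos smooth_partial)+,
          subst partial_sum, (intro smooth_intros smooth_H smooth_S smooth_kos smooth_partial)+,
          subst partial_sum, (intro smooth_intros smooth_H smooth_S smooth_kos smooth_partial)+,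
          subst partial_sum, (intro smooth_intros smooth_H smooth_S smooth_kos smooth_partial)+,
          subst partial_sum, (intro smooth_intros smooth_H smooth_S smooth_kos smooth_partial)+,
          subst partial_sum, (intro smooth_intros smooth_H smooth_S smooth_kos smooth_partial)+,
          subst (1 2 3) partial_prod_zero, (intro smooth_intros smooth_H smooth_S smooth_kos smooth_partial qf_zero_imp[OF z])+)
         simp
    then show ?thesis .
  qed
  have "partial a (partial k (qf p)) x = (\<Sum>j\<in>UNIV. 2 * partial a (\<lambda>x. H x k j * S p j x) x) + partial a (rem p k) x"
    unfolding e
    by (subst partial_add, (intro smooth_intros smooth_H smooth_S smooth_rem)+, subst partial_sum,
        (intro smooth_intros smooth_H smooth_S)+, subst partial_cmult, (intro smooth_intros smooth_H smooth_S)+, rule refl)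
  also have "\<dots> = 2 * (\<Sum>j\<in>UNIV. H x j k * proj j a)"
    unfolding r partial_mult[OF smooth_H smooth_S] partial_S qf_zero_imp[OF z]
    by (simp add: sum_distrib_left sym_H[of x k])
  finally show ?thesis by (simp add: sum_H_proj sym_H[of x a k])
qed

text \<open>On the zero set the value is twice the trace of \<open>hinv\<close> times
  \<open>H\<close>, a projection of rank \<open>n - 1\<close>. For \<open>n \<ge> 4\<close> this is
  at least 6, and by compactness it stays above \<open>11 / 2\<close> where \<open>qf\<close> is
  small.\<close>

lemma lap_qf:
  assumes "CARD('n) \<ge> 4"
  obtains d where "d > 0"
    "\<And>x. x \<in> K \<Longrightarrow> qf p x < d \<Longrightarrow> (lap (qf p) x) \<ge> 11 / 2"
proof -
  let ?L = "\<lambda>x. lap (qf p) x"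
  let ?f = "\<lambda>x. ?L x - 2 * (real CARD('n) - 1)"
  have z: "?f x = 0" if "qf p x = 0" for x
  proof -
    have "?L x = 2 * (\<Sum>i\<in>UNIV. \<Sum>j\<in>UNIV. hinv x i j * H x j i)"
      by (simp add: hess_qf_zero[OF that] sum_distrib_left mult.left_commute)
    also have "\<dots> = 2 * (\<Sum>i\<in>UNIV. 1 - (u $ i * \<nu> x i) * (1 / c x))" by (simp add: sum_hinv_H)
    also have "\<dots> = 2 * (real CARD('n) - 1)"
      unfolding sum_subtractf sum_distrib_right[symmetric] sum_u_\<nu> by simp
    finally show ?thesis by simp
  qed
  have "continuous_on K ?f"
    by (intro smooth_continuous smooth_intros smooth_hinv smooth_partial smooth_qf)
  then obtain d where d: "d > 0" "\<And>x. x \<in> K \<Longrightarrow> qf p x < d \<Longrightarrow> \<bar>?f x\<bar> < 1 / 2"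
    using small_near_zeros[OF K _ smooth_continuous[OF smooth_qf], of ?f p "1/2"] qf_parts(3) z by auto
  have "?L x \<ge> 11 / 2" if "x \<in> K" "qf p x < d" for x
  proof -
    have n: "real CARD('n) \<ge> 4" using assms by simp
    have "y \<ge> 11 / 2" if "\<bar>y - 2 * (r - 1)\<bar> < 1 / 2" "r \<ge> 4" for y r :: real
    proof -
      have "2 * (r - 1) - y \<le> \<bar>y - 2 * (r - 1)\<bar>" using abs_ge_minus_self[of "y - 2 * (r - 1)"] by simp
      then have "2 * (r - 1) - y < 1 / 2" using that(1) by (rule le_less_trans)
      then show ?thesis using that(2) by (simp add: field_simps)
    qed
    from this[OF d(2)[OF that] n] show ?thesis .
  qed
  then show ?thesis using that d(1) by blast
qed

text \<open>The gradient is \<open>V + rem\<close> with \<open>V = 2 * H S\<close>. The part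
  quadratic in \<open>V\<close> gives \<open>4 * H(S, S) \<le> 4 * qf\<close>. The rest is
  \<open>k\<close> times \<open>rem\<close>, with \<open>rem\<close> of order \<open>qf\<close> and
  \<open>k\<close> vanishing on the zero set, hence at most \<open>qf / 2\<close> where
  \<open>qf\<close> is small.\<close>

lemma hgrad_qf:
  obtains d where "d > 0"
    "\<And>x. x \<in> K \<Longrightarrow> qf p x < d \<Longrightarrow> (grad2 (qf p) x) \<le> 9 / 2 * qf p x"
proof -
  define V where "V a x = 2 * (\<Sum>j\<in>UNIV. H x a j * S p j x)" for a x
  define k where "k j x = (\<Sum>i\<in>UNIV. hinv x i j * (2 * V i x + rem p i x))" for j x
  have sV: "smooth (V a)" for a unfolding V_def by (intro smooth_intros smooth_H smooth_S)
  have sk: "smooth (k a)" for a unfolding k_def by (intro smooth_intros smooth_hinv smooth_rem sV)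
  have k0: "k a x = 0" if "qf p x = 0" for a x
    using that by (simp add: k_def V_def rem_def qf_zero_imp)
  have "\<exists>C\<ge>0. \<forall>j. \<forall>x\<in>K. \<bar>rem p j x\<bar> \<le> C * qf p x"
  proof -
    obtain C where C: "\<And>j. C j \<ge> 0" "\<And>j x. x \<in> K \<Longrightarrow> \<bar>rem p j x\<bar> \<le> C j * qf p x"
      using Oq_rem unfolding Oq_def by metis
    have "C j \<le> (\<Sum>j\<in>UNIV. C j)" for j by (rule member_le_sum) (use C in auto)
    then have "\<bar>rem p j x\<bar> \<le> (\<Sum>j\<in>UNIV. C j) * qf p x" if "x \<in> K" for j x
      using C(2)[OF that, of j] mult_right_mono[OF _ qf_parts(3)] by (meson order_trans)
    then show ?thesis using C(1) by (intro exI[of _ "\<Sum>j\<in>UNIV. C j"]) (auto intro: sum_nonneg)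
  qed
  then obtain C where C: "C \<ge> 0" "\<And>j x. x \<in> K \<Longrightarrow> \<bar>rem p j x\<bar> \<le> C * qf p x" by blast
  have "1 / (2 * (C + 1)) > 0" using C by simp
  moreover have "continuous_on K (\<lambda>x. \<Sum>j\<in>UNIV. \<bar>k j x\<bar>)"
    by (intro continuous_intros smooth_continuous sk)
  ultimately obtain d where d: "d > 0" "\<And>x. x \<in> K \<Longrightarrow> qf p x < d \<Longrightarrow> \<bar>\<Sum>j\<in>UNIV. \<bar>k j x\<bar>\<bar> < 1 / (2 * (C + 1))"
    using small_near_zeros[OF K _ smooth_continuous[OF smooth_qf], of "\<lambda>x. \<Sum>j\<in>UNIV. \<bar>k j x\<bar>" p "1 / (2 * (C + 1))"] qf_parts(3) k0 by auto
  show ?thesis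
  proof
    show "d > 0" by fact
    fix x assume x: "x \<in> K" "qf p x < d"
    have hV: "(\<Sum>i\<in>UNIV. hinv x i j * V i x) = 2 * (S p j x - u $ j * (\<Sum>i\<in>UNIV. \<nu> x i * S p i x) / c x)" for j
    proof -
      have "(\<Sum>i\<in>UNIV. hinv x i j * V i x) = 2 * (\<Sum>l\<in>UNIV. (\<Sum>i\<in>UNIV. hinv x j i * H x i l) * S p l x)"
        unfolding V_def sum_distrib_left sum_distrib_right
        by (subst sum.swap) (intro sum.cong refl, subst sym_hinv, simp)
      also have "\<dots> = 2 * (\<Sum>l\<in>UNIV. (if j = l then S p l x else 0) - (\<nu> x l * S p l x) * (u $ j / c x))"
        unfolding sum_hinv_H by (intro arg_cong[where f = "(*) 2"] sum.cong refl) (simp add: algebra_simps)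
      also have "\<dots> = 2 * (S p j x - u $ j * (\<Sum>i\<in>UNIV. \<nu> x i * S p i x) / c x)"
        unfolding sum_subtractf sum_distrib_right[symmetric] by simp
      finally show ?thesis .
    qed
    \<comment> \<open>\<open>hinv\<close> times \<open>H\<close> is a projection along
      \<open>u\<close> and \<open>H\<close> annihilates \<open>u\<close>, so contracting two copies
      of \<open>2 * H S\<close> with \<open>hinv\<close> returns \<open>4 * H(S, S)\<close>.\<close>
    have VV: "(\<Sum>i\<in>UNIV. \<Sum>j\<in>UNIV. hinv x i j * (V i x * V j x)) = 4 * (\<Sum>i\<in>UNIV. \<Sum>j\<in>UNIV. H x i j * (S p i x * S p j x))"
    proof -
      have uV: "(\<Sum>j\<in>UNIV. u $ j * V j x) = 0"
      proof -
        have "(\<Sum>j\<in>UNIV. u $ j * V j x) = 2 * (\<Sum>l\<in>UNIV. (\<Sum>j\<in>UNIV. u $ j * H x j l) * S p l x)"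
          unfolding V_def sum_distrib_left sum_distrib_right by (subst sum.swap) (simp add: algebra_simps)
        then show ?thesis by (simp add: sum_u_H)
      qed
      have "(\<Sum>i\<in>UNIV. \<Sum>j\<in>UNIV. hinv x i j * (V i x * V j x)) = (\<Sum>j\<in>UNIV. (\<Sum>i\<in>UNIV. hinv x i j * V i x) * V j x)"
        unfolding sum_distrib_right by (subst sum.swap) (simp add: mult.assoc)
      also have "\<dots> = (\<Sum>j\<in>UNIV. 2 * (S p j x * V j x) - (2 * (\<Sum>i\<in>UNIV. \<nu> x i * S p i x) / c x) * (u $ j * V j x))"
        unfolding hV by (intro sum.cong refl) (simp add: algebra_simps)
      also have "\<dots> = 2 * (\<Sum>j\<in>UNIV. S p j x * V j x)"
        unfolding sum_subtractf sum_distrib_left[symmetric] uV by simp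
      also have "\<dots> = 4 * (\<Sum>i\<in>UNIV. \<Sum>j\<in>UNIV. H x i j * (S p i x * S p j x))"
        unfolding V_def by (simp add: sum_distrib_left algebra_simps)
      finally show ?thesis .
    qed
    have "(grad2 (qf p) x)
      = (\<Sum>i\<in>UNIV. \<Sum>j\<in>UNIV. hinv x i j * (V i x * V j x) + (hinv x i j * (V i x + rem p i x) * rem p j x + hinv x i j * V j x * rem p i x))"
      unfolding partial_qf V_def[symmetric] by (intro sum.cong refl) (simp add: algebra_simps)
    also have "\<dots> = (\<Sum>i\<in>UNIV. \<Sum>j\<in>UNIV. hinv x i j * (V i x * V j x)) + (\<Sum>j\<in>UNIV. k j x * rem p j x)"
    proof -
      have "(\<Sum>i\<in>UNIV. \<Sum>j\<in>UNIV. hinv x i j * V j x * rem p i x) = (\<Sum>i\<in>UNIV. \<Sum>j\<in>UNIV. hinv x i j * V i x * rem p j x)"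
        by (subst sum.swap) (simp add: sym_hinv[of x])
      moreover have "(\<Sum>j\<in>UNIV. k j x * rem p j x) = (\<Sum>i\<in>UNIV. \<Sum>j\<in>UNIV. hinv x i j * (V i x + rem p i x) * rem p j x + hinv x i j * V i x * rem p j x)"
        unfolding k_def sum_distrib_right by (subst sum.swap) (simp add: algebra_simps)
      ultimately show ?thesis by (simp add: sum.distrib)
    qed
    also have "\<dots> \<le> 4 * qf p x + 1 / 2 * qf p x"
    proof (rule add_mono)
      show "(\<Sum>i\<in>UNIV. \<Sum>j\<in>UNIV. hinv x i j * (V i x * V j x)) \<le> 4 * qf p x"
        unfolding VV using qf_parts(1)[of x p] by simp
      have "(\<Sum>j\<in>UNIV. k j x * rem p j x) \<le> (\<Sum>j\<in>UNIV. \<bar>k j x\<bar> * (C * qf p x))"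
      proof (rule sum_mono)
        fix j
        have "k j x * rem p j x \<le> \<bar>k j x\<bar> * \<bar>rem p j x\<bar>" by (metis abs_ge_self abs_mult)
        also have "\<dots> \<le> \<bar>k j x\<bar> * (C * qf p x)" by (intro mult_left_mono C x) auto
        finally show "k j x * rem p j x \<le> \<bar>k j x\<bar> * (C * qf p x)" .
      qed
      also have "\<dots> = (\<Sum>j\<in>UNIV. \<bar>k j x\<bar>) * (C * qf p x)" by (simp add: sum_distrib_right)
      also have "\<dots> \<le> 1 / (2 * (C + 1)) * (C * qf p x)"
        using d(2)[OF x] C(1) qf_parts(3) by (intro mult_right_mono) auto
      also have "\<dots> = (C / (C + 1)) * (1 / 2 * qf p x)" by simp
      also have "\<dots> \<le> 1 * (1 / 2 * qf p x)" using C(1) qf_parts(3) by (intro mult_right_mono) auto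
      finally show "(\<Sum>j\<in>UNIV. k j x * rem p j x) \<le> 1 / 2 * qf p x" by simp
    qed
    finally show "(grad2 (qf p) x) \<le> 9 / 2 * qf p x" by simp
  qed
qed

text \<open>The constant \<open>Cq\<close> does not depend on \<open>\<delta>\<close>, and every
  smaller \<open>\<delta>\<close> is admissible, so tubes can be shrunk until they are
  disjoint.\<close>

lemma tube_qf:
  assumes "CARD('n) \<ge> 4" "\<And>x. - M \<le> b x" "\<And>x. b x \<le> 0"
    "\<beta> \<ge> 0" "\<beta> * (real CARD('n) - 2) \<ge> M + 1"
  obtains Cq d where "d > 0" "\<And>\<delta>. 0 < \<delta> \<Longrightarrow> \<delta> \<le> d \<Longrightarrow> tube h u b \<beta> (qf p) K M Cq \<delta>"
proof -
  obtain C1 where C1: "C1 \<ge> 0" "\<And>x. x \<in> K \<Longrightarrow> \<bar>\<Sum>a\<in>UNIV. (partial a (qf p) x)\<^sup>2\<bar> \<le> C1 * qf p x"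
    using Oq_grad unfolding Oq_def by blast
  obtain C2 where C2: "C2 \<ge> 0" "\<And>x. x \<in> K \<Longrightarrow> \<bar>\<Sum>a\<in>UNIV. u $ a * partial a (qf p) x\<bar> \<le> C2 * qf p x"
    using Oq_u unfolding Oq_def by blast
  obtain C3 where C3: "C3 \<ge> 0" "\<And>x. x \<in> K \<Longrightarrow> \<bar>hess_u (qf p) x\<bar> \<le> C3 * qf p x"
    using Oq_uu unfolding Oq_def by blast
  define C where "C = C1 + C2 + C3"
  have C: "C \<ge> 0" "C1 * qf p x \<le> C * qf p x" "C2 * qf p x \<le> C * qf p x" "C3 * qf p x \<le> C * qf p x" for x
    using C1(1) C2(1) C3(1) qf_parts(3)[of p x] by (auto simp: C_def intro!: mult_right_mono)
  obtain d1 where d1: "d1 > 0"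
    "\<And>x. x \<in> K \<Longrightarrow> qf p x < d1 \<Longrightarrow> (lap (qf p) x) \<ge> 11 / 2"
    using lap_qf[OF assms(1)] by blast
  obtain d2 where d2: "d2 > 0"
    "\<And>x. x \<in> K \<Longrightarrow> qf p x < d2 \<Longrightarrow> (grad2 (qf p) x) \<le> 9 / 2 * qf p x"
    using hgrad_qf by blast
  show ?thesis
  proof
    show "min d1 d2 > 0" using d1(1) d2(1) by simp
    fix \<delta> assume \<delta>: "0 < \<delta>" "\<delta> \<le> min d1 d2"
    show "tube h u b \<beta> (qf p) K M C \<delta>"
    proof unfold_locales
      fix x assume x: "x \<in> K"
      show "(\<Sum>i\<in>UNIV. (partial i (qf p) x)\<^sup>2) \<le> C * qf p x" using C1(2)[OF x] C(2)[of x] by linarith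
      show "\<bar>\<Sum>i\<in>UNIV. u $ i * partial i (qf p) x\<bar> \<le> C * qf p x" using C2(2)[OF x] C(3)[of x] by linarith
      show "\<bar>hess_u (qf p) x\<bar> \<le> C * qf p x"
        using C3(2)[OF x] C(4)[of x] by linarith
    qed (use \<delta> d1 d2 C(1) K assms smooth_qf qf_parts(3) in auto)
  qed
qed

end

end

section \<open>Several disjoint lines\<close>

context line_field begin

lemma G_form: "v \<bullet> ((\<chi> i j. G x t i j) *v v) =
    exp (2 * \<beta> * t) * (\<Sum>i\<in>UNIV. \<Sum>j\<in>UNIV. H x i j * (v $ i * v $ j))
    + exp (2 * b x * t) * ((\<Sum>i\<in>UNIV. \<nu> x i * v $ i)\<^sup>2 / c x)"
proof -
  have "v \<bullet> ((\<chi> i j. G x t i j) *v v) = (\<Sum>i\<in>UNIV. \<Sum>j\<in>UNIV. exp (2 * \<beta> * t) * (H x i j * (v $ i * v $ j))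
     + exp (2 * b x * t) * ((\<nu> x i * v $ i) * (\<nu> x j * v $ j) / c x))"
    by (simp add: inner_vec_def matrix_vector_mult_def sum_distrib_left G_def \<tau>_def algebra_simps)
  moreover have "(\<Sum>i\<in>UNIV. \<nu> x i * v $ i)\<^sup>2 / c x = (\<Sum>i\<in>UNIV. \<Sum>j\<in>UNIV. (\<nu> x i * v $ i) * (\<nu> x j * v $ j) / c x)"
    by (simp only: power2_eq_square sum_product sum_divide_distrib)
  ultimately show ?thesis by (simp only: sum.distrib sum_distrib_left)
qed

text \<open>The two orthogonal parts are scaled with exponents \<open>2 * \<beta> * t\<close> and
  \<open>2 * b x * t\<close>, both between \<open>2 * b x\<close> and \<open>2 * \<beta>\<close>.
  The lower bound is what excludes unwanted shortcuts.\<close>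

lemma G_range:
  assumes "0 \<le> t" "t \<le> 1" "b x \<le> 0" "\<beta> \<ge> 0"
  shows "exp (2 * b x) * (v \<bullet> (h x *v v)) \<le> v \<bullet> ((\<chi> i j. G x t i j) *v v)"
    "v \<bullet> ((\<chi> i j. G x t i j) *v v) \<le> exp (2 * \<beta>) * (v \<bullet> (h x *v v))"
proof -
  define P where "P = (\<Sum>i\<in>UNIV. \<Sum>j\<in>UNIV. H x i j * (v $ i * v $ j))"
  define R where "R = (\<Sum>i\<in>UNIV. \<nu> x i * v $ i)\<^sup>2 / c x"
  have P: "P \<ge> 0" unfolding P_def by (rule H_form_nonneg)
  have R: "R \<ge> 0" unfolding R_def using c_pos[of x] by simp
  have h: "v \<bullet> (h x *v v) = P + R" using H_form[of x v] by (simp add: P_def R_def)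
  have G: "v \<bullet> ((\<chi> i j. G x t i j) *v v) = exp (2 * \<beta> * t) * P + exp (2 * b x * t) * R"
    unfolding G_form P_def R_def ..
  have b: "b x \<le> b x * t" "b x * t \<le> 0" "0 \<le> \<beta> * t" "\<beta> * t \<le> \<beta>"
    using assms mult_left_mono_neg[of t 1 "b x"] mult_left_mono[of t 1 \<beta>] by (auto simp: mult_nonpos_nonneg)
  have e: "exp (2 * b x) \<le> exp (2 * \<beta> * t)" "exp (2 * b x) \<le> exp (2 * b x * t)"
     "exp (2 * \<beta> * t) \<le> exp (2 * \<beta>)" "exp (2 * b x * t) \<le> exp (2 * \<beta>)"
  proof -
    have "b x \<le> \<beta> * t" "b x * t \<le> \<beta>" using b assms by linarith+
    then show "exp (2 * b x) \<le> exp (2 * \<beta> * t)" "exp (2 * b x) \<le> exp (2 * b x * t)"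
     "exp (2 * \<beta> * t) \<le> exp (2 * \<beta>)" "exp (2 * b x * t) \<le> exp (2 * \<beta>)"
      using b by (simp_all only: mult.assoc exp_le_cancel_iff mult_le_cancel_left_pos zero_less_numeral)
  qed
  show "exp (2 * b x) * (v \<bullet> (h x *v v)) \<le> v \<bullet> ((\<chi> i j. G x t i j) *v v)"
    unfolding h G distrib_left using e P R by (intro add_mono mult_right_mono) auto
  show "v \<bullet> ((\<chi> i j. G x t i j) *v v) \<le> exp (2 * \<beta>) * (v \<bullet> (h x *v v))"
    unfolding h G distrib_left using e P R by (intro add_mono mult_right_mono) auto
qed

lemma G_core: "u \<bullet> ((\<chi> i j. G x 1 i j) *v u) = exp (2 * b x) * (u \<bullet> (h x *v u))"
proof -
  have z: "(\<Sum>i\<in>UNIV. \<Sum>j\<in>UNIV. H x i j * (u $ i * u $ j)) = 0"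
  proof -
    have "(\<Sum>i\<in>UNIV. \<Sum>j\<in>UNIV. H x i j * (u $ i * u $ j)) = (\<Sum>j\<in>UNIV. (\<Sum>i\<in>UNIV. u $ i * H x i j) * u $ j)"
      unfolding sum_distrib_right by (subst sum.swap) (simp add: algebra_simps)
    then show ?thesis by (simp add: sum_u_H)
  qed
  show ?thesis using H_form[of x u] unfolding G_form z by simp
qed

lemma G_0: "G x 0 i j = h x $ i $ j" by (simp add: G_def H_def)
lemma sym_G: "G x t i j = G x t j i"
  using sym_\<tau>[of x i j] sym_H[of x i j] by (simp add: G_def)

lemma qf_periodic:
  assumes "\<And>i. u $ i \<in> \<int>" "lattice_rel x y"
  shows "qf p x = qf p y"
proof -
  have "S p j x = S p j y \<and> kos p j x = kos p j y" for j
  proof -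
    have "\<theta> p j x - \<theta> p j y = u $ piv * (x $ j - y $ j) - u $ j * (x $ piv - y $ piv)"
      by (simp add: \<theta>_def algebra_simps)
    also have "\<dots> \<in> \<int>" using assms by (auto simp: lattice_rel_def)
    finally obtain n where "\<theta> p j x - \<theta> p j y = of_int n" by (auto elim: Ints_cases)
    then have "2 * pi * \<theta> p j x = 2 * pi * \<theta> p j y + 2 * pi * of_int n" by (simp add: algebra_simps)
    then show ?thesis by (simp add: S_def kos_def sin_add cos_add sin_int_2pin cos_int_2pin)
  qed
  moreover have "H x i j = H y i j" for i j
    using periodic_h[OF assms(2)] by (simp add: H_def \<tau>_def \<nu>_def c_def)
  ultimately show ?thesis by (simp add: qf_def)
qed

lemma G_periodic:
  assumes "lattice_rel x y" "b x = b y"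
  shows "G x t i j = G y t i j"
  using periodic_h[OF assms(1)] assms(2) by (simp add: G_def H_def \<tau>_def \<nu>_def c_def)

end

lemma finite_pos_lower_bound:
  fixes f :: "'a \<Rightarrow> real"
  assumes "finite A" "\<And>a. a \<in> A \<Longrightarrow> f a > 0"
  obtains m where "m > 0" "\<And>a. a \<in> A \<Longrightarrow> m \<le> f a"
proof
  show "Min (insert 1 (f ` A)) > 0" using assms by (subst Min_gr_iff) auto
  show "Min (insert 1 (f ` A)) \<le> f a" if "a \<in> A" for a using assms that by (intro Min_le) auto
qed

context metric_field begin

text \<open>By compactness of \<open>K\<close>, disjoint zero sets have disjoint tubes. Near a point
  of \<open>K\<close> the metric is then \<open>h\<close> or a one-line metric, and the local claims
  reduce to these two cases.\<close>

lemma lines_metric: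
  fixes b :: "real ^ 'n \<Rightarrow> real" and u p :: "nat \<Rightarrow> real ^ 'n" and K :: "(real ^ 'n) set"
  assumes card: "CARD('n) \<ge> 4" and K: "compact K" and b: "smooth b" "\<And>x y. lattice_rel x y \<Longrightarrow> b x = b y"
    "\<And>x. - M \<le> b x" "\<And>x. b x \<le> 0"
    and \<beta>: "\<beta> \<ge> 0" "\<beta> * (real CARD('n) - 2) \<ge> M + 1"
    and u: "\<And>k. k < N \<Longrightarrow> u k \<noteq> 0" "\<And>k i. k < N \<Longrightarrow> u k $ i \<in> \<int>"
    and disj: "\<And>k l x. k < N \<Longrightarrow> l < N \<Longrightarrow> k \<noteq> l \<Longrightarrow> line_field.qf h (u k) (p k) x = 0 \<Longrightarrow> line_field.qf h (u l) (p l) x \<noteq> 0"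
    and \<epsilon>: "\<epsilon> > 0"
  obtains m :: "real ^ 'n \<Rightarrow> real ^ 'n ^ 'n" where
    "\<And>i j. smooth (\<lambda>x. m x $ i $ j)" "\<And>x y. lattice_rel x y \<Longrightarrow> m x = m y" "\<And>x i j. m x $ i $ j = m x $ j $ i"
    "\<And>x v. x \<in> K \<Longrightarrow> exp (2 * b x) * (v \<bullet> (h x *v v)) \<le> v \<bullet> (m x *v v)"
    "\<And>x v. x \<in> K \<Longrightarrow> v \<bullet> (m x *v v) \<le> exp (2 * \<beta>) * (v \<bullet> (h x *v v))"
    "\<And>x k. x \<in> K \<Longrightarrow> k < N \<Longrightarrow> line_field.qf h (u k) (p k) x = 0 \<Longrightarrow>
        u k \<bullet> (m x *v u k) = exp (2 * b x) * (u k \<bullet> (h x *v u k))"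
    "\<And>x. x \<in> K \<Longrightarrow> curv m x > - \<epsilon>"
proof -
  define q where "q k = line_field.qf h (u k) (p k)" for k
  have lf: "line_field h (u k) b" if "k < N" for k
    by unfold_locales (use u that b in auto)
  have q0: "q k x \<ge> 0" if "k < N" for k x
    unfolding q_def by (rule line_field.qf_parts(3)[OF lf[OF that]])
  have sq: "smooth (q k)" if "k < N" for k
    unfolding q_def by (rule line_field.smooth_qf[OF lf[OF that]])
  have "\<forall>k\<in>{..<N}. \<exists>z. snd z > 0 \<and> (\<forall>\<delta>. 0 < \<delta> \<longrightarrow> \<delta> \<le> snd z \<longrightarrow> tube h (u k) b \<beta> (q k) K M (fst z) \<delta>)"
  proof
    fix k assume "k \<in> {..<N}"
    then have k: "k < N" by simp
    obtain C d where "d > 0" "\<And>\<delta>. 0 < \<delta> \<Longrightarrow> \<delta> \<le> d \<Longrightarrow> tube h (u k) b \<beta> (q k) K M C \<delta>"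
      using line_field.tube_qf[OF lf[OF k] K card b(3,4) \<beta>, of "p k"] unfolding q_def by blast
    then show "\<exists>z. snd z > 0 \<and> (\<forall>\<delta>. 0 < \<delta> \<longrightarrow> \<delta> \<le> snd z \<longrightarrow> tube h (u k) b \<beta> (q k) K M (fst z) \<delta>)"
      by (intro exI[of _ "(C, d)"]) simp
  qed
  from bchoice[OF this] obtain z where z: "\<forall>k\<in>{..<N}. snd (z k) > 0 \<and>
      (\<forall>\<delta>. 0 < \<delta> \<longrightarrow> \<delta> \<le> snd (z k) \<longrightarrow> tube h (u k) b \<beta> (q k) K M (fst (z k)) \<delta>)" by blast
  define C where "C k = fst (z k)" for k
  define d where "d k = snd (z k)" for k
  have d: "\<And>k. k < N \<Longrightarrow> d k > 0" "\<And>k \<delta>. k < N \<Longrightarrow> 0 < \<delta> \<Longrightarrow> \<delta> \<le> d k \<Longrightarrow> tube h (u k) b \<beta> (q k) K M (C k) \<delta>"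
    using z by (simp_all add: C_def d_def)
  obtain d0 where d0: "d0 > 0" "\<And>k. k < N \<Longrightarrow> d0 \<le> d k"
    using finite_pos_lower_bound[of "{..<N}" d] d(1) by auto
  have "\<exists>m>0. \<forall>x\<in>K. q k x + q l x \<ge> m" if "k < N" "l < N" "k \<noteq> l" for k l
  proof -
    have "continuous_on K (\<lambda>x. q k x + q l x)"
      by (intro smooth_continuous smooth_intros sq that)
    moreover have "q k x + q l x > 0" for x
      using q0[OF that(1), of x] q0[OF that(2), of x] disj[OF that, of x] unfolding q_def by (cases "line_field.qf h (u k) (p k) x = 0") auto
    ultimately obtain m where "m > 0" "\<And>x. x \<in> K \<Longrightarrow> q k x + q l x \<ge> m"
      using compact_pos_lower_bound[OF K, of "\<lambda>x. q k x + q l x"] by blast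
    then show ?thesis by blast
  qed
  then have "\<forall>z\<in>{z \<in> {..<N} \<times> {..<N}. fst z \<noteq> snd z}. \<exists>m. m > 0 \<and> (\<forall>x\<in>K. q (fst z) x + q (snd z) x \<ge> m)"
    by auto
  from bchoice[OF this] obtain m0 where m00: "\<forall>z\<in>{z \<in> {..<N} \<times> {..<N}. fst z \<noteq> snd z}. m0 z > 0 \<and> (\<forall>x\<in>K. q (fst z) x + q (snd z) x \<ge> m0 z)"
    by blast
  have m0: "m0 (k, l) > 0 \<and> (\<forall>x\<in>K. q k x + q l x \<ge> m0 (k, l))" if "k < N" "l < N" "k \<noteq> l" for k l
    using m00 that by simp
  have "\<And>z. z \<in> {z \<in> {..<N} \<times> {..<N}. fst z \<noteq> snd z} \<Longrightarrow> m0 z > 0" using m0 by auto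
  then obtain m1 where m1: "m1 > 0" "\<And>z. z \<in> {z \<in> {..<N} \<times> {..<N}. fst z \<noteq> snd z} \<Longrightarrow> m1 \<le> m0 z"
    using finite_pos_lower_bound[of "{z \<in> {..<N} \<times> {..<N}. fst z \<noteq> snd z}" m0] by auto
  \<comment> \<open>\<open>m1\<close> bounds from below the sum of any two different
    \<open>q k\<close> on \<open>K\<close>. Where one of them is below \<open>m1 / 2\<close>, every
    other one exceeds it.\<close>
  define \<delta> where "\<delta> = min d0 (m1 / 2)"
  have \<delta>: "\<delta> > 0" "\<delta> \<le> d0" "2 * \<delta> \<le> m1" using d0 m1 by (auto simp: \<delta>_def)
  have sep: "q l x > \<delta>" if "k < N" "l < N" "k \<noteq> l" "x \<in> K" "q k x < \<delta>" for k l x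
  proof -
    have "m1 \<le> m0 (k, l)" by (rule m1(2)) (use that in auto)
    moreover have "m0 (k, l) \<le> q k x + q l x" using m0[OF that(1-3)] that(4) by blast
    ultimately show ?thesis using that(5) \<delta> by linarith
  qed
  have tb: "tube h (u k) b \<beta> (q k) K M (C k) \<delta>" if "k < N" for k
    using d(2)[OF that \<delta>(1)] d0(2)[OF that] \<delta>(2) by linarith
  define G where "G k = line_field.G h (u k) b \<beta>" for k
  have "\<forall>k\<in>{..<N}. \<exists>L0. L0 \<ge> 1 \<and> (\<forall>x\<in>K. \<forall>L\<ge>L0. curv (\<lambda>x. \<chi> i j. G k x (tube.w (q k) \<delta> L x) i j) x > - \<epsilon>)"
  proof
    fix k assume "k \<in> {..<N}"
    then have k: "k < N" by simp
    obtain L0 where "L0 \<ge> 1" "\<And>x L. x \<in> K \<Longrightarrow> L \<ge> L0 \<Longrightarrow> curv (\<lambda>x. \<chi> i j. G k x (tube.w (q k) \<delta> L x) i j) x > - \<epsilon>"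
      using tube.curv_eventually[OF tb[OF k] \<epsilon>] unfolding G_def by blast
    then show "\<exists>L0. L0 \<ge> 1 \<and> (\<forall>x\<in>K. \<forall>L\<ge>L0. curv (\<lambda>x. \<chi> i j. G k x (tube.w (q k) \<delta> L x) i j) x > - \<epsilon>)"
      by blast
  qed
  from bchoice[OF this] obtain L0 where L00: "\<forall>k\<in>{..<N}. L0 k \<ge> 1 \<and>
      (\<forall>x\<in>K. \<forall>L\<ge>L0 k. curv (\<lambda>x. \<chi> i j. G k x (tube.w (q k) \<delta> L x) i j) x > - \<epsilon>)" by blast
  have L0: "\<And>k. k < N \<Longrightarrow> L0 k \<ge> 1"
    "\<And>k x L. k < N \<Longrightarrow> x \<in> K \<Longrightarrow> L \<ge> L0 k \<Longrightarrow> curv (\<lambda>x. \<chi> i j. G k x (tube.w (q k) \<delta> L x) i j) x > - \<epsilon>"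
    using L00 by simp_all
  have L0': "0 \<le> L0 k" if "k < N" for k using L0(1)[OF that] by linarith
  \<comment> \<open>One scale for all tubes: the sum of the nonnegative thresholds dominates each of
    them.\<close>
  define L where "L = 1 + (\<Sum>k<N. L0 k)"
  have L: "L0 k \<le> L" if "k < N" for k
  proof -
    have "L0 k \<le> (\<Sum>k<N. L0 k)" by (rule member_le_sum) (use that L0' in auto)
    then show ?thesis by (simp add: L_def)
  qed
  have Lpos: "L > 0" unfolding L_def using L0' by (intro add_pos_nonneg sum_nonneg) auto
  define w where "w k = tube.w (q k) \<delta> L" for k
  have w: "0 \<le> w k x" "w k x \<le> 1" if "k < N" for k x
    unfolding w_def using tube.w_range[OF tb[OF that] Lpos] by auto
  have w_out: "w k x = 0" if "k < N" "q k x + \<delta> * exp (- L) \<ge> \<delta>" for k x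
    unfolding w_def using tube.w_outside[OF tb[OF that(1)], of L x] that(2) unfolding tube.Q_def[OF tb[OF that(1)]] by blast
  have sw: "smooth (w k)" if "k < N" for k
    unfolding w_def by (rule tube.smooth_w[OF tb[OF that]])
  have G0: "G k x 0 i j = h x $ i $ j" if "k < N" for k x i j
    unfolding G_def by (rule line_field.G_0[OF lf[OF that]])
  define m where "m x = (\<chi> i j. h x $ i $ j + (\<Sum>k<N. G k x (w k x) i j - h x $ i $ j))" for x
  have m_one: "m x = (\<chi> i j. G k x (w k x) i j)" if "k < N" "\<And>l. l < N \<Longrightarrow> l \<noteq> k \<Longrightarrow> w l x = 0" for k x
  proof -
    have "(\<Sum>l<N. G l x (w l x) i j - h x $ i $ j) = G k x (w k x) i j - h x $ i $ j" for i j
    proof -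
      have "(\<Sum>l<N. G l x (w l x) i j - h x $ i $ j) = (\<Sum>l\<in>{k}. G l x (w l x) i j - h x $ i $ j)"
        by (rule sum.mono_neutral_right) (use that G0 in auto)
      then show ?thesis by simp
    qed
    then show ?thesis by (simp add: m_def)
  qed
  have m_none: "m x = h x" if "\<And>l. l < N \<Longrightarrow> w l x = 0" for x
    using that G0 by (simp add: m_def vec_eq_iff)
  have cq: "open {y. q k y < a}" "open {y. q k y > a}" if "k < N" for k a
  proof -
    have "continuous_on UNIV (q k)" by (rule smooth_continuous[OF sq[OF that]])
    then show "open {y. q k y < a}" "open {y. q k y > a}"
      by (auto intro: open_Collect_less continuous_intros)
  qed
  have local: "(\<exists>k<N. \<exists>U. open U \<and> x \<in> U \<and> (\<forall>y\<in>U. m y = (\<chi> i j. G k y (w k y) i j)) \<and> (\<forall>l<N. q l x = 0 \<longrightarrow> l = k))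
     \<or> (\<exists>U. open U \<and> x \<in> U \<and> (\<forall>y\<in>U. m y = h y)) \<and> (\<forall>l<N. q l x \<noteq> 0)" if x: "x \<in> K" for x
  proof (cases "\<exists>k<N. q k x < \<delta>")
    case True
    then obtain k where k: "k < N" "q k x < \<delta>" by blast
    let ?U = "{y. q k y < \<delta>} \<inter> (\<Inter>l\<in>{..<N} - {k}. {y. q l y > \<delta>})"
    have "open ?U" by (intro open_Int open_INT cq k ballI) auto
    moreover have "x \<in> ?U" using k sep[OF k(1) _ _ x k(2)] by auto
    moreover have "m y = (\<chi> i j. G k y (w k y) i j)" if y: "y \<in> ?U" for y
    proof (rule m_one[OF k(1)])
      fix l assume l: "l < N" "l \<noteq> k"
      then have "q l y > \<delta>" using y by auto
      then show "w l y = 0" using w_out[OF l(1)] \<delta>(1) by (simp add: add_increasing2)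
    qed
    moreover have "\<forall>l<N. q l x = 0 \<longrightarrow> l = k"
      using sep[OF k(1) _ _ x k(2)] \<delta>(1) by fastforce
    ultimately show ?thesis using k(1) by blast
  next
    case False
    \<comment> \<open>The profile already vanishes for
      \<open>q \<ge> \<delta> - \<delta> * exp (- L)\<close>. This slack yields an open
      neighbourhood on which the metric is \<open>h\<close>, even at points where some
      \<open>q l\<close> equals \<open>\<delta>\<close>.\<close>
    let ?U = "\<Inter>l\<in>{..<N}. {y. q l y > \<delta> - \<delta> * exp (- L)}"
    have e: "\<delta> * exp (- L) > 0" using \<delta>(1) by simp
    have "open ?U" by (intro open_INT cq ballI) auto
    moreover have "x \<in> ?U"
    proof (intro INT_I CollectI)
      fix l assume "l \<in> {..<N}"
      then have "l < N" by simp
      then have "\<not> q l x < \<delta>" using False by blast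
      then have "\<delta> \<le> q l x" by simp
      then show "\<delta> - \<delta> * exp (- L) < q l x" using e by linarith
    qed
    moreover have "m y = h y" if y: "y \<in> ?U" for y
    proof (rule m_none)
      fix l assume l: "l < N"
      then have "q l y > \<delta> - \<delta> * exp (- L)" using y by auto
      then show "w l y = 0" using w_out[OF l] by simp
    qed
    moreover have "\<forall>l<N. q l x \<noteq> 0" using False \<delta>(1) by auto
    ultimately show ?thesis by blast
  qed
  show ?thesis
  proof
    show "smooth (\<lambda>x. m x $ i $ j)" for i j
      unfolding m_def G_def
      by (simp, intro smooth_intros smooth_h line_field.smooth_G[OF lf] sw) auto
    show "m x $ i $ j = m x $ j $ i" for x i j
      unfolding m_def G_def using sym_h[of x i j] line_field.sym_G[OF lf, of _ _ x _ i j] by simp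
    show "m x = m y" if "lattice_rel x y" for x y
    proof -
      have "w k x = w k y" if k: "k < N" for k
      proof -
        have "q k x = q k y"
          unfolding q_def by (rule line_field.qf_periodic[OF lf[OF k] u(2)[OF k] \<open>lattice_rel x y\<close>])
        then show ?thesis unfolding w_def tube.w_def[OF tb[OF k]] tube.T_def[OF tb[OF k]] tube.Q_def[OF tb[OF k]] by simp
      qed
      moreover have "G k x t i j = G k y t i j" if k: "k < N" for k t i j
        unfolding G_def by (rule line_field.G_periodic[OF lf[OF k] \<open>lattice_rel x y\<close> b(2)[OF \<open>lattice_rel x y\<close>]])
      ultimately show ?thesis using periodic_h[OF \<open>lattice_rel x y\<close>] by (simp add: m_def)
    qed
    fix x assume x: "x \<in> K"
    have cases: "(\<exists>k<N. m x = (\<chi> i j. G k x (w k x) i j)) \<or> m x = h x" using local[OF x] by blast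
    have hx: "0 \<le> v \<bullet> (h x *v v)" for v using pos_h[of v x] by (cases "v = 0") auto
    have e: "exp (2 * b x) \<le> 1" "1 \<le> exp (2 * \<beta>)" using b(4) \<beta>(1) by auto
    show "exp (2 * b x) * (v \<bullet> (h x *v v)) \<le> v \<bullet> (m x *v v)" for v
      using cases
    proof (elim disjE exE conjE)
      fix k assume k: "k < N" "m x = (\<chi> i j. G k x (w k x) i j)"
      show ?thesis unfolding k(2) G_def
        by (rule line_field.G_range(1)[OF lf[OF k(1)] w(1)[OF k(1)] w(2)[OF k(1)] b(4) \<beta>(1)])
    next
      assume "m x = h x"
      then show ?thesis using mult_right_mono[OF e(1) hx[of v]] by simp
    qed
    show "v \<bullet> (m x *v v) \<le> exp (2 * \<beta>) * (v \<bullet> (h x *v v))" for v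
      using cases
    proof (elim disjE exE conjE)
      fix k assume k: "k < N" "m x = (\<chi> i j. G k x (w k x) i j)"
      show ?thesis unfolding k(2) G_def
        by (rule line_field.G_range(2)[OF lf[OF k(1)] w(1)[OF k(1)] w(2)[OF k(1)] b(4) \<beta>(1)])
    next
      assume "m x = h x"
      then show ?thesis using mult_right_mono[OF e(2) hx[of v]] by simp
    qed
    show "u k \<bullet> (m x *v u k) = exp (2 * b x) * (u k \<bullet> (h x *v u k))"
      if k: "k < N" "line_field.qf h (u k) (p k) x = 0" for k
    proof -
      have "q k x = 0" using k by (simp add: q_def)
      then have "m x = (\<chi> i j. G k x (w k x) i j)" using local[OF x] k(1) by blast
      moreover have "w k x = 1" unfolding w_def by (rule tube.w_core[OF tb[OF k(1)] Lpos \<open>q k x = 0\<close>])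
      ultimately show ?thesis using line_field.G_core[OF lf[OF k(1)]] by (simp add: G_def)
    qed
    show "curv m x > - \<epsilon>"
      using local[OF x]
    proof (elim disjE exE conjE)
      fix k U assume k: "k < N" "open U" "x \<in> U" "\<forall>y\<in>U. m y = (\<chi> i j. G k y (w k y) i j)"
      have "curv m x = curv (\<lambda>x. \<chi> i j. G k x (w k x) i j) x"
        by (rule curv_cong[OF k(2,3)]) (use k(4) in blast)
      then show ?thesis using L0(2)[OF k(1) x L[OF k(1)]] by (simp add: w_def)
    next
      fix U assume k: "open U" "x \<in> U" "\<forall>y\<in>U. m y = h y"
      have "curv m x = curv h x" by (rule curv_cong[OF k(1,2)]) (use k(3) in blast)
      then show ?thesis using \<epsilon> by (simp add: curv_h)
    qed
  qed
qed

end

section \<open>Lengths and distances\<close>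

definition nrm :: "'n::finite tensor2 \<Rightarrow> 'n torus \<Rightarrow> real ^ 'n \<Rightarrow> real" where
  "nrm g p v = sqrt (g p v v)"

text \<open>Common ground for the smooth metrics and for \<open>conformal f g0\<close>, which is
  only continuous.\<close>

definition cmetric :: "'n::finite tensor2 \<Rightarrow> bool" where
  "cmetric g \<longleftrightarrow> (\<forall>p. bilinear (g p)) \<and> (\<forall>p v. g p v v \<ge> 0) \<and> (\<forall>i j. continuous_on UNIV (\<lambda>x. comp_mat g x $ i $ j))"

lemma cmetric_components:
  assumes "bilinear (g (proj_torus x))"
  shows "g (proj_torus x) v w = (\<Sum>i\<in>UNIV. \<Sum>j\<in>UNIV. comp_mat g x $ i $ j * (v $ i * w $ j))"
proof -
  let ?B = "g (proj_torus x)"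
  have v: "v = (\<Sum>i\<in>UNIV. v $ i *\<^sub>R axis i 1)" for v :: "real ^ 'a"
    by (simp add: basis_expansion[of v, unfolded scalar_mult_eq_scaleR])
  have l1: "linear (\<lambda>v. ?B v w)" for w using assms by (simp add: bilinear_def)
  have l2: "linear (?B v)" for v using assms by (simp add: bilinear_def)
  have "?B v w = ?B (\<Sum>i\<in>UNIV. v $ i *\<^sub>R axis i 1) w" using v[of v] by simp
  also have "\<dots> = (\<Sum>i\<in>UNIV. v $ i * ?B (axis i 1) w)"
    using linear_sum[OF l1[of w], of "\<lambda>i. v $ i *\<^sub>R axis i 1" UNIV] linear_scale[OF l1[of w]] by simp
  also have "\<dots> = (\<Sum>i\<in>UNIV. v $ i * (\<Sum>j\<in>UNIV. w $ j * ?B (axis i 1) (axis j 1)))"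
  proof (intro sum.cong refl arg_cong2[where f = "(*)"])
    fix i
    have "?B (axis i 1) w = ?B (axis i 1) (\<Sum>j\<in>UNIV. w $ j *\<^sub>R axis j 1)" using v[of w] by simp
    also have "\<dots> = (\<Sum>j\<in>UNIV. w $ j * ?B (axis i 1) (axis j 1))"
      using linear_sum[OF l2[of "axis i 1"], of "\<lambda>j. w $ j *\<^sub>R axis j 1" UNIV] linear_scale[OF l2[of "axis i 1"]] by simp
    finally show "?B (axis i 1) w = (\<Sum>j\<in>UNIV. w $ j * ?B (axis i 1) (axis j 1))" .
  qed
  finally show ?thesis by (simp add: comp_mat_def sum_distrib_left mult_ac)
qed

context
  fixes g :: "'n::finite tensor2"
  assumes g: "cmetric g"
begin

lemma nrm_nonneg: "nrm g p v \<ge> 0"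
  using g by (simp add: nrm_def cmetric_def)

lemma nrm_scale: "nrm g p (r *\<^sub>R v) = \<bar>r\<bar> * nrm g p v"
proof -
  have l: "linear (\<lambda>v. g p v w)" "linear (g p v)" for v w using g by (auto simp: cmetric_def bilinear_def)
  have "g p (r *\<^sub>R v) (r *\<^sub>R v) = r\<^sup>2 * g p v v"
    using linear_scale[OF l(1)] linear_scale[OF l(2)] by (simp add: power2_eq_square)
  then show ?thesis by (simp add: nrm_def real_sqrt_mult)
qed

lemma continuous_nrm: "continuous_on S (\<lambda>z. nrm g (proj_torus (fst z)) (snd z))"
proof -
  have c: "continuous_on S (\<lambda>z. comp_mat g (fst z) $ i $ j)" for S :: "((real ^ 'n) \<times> (real ^ 'n)) set" and i j
  proof -
    have "continuous_on UNIV (\<lambda>x. comp_mat g x $ i $ j)" using g by (simp add: cmetric_def)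
    from continuous_on_compose2[OF this continuous_on_fst[OF continuous_on_id], of S] show ?thesis by simp
  qed
  have b: "bilinear (g p)" for p using g by (simp add: cmetric_def)
  show ?thesis
    unfolding nrm_def cmetric_components[where g = g, OF b] by (intro continuous_intros c)
qed

lemma isCont_nrm: "isCont (\<lambda>z. nrm g (proj_torus (fst z)) (snd z)) z"
  using continuous_nrm[of UNIV] by (cases z) (simp add: continuous_on_eq_continuous_at)

end

text \<open>Two lifts differ by lattice vectors at \<open>t\<close> and at nearby times. The
  difference is continuous at \<open>t\<close> with integer entries there, hence constant near
  \<open>t\<close>, so its derivative \<open>v - v'\<close> vanishes.\<close>

lemma has_velocity_unique:
  assumes "has_velocity \<gamma> v t UNIV" "has_velocity \<gamma> v' t UNIV"
  shows "v = v'"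
proof -
  obtain c where c: "proj_torus (c t) = \<gamma> t" "\<forall>\<^sub>F s in at t. proj_torus (c s) = \<gamma> s" "(c has_vector_derivative v) (at t)"
    using assms(1) by (auto simp: has_velocity_def)
  obtain c' where c': "proj_torus (c' t) = \<gamma> t" "\<forall>\<^sub>F s in at t. proj_torus (c' s) = \<gamma> s" "(c' has_vector_derivative v') (at t)"
    using assms(2) by (auto simp: has_velocity_def)
  define D where "D s = c s - c' s" for s
  have dD: "(D has_vector_derivative v - v') (at t)" unfolding D_def by (intro has_vector_derivative_diff c c')
  then have "D \<midarrow>t\<rightarrow> D t" using has_vector_derivative_continuous[OF dD] by (simp add: continuous_at)
  then have "\<forall>\<^sub>F s in at t. dist (D s) (D t) < 1" by (rule tendstoD) simp
  moreover have "\<forall>\<^sub>F s in at t. proj_torus (c s) = proj_torus (c' s)"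
    using c(2) c'(2) by eventually_elim simp
  ultimately have "\<forall>\<^sub>F s in at t. D s = D t"
  proof eventually_elim
    case (elim s)
    show ?case
    proof (rule vec_eq_iff[THEN iffD2], rule allI)
      fix i
      have "D s $ i \<in> \<int>" "D t $ i \<in> \<int>"
        using elim(2) c(1) c'(1) proj_torus_eq_iff[of "c s" "c' s"] proj_torus_eq_iff[of "c t" "c' t"]
        by (auto simp: D_def lattice_rel_def)
      then obtain m n where m: "D s $ i = of_int m" "D t $ i = of_int n" by (auto elim!: Ints_cases)
      have "\<bar>(D s - D t) $ i\<bar> \<le> norm (D s - D t)" by (rule component_le_norm_cart)
      also have "\<dots> < 1" using elim(1) by (simp add: dist_norm)
      finally have "m = n" using m by simp
      then show "D s $ i = D t $ i" using m by simp
    qed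
  qed
  then have "((\<lambda>s. D t) has_vector_derivative v - v') (at t)"
    using dD unfolding has_vector_derivative_def by (rule_tac has_derivative_transform_eventually) auto
  moreover have "((\<lambda>s. D t) has_vector_derivative 0) (at t)" by (rule has_vector_derivative_const)
  ultimately have "v - v' = 0" by (rule vector_derivative_unique_at)
  then show ?thesis by simp
qed

lemma velocity_eq: "has_velocity \<gamma> v t UNIV \<Longrightarrow> velocity \<gamma> t = v"
  unfolding velocity_def using has_velocity_unique by blast

lemma has_velocity_interior:
  assumes "has_velocity \<gamma> v t {a..b}" "a < t" "t < b"
  shows "has_velocity \<gamma> v t UNIV"
  using assms(1) unfolding has_velocity_def at_within_Icc_at[OF assms(2,3)] by simp

definition C1_data :: "(real \<Rightarrow> 'n::finite torus) \<Rightarrow> (real \<Rightarrow> real ^ 'n) \<Rightarrow> real \<Rightarrow> real \<Rightarrow> bool" where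
  "C1_data \<gamma> V a b \<longleftrightarrow> a < b \<and> continuous_on {a..b} V \<and> (\<forall>t\<in>{a..b}. has_velocity \<gamma> (V t) t {a..b})"

text \<open>The lift belonging to \<open>t\<close> is known to be continuous only at
  \<open>t\<close>, which is what continuity of the speed at \<open>t\<close> requires.\<close>

lemma continuous_on_speed:
  assumes g: "cmetric g" and V: "C1_data \<gamma> V a b"
  shows "continuous_on {a..b} (\<lambda>t. nrm g (\<gamma> t) (V t))"
  unfolding continuous_on_def
proof
  fix t assume t: "t \<in> {a..b}"
  then obtain c where c: "proj_torus (c t) = \<gamma> t" "\<forall>\<^sub>F s in at t within {a..b}. proj_torus (c s) = \<gamma> s"
    "(c has_vector_derivative V t) (at t within {a..b})"
    using V unfolding C1_data_def has_velocity_def by blast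
  have "(c \<longlongrightarrow> c t) (at t within {a..b})"
    using has_vector_derivative_continuous[OF c(3)] by (simp add: continuous_within)
  moreover have "(V \<longlongrightarrow> V t) (at t within {a..b})" using V t by (auto simp: C1_data_def continuous_on_def)
  ultimately have "((\<lambda>s. (c s, V s)) \<longlongrightarrow> (c t, V t)) (at t within {a..b})" by (rule tendsto_Pair)
  from isCont_tendsto_compose[OF isCont_nrm[OF g] this]
  have "((\<lambda>s. nrm g (proj_torus (c s)) (V s)) \<longlongrightarrow> nrm g (\<gamma> t) (V t)) (at t within {a..b})" by (simp add: c(1))
  then show "((\<lambda>t. nrm g (\<gamma> t) (V t)) \<longlongrightarrow> nrm g (\<gamma> t) (V t)) (at t within {a..b})"
    by (rule Lim_transform_eventually) (use c(2) in eventually_elim, simp)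
qed

text \<open>
  Piecewise \<open>C\<^sup>1\<close> curves on \<open>[a, b]\<close> together with their lengths. The velocity is a witness instead of the
  value of \<^const>\<open>velocity\<close>, which is unspecified at the break points.
\<close>

inductive pc :: "'n::finite tensor2 \<Rightarrow> (real \<Rightarrow> 'n torus) \<Rightarrow> real \<Rightarrow> real \<Rightarrow> real \<Rightarrow> bool" for g \<gamma> where
  base: "C1_data \<gamma> V a b \<Longrightarrow> pc g \<gamma> a b (integral {a..b} (\<lambda>t. nrm g (\<gamma> t) (V t)))"
| join: "pc g \<gamma> a b L \<Longrightarrow> pc g \<gamma> b c L' \<Longrightarrow> pc g \<gamma> a c (L + L')"

lemma pc_less: "pc g \<gamma> a b L \<Longrightarrow> a < b"
  by (induction rule: pc.induct) (auto simp: C1_data_def)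

lemma pc_has_integral:
  assumes g: "cmetric g"
  shows "pc g \<gamma> a b L \<Longrightarrow> ((\<lambda>t. sqrt (g (\<gamma> t) (velocity \<gamma> t) (velocity \<gamma> t))) has_integral L) {a..b}"
proof (induction rule: pc.induct)
  case (base V a b)
  have "((\<lambda>t. nrm g (\<gamma> t) (V t)) has_integral integral {a..b} (\<lambda>t. nrm g (\<gamma> t) (V t))) {a..b}"
    by (intro integrable_integral integrable_continuous_real continuous_on_speed[OF g base])
  then show ?case
  proof (rule has_integral_spike_finite[where S = "{a, b}", rotated 2])
    fix t assume "t \<in> {a..b} - {a, b}"
    then have "a < t" "t < b" "has_velocity \<gamma> (V t) t {a..b}" using base by (auto simp: C1_data_def)
    then have "velocity \<gamma> t = V t" by (intro velocity_eq has_velocity_interior)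
    then show "sqrt (g (\<gamma> t) (velocity \<gamma> t) (velocity \<gamma> t)) = nrm g (\<gamma> t) (V t)" by (simp add: nrm_def)
  qed simp
next
  case (join a b L c L')
  show ?case
    by (rule has_integral_combine[OF less_imp_le[OF pc_less[OF join.hyps(1)]] less_imp_le[OF pc_less[OF join.hyps(2)]] join.IH])
qed

lemma pc_nonneg: "cmetric g \<Longrightarrow> pc g \<gamma> a b L \<Longrightarrow> L \<ge> 0"
  by (rule has_integral_nonneg[OF pc_has_integral]) (auto simp: cmetric_def)

lemma piecewise_imp_pc:
  assumes "piecewise_C1_curve \<gamma>"
  obtains L where "pc g \<gamma> 0 1 L"
proof -
  obtain N :: nat and \<tau> where \<tau>: "\<tau> 0 = 0" "\<tau> N = 1" "\<And>k. k < N \<Longrightarrow> \<tau> k < \<tau> (Suc k) \<and> C1_curve_on (\<tau> k) (\<tau> (Suc k)) \<gamma>"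
    using assms unfolding piecewise_C1_curve_def by blast
  have piece: "\<exists>L. pc g \<gamma> (\<tau> k) (\<tau> (Suc k)) L" if k: "k < N" for k
  proof -
    obtain V where "C1_data \<gamma> V (\<tau> k) (\<tau> (Suc k))"
      using \<tau>(3)[OF k] unfolding C1_curve_on_def C1_data_def by blast
    then show ?thesis using pc.base by blast
  qed
  have all: "k < N \<Longrightarrow> \<exists>L. pc g \<gamma> (\<tau> 0) (\<tau> (Suc k)) L" for k
  proof (induction k)
    case 0 then show ?case using piece by blast
  next
    case (Suc k)
    then obtain L where "pc g \<gamma> (\<tau> 0) (\<tau> (Suc k)) L" by auto
    moreover obtain L' where "pc g \<gamma> (\<tau> (Suc k)) (\<tau> (Suc (Suc k))) L'" using piece[OF Suc.prems] by blast
    ultimately show ?case using pc.join by blast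
  qed
  have "N \<noteq> 0"
  proof
    assume "N = 0" then show False using \<tau>(1,2) by simp
  qed
  then obtain n where n: "N = Suc n" by (cases N) auto
  then have "\<exists>L. pc g \<gamma> (\<tau> 0) (\<tau> N) L" using all[of n] by simp
  then show ?thesis using \<tau>(1,2) that by auto
qed

lemma pc_imp_pieces:
  "pc g \<gamma> a b L \<Longrightarrow> \<exists>(N::nat) \<tau>. \<tau> 0 = a \<and> \<tau> N = b \<and> (\<forall>k<N. \<tau> k < \<tau> (Suc k) \<and> C1_curve_on (\<tau> k) (\<tau> (Suc k)) \<gamma>)"
proof (induction rule: pc.induct)
  case (base V a b)
  then show ?case
    by (intro exI[of _ 1] exI[of _ "\<lambda>k. if k = 0 then a else b"]) (auto simp: C1_data_def C1_curve_on_def)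
next
  case (join a b L c L')
  then obtain N :: nat and \<tau> where A: "\<tau> 0 = a" "\<tau> N = b" "\<And>k. k < N \<Longrightarrow> \<tau> k < \<tau> (Suc k) \<and> C1_curve_on (\<tau> k) (\<tau> (Suc k)) \<gamma>"
    by blast
  from join obtain N' :: nat and \<tau>' where B: "\<tau>' 0 = b" "\<tau>' N' = c" "\<And>k. k < N' \<Longrightarrow> \<tau>' k < \<tau>' (Suc k) \<and> C1_curve_on (\<tau>' k) (\<tau>' (Suc k)) \<gamma>"
    by blast
  let ?\<sigma> = "\<lambda>k. if k \<le> N then \<tau> k else \<tau>' (k - N)"
  have s1: "?\<sigma> k < ?\<sigma> (Suc k) \<and> C1_curve_on (?\<sigma> k) (?\<sigma> (Suc k)) \<gamma>" if k: "k < N + N'" for k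
  proof -
    consider (less) "k < N" | (eq) "k = N" | (greater) "k > N" by linarith
    then show ?thesis
    proof cases
      case less then show ?thesis using A(3) by simp
    next
      case eq
      then show ?thesis using B(1) B(3)[of 0] A(2) k by simp
    next
      case greater
      then show ?thesis using B(3)[of "k - N"] k by (simp add: Suc_diff_le)
    qed
  qed
  have s2: "?\<sigma> 0 = a" "?\<sigma> (N + N') = c" using A B by auto
  show ?case
    by (rule exI[of _ "N + N'"], rule exI[of _ ?\<sigma>]) (use s1 s2 in blast)
qed

lemma curve_length_pc:
  assumes "cmetric g" "pc g \<gamma> 0 1 L"
  shows "piecewise_C1_curve \<gamma>" "curve_length g \<gamma> = L"
  using pc_imp_pieces[OF assms(2)] integral_unique[OF pc_has_integral[OF assms]]
  unfolding piecewise_C1_curve_def curve_length_def by auto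

lemma riemannian_dist_pc:
  assumes "cmetric g"
  shows "riemannian_dist g p q = Inf {L. \<exists>\<gamma>. pc g \<gamma> 0 1 L \<and> \<gamma> 0 = p \<and> \<gamma> 1 = q}"
proof -
  have "{curve_length g \<gamma> |\<gamma>. piecewise_C1_curve \<gamma> \<and> \<gamma> 0 = p \<and> \<gamma> 1 = q} = {L. \<exists>\<gamma>. pc g \<gamma> 0 1 L \<and> \<gamma> 0 = p \<and> \<gamma> 1 = q}"
  proof (intro set_eqI iffI)
    fix L assume "L \<in> {curve_length g \<gamma> |\<gamma>. piecewise_C1_curve \<gamma> \<and> \<gamma> 0 = p \<and> \<gamma> 1 = q}"
    then obtain \<gamma> where \<gamma>: "L = curve_length g \<gamma>" "piecewise_C1_curve \<gamma>" "\<gamma> 0 = p" "\<gamma> 1 = q" by blast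
    obtain L' where "pc g \<gamma> 0 1 L'" using piecewise_imp_pc[OF \<gamma>(2)] by blast
    then show "L \<in> {L. \<exists>\<gamma>. pc g \<gamma> 0 1 L \<and> \<gamma> 0 = p \<and> \<gamma> 1 = q}" using curve_length_pc[OF assms] \<gamma> by auto
  next
    fix L assume "L \<in> {L. \<exists>\<gamma>. pc g \<gamma> 0 1 L \<and> \<gamma> 0 = p \<and> \<gamma> 1 = q}"
    then obtain \<gamma> where \<gamma>: "pc g \<gamma> 0 1 L" "\<gamma> 0 = p" "\<gamma> 1 = q" by blast
    then show "L \<in> {curve_length g \<gamma> |\<gamma>. piecewise_C1_curve \<gamma> \<and> \<gamma> 0 = p \<and> \<gamma> 1 = q}"
      using curve_length_pc[OF assms \<gamma>(1)] by (intro CollectI exI[of _ \<gamma>]) simp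
  qed
  then show ?thesis by (simp add: riemannian_dist_def)
qed

section \<open>Straight segments, reparametrisation and the triangle inequality\<close>

definition seg :: "'n::finite tensor2 \<Rightarrow> real ^ 'n \<Rightarrow> real ^ 'n \<Rightarrow> real" where
  "seg g x y = integral {0..1} (\<lambda>t. nrm g (proj_torus (x + t *\<^sub>R (y - x))) (y - x))"

lemma pc_seg: "pc g (\<lambda>t. proj_torus (x + t *\<^sub>R (y - x))) 0 1 (seg g x y)"
  unfolding seg_def
proof (rule pc.base[where V = "\<lambda>t. y - x"])
  show "C1_data (\<lambda>t. proj_torus (x + t *\<^sub>R (y - x))) (\<lambda>t. y - x) 0 1"
    unfolding C1_data_def has_velocity_def
  proof (intro conjI ballI exI)
    fix t :: real
    show "((\<lambda>t. x + t *\<^sub>R (y - x)) has_vector_derivative y - x) (at t within {0..1})"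
      by (auto intro!: derivative_eq_intros)
  qed auto
qed

lemma torus_cases: obtains x where "p = proj_torus x"
  using proj_rep_torus by metis

context
  fixes g :: "'n::finite tensor2"
  assumes g: "cmetric g"
begin

lemma dist_set_nonempty: "\<exists>L \<gamma>. pc g \<gamma> 0 1 L \<and> \<gamma> 0 = p \<and> \<gamma> 1 = q"
proof -
  obtain x where "p = proj_torus x" by (rule torus_cases)
  moreover obtain y where "q = proj_torus y" by (rule torus_cases)
  ultimately show ?thesis using pc_seg[of g x y] by (intro exI[of _ "seg g x y"] exI[of _ "\<lambda>t. proj_torus (x + t *\<^sub>R (y - x))"]) simp
qed

lemma dist_set_nonempty_Collect: "{L. \<exists>\<gamma>. pc g \<gamma> 0 1 L \<and> \<gamma> 0 = p \<and> \<gamma> 1 = q} \<noteq> {}"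
  using dist_set_nonempty[of p q] by blast

lemma dist_le: "pc g \<gamma> 0 1 L \<Longrightarrow> riemannian_dist g (\<gamma> 0) (\<gamma> 1) \<le> L"
  unfolding riemannian_dist_pc[OF g] using pc_nonneg[OF g]
  by (intro cInf_lower bdd_belowI[of _ 0]) auto

lemma dist_ge:
  assumes "\<And>\<gamma> L. pc g \<gamma> 0 1 L \<Longrightarrow> \<gamma> 0 = p \<Longrightarrow> \<gamma> 1 = q \<Longrightarrow> B \<le> L"
  shows "B \<le> riemannian_dist g p q"
  unfolding riemannian_dist_pc[OF g] by (rule cInf_greatest[OF dist_set_nonempty_Collect]) (use assms in blast)

lemma dist_nonneg: "riemannian_dist g p q \<ge> 0"
  by (rule dist_ge) (rule pc_nonneg[OF g])

lemma dist_witness: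
  assumes "e > 0"
  obtains \<gamma> L where "pc g \<gamma> 0 1 L" "\<gamma> 0 = p" "\<gamma> 1 = q" "L < riemannian_dist g p q + e"
proof -
  have "Inf {L. \<exists>\<gamma>. pc g \<gamma> 0 1 L \<and> \<gamma> 0 = p \<and> \<gamma> 1 = q} < riemannian_dist g p q + e"
    using assms by (simp add: riemannian_dist_pc[OF g])
  then have "\<exists>L\<in>{L. \<exists>\<gamma>. pc g \<gamma> 0 1 L \<and> \<gamma> 0 = p \<and> \<gamma> 1 = q}. L < riemannian_dist g p q + e"
    using dist_set_nonempty_Collect pc_nonneg[OF g] by (subst (asm) cInf_less_iff) (blast, auto intro!: bdd_belowI[of _ 0])
  then show ?thesis using that by blast
qed

lemma dist_le_seg: "riemannian_dist g (proj_torus x) (proj_torus y) \<le> seg g x y"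
  using dist_le[OF pc_seg[of g x y]] by simp

end

lemma nrm_line_integrable:
  assumes "cmetric g"
  shows "(\<lambda>t. nrm g (proj_torus (x + t *\<^sub>R (y - x))) (y - x)) integrable_on {0..1}"
proof -
  have "continuous_on {0..1} (\<lambda>t. (x + t *\<^sub>R (y - x), y - x))" by (intro continuous_intros)
  from continuous_on_compose2[OF continuous_nrm[OF assms, of UNIV] this]
  have "continuous_on {0..1} (\<lambda>t. nrm g (proj_torus (x + t *\<^sub>R (y - x))) (y - x))" by simp
  then show ?thesis by (rule integrable_continuous_real)
qed

lemma seg_le:
  assumes g: "cmetric g" and "\<And>p v. nrm g p v \<le> C * norm v"
  shows "seg g x y \<le> C * norm (y - x)"
proof -
  have "seg g x y \<le> integral {0..1} (\<lambda>t::real. C * norm (y - x))"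
    unfolding seg_def by (intro integral_le nrm_line_integrable[OF g] assms(2)) auto
  then show ?thesis by simp
qed

lemma C1_data_affine:
  assumes V: "C1_data \<gamma> V a b" and m: "m > 0"
  shows "C1_data (\<lambda>t. \<gamma> (m * t + e)) (\<lambda>t. m *\<^sub>R V (m * t + e)) ((a - e) / m) ((b - e) / m)"
  unfolding C1_data_def
proof (intro conjI ballI)
  let ?a = "(a - e) / m" and ?b = "(b - e) / m"
  let ?f = "\<lambda>t. m * t + e"
  have ab: "a < b" using V by (simp add: C1_data_def)
  then show "?a < ?b" using m by (simp add: divide_strict_right_mono)
  have f: "?f t \<in> {a..b}" if "t \<in> {?a..?b}" for t
    using that m by (simp add: pos_divide_le_eq pos_le_divide_eq) (simp add: algebra_simps)
  have im: "?f ` {?a..?b} \<subseteq> {a..b}" using f by blast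
  have "continuous_on {a..b} V" using V by (simp add: C1_data_def)
  from continuous_on_compose2[OF this _ im]
  have "continuous_on {?a..?b} (\<lambda>t. V (?f t))" by (simp add: continuous_on_add continuous_on_mult)
  then show "continuous_on {?a..?b} (\<lambda>t. m *\<^sub>R V (?f t))"
    by (intro continuous_on_scaleR continuous_on_const)
  fix t assume t: "t \<in> {?a..?b}"
  have "\<forall>t\<in>{a..b}. has_velocity \<gamma> (V t) t {a..b}" using V by (simp add: C1_data_def)
  from bspec[OF this f[OF t]]
  obtain c where c: "proj_torus (c (?f t)) = \<gamma> (?f t)" "\<forall>\<^sub>F s in at (?f t) within {a..b}. proj_torus (c s) = \<gamma> s"
    "(c has_vector_derivative V (?f t)) (at (?f t) within {a..b})"
    unfolding has_velocity_def by blast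
  show "has_velocity (\<lambda>t. \<gamma> (?f t)) (m *\<^sub>R V (?f t)) t {?a..?b}"
    unfolding has_velocity_def
  proof (intro exI[of _ "\<lambda>s. c (?f s)"] conjI)
    show "proj_torus (c (?f t)) = \<gamma> (?f t)" by (rule c(1))
    have "filterlim ?f (at (?f t) within {a..b}) (at t within {?a..?b})"
      unfolding filterlim_at
    proof
      show "\<forall>\<^sub>F s in at t within {?a..?b}. ?f s \<in> {a..b} \<and> ?f s \<noteq> ?f t"
        unfolding eventually_at_filter using f m by (intro always_eventually) auto
      show "(?f \<longlongrightarrow> ?f t) (at t within {?a..?b})" by (intro tendsto_intros)
    qed
    then show "\<forall>\<^sub>F s in at t within {?a..?b}. proj_torus (c (?f s)) = \<gamma> (?f s)"
      using c(2) by (rule eventually_compose_filterlim[rotated])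
    have "(?f has_vector_derivative m) (at t within {?a..?b})"
      unfolding has_real_derivative_iff_has_vector_derivative[symmetric]
      by (auto intro!: derivative_eq_intros)
    from vector_diff_chain_within[OF this has_vector_derivative_within_subset[OF c(3) im]]
    show "((\<lambda>s. c (?f s)) has_vector_derivative m *\<^sub>R V (?f t)) (at t within {?a..?b})" by (simp add: o_def)
  qed
qed

text \<open>Used to run two curves at double speed when they are concatenated on the unit
  interval.\<close>

lemma pc_affine:
  assumes g: "cmetric g" and m: "m > 0"
  shows "pc g \<gamma> a b L \<Longrightarrow> pc g (\<lambda>t. \<gamma> (m * t + e)) ((a - e) / m) ((b - e) / m) L"
proof (induction rule: pc.induct)
  case (base V a b)
  have ab: "a < b" using base by (simp add: C1_data_def)
  let ?n = "\<lambda>t. nrm g (\<gamma> t) (V t)"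
  have "(?n has_integral integral {a..b} ?n) (cbox a b)"
    using integrable_integral[OF integrable_continuous_real[OF continuous_on_speed[OF g base]]] by simp
  from has_integral_affinity[OF this, of m e]
  have "((\<lambda>t. ?n (m * t + e)) has_integral (1 / m) * integral {a..b} ?n) {(a - e) / m..(b - e) / m}"
    using m ab by (simp add: image_affinity_atLeastAtMost_div_diff diff_divide_distrib)
  from has_integral_mult_right[OF this, of m]
  have "((\<lambda>t. nrm g (\<gamma> (m * t + e)) (m *\<^sub>R V (m * t + e))) has_integral integral {a..b} ?n) {(a - e) / m..(b - e) / m}"
    using m by (simp add: nrm_scale[OF g])
  from pc.base[OF C1_data_affine[OF base m], of g e] integral_unique[OF this] show ?case by simp
next
  case (join a b L c L')
  show ?case by (rule pc.join[OF join.IH])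
qed

lemma pc_cong: "pc g \<gamma> a b L \<Longrightarrow> (\<And>t. t \<in> {a..b} \<Longrightarrow> \<gamma> t = \<gamma>' t) \<Longrightarrow> pc g \<gamma>' a b L"
proof (induction rule: pc.induct)
  case (base V a b)
  have "has_velocity \<gamma>' v t {a..b}" if hv: "has_velocity \<gamma> v t {a..b}" "t \<in> {a..b}" for v t
  proof -
    obtain c where c: "proj_torus (c t) = \<gamma> t" "\<forall>\<^sub>F s in at t within {a..b}. proj_torus (c s) = \<gamma> s"
      "(c has_vector_derivative v) (at t within {a..b})"
      using hv(1) unfolding has_velocity_def by blast
    have "\<forall>\<^sub>F s in at t within {a..b}. proj_torus (c s) = \<gamma>' s"
      using c(2) unfolding eventually_at_filter by eventually_elim (use base(2) in auto)
    then show ?thesis unfolding has_velocity_def using c base(2)[OF hv(2)] by auto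
  qed
  then have "C1_data \<gamma>' V a b" using base(1) by (simp add: C1_data_def)
  moreover have "integral {a..b} (\<lambda>t. nrm g (\<gamma> t) (V t)) = integral {a..b} (\<lambda>t. nrm g (\<gamma>' t) (V t))"
    by (rule integral_cong) (use base(2) in simp)
  ultimately show ?case using pc.base[of \<gamma>' V a b g] by simp
next
  case (join a b L c L')
  have "a < b" "b < c" using pc_less[OF join.hyps(1)] pc_less[OF join.hyps(2)] by simp_all
  then show ?case by (intro pc.join[OF join.IH] join.prems) auto
qed

lemma riemannian_dist_triangle:
  assumes g: "cmetric g"
  shows "riemannian_dist g p r \<le> riemannian_dist g p q + riemannian_dist g q r"
proof (rule field_le_epsilon)
  fix e :: real assume "e > 0"
  then have e: "e / 2 > 0" by simp
  obtain \<gamma>1 L1 where 1: "pc g \<gamma>1 0 1 L1" "\<gamma>1 0 = p" "\<gamma>1 1 = q" "L1 < riemannian_dist g p q + e / 2"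
    using dist_witness[OF g e] by blast
  obtain \<gamma>2 L2 where 2: "pc g \<gamma>2 0 1 L2" "\<gamma>2 0 = q" "\<gamma>2 1 = r" "L2 < riemannian_dist g q r + e / 2"
    using dist_witness[OF g e] by blast
  define \<gamma> where "\<gamma> t = (if t \<le> 1 / 2 then \<gamma>1 (2 * t) else \<gamma>2 (2 * t - 1))" for t :: real
  have a: "pc g (\<lambda>t. \<gamma>1 (2 * t + 0)) 0 (1 / 2) L1" using pc_affine[OF g _ 1(1), of 2 0] by simp
  have b: "pc g (\<lambda>t. \<gamma>2 (2 * t + - 1)) (1 / 2) 1 L2" using pc_affine[OF g _ 2(1), of 2 "-1"] by simp
  have "pc g \<gamma> 0 (1 / 2) L1" by (rule pc_cong[OF a]) (simp add: \<gamma>_def)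
  moreover have "pc g \<gamma> (1 / 2) 1 L2"
  proof (rule pc_cong[OF b])
    fix t :: real assume "t \<in> {1 / 2..1}"
    then show "\<gamma>2 (2 * t + - 1) = \<gamma> t"
    proof (cases "t = 1 / 2")
      case True
      show ?thesis unfolding True \<gamma>_def using 1(3) 2(2) by simp
    qed (simp add: \<gamma>_def)
  qed
  ultimately have "pc g \<gamma> 0 1 (L1 + L2)" by (rule pc.join)
  from dist_le[OF g this] show "riemannian_dist g p r \<le> riemannian_dist g p q + riemannian_dist g q r + e"
    using 1 2 by (simp add: \<gamma>_def)
qed

lemma dist_mono:
  assumes g: "cmetric g" and g': "cmetric g'" and le: "\<And>p v. c * nrm g p v \<le> nrm g' p v" and c: "c \<ge> 0"
  shows "c * riemannian_dist g p q \<le> riemannian_dist g' p q"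
proof (rule dist_ge[OF g'])
  fix \<gamma> L assume L: "pc g' \<gamma> 0 1 L" "\<gamma> 0 = p" "\<gamma> 1 = q"
  obtain L' where L': "pc g \<gamma> 0 1 L'"
    using piecewise_imp_pc[OF curve_length_pc(1)[OF g' L(1)], of g] by blast
  have "c * L' \<le> L"
    by (rule has_integral_le[OF has_integral_mult_right[OF pc_has_integral[OF g L']] pc_has_integral[OF g' L(1)]])
       (use le in \<open>simp add: nrm_def\<close>)
  moreover have "c * riemannian_dist g p q \<le> c * L'" using dist_le[OF g L'] L(2,3) c by (intro mult_left_mono) auto
  ultimately show "c * riemannian_dist g p q \<le> L" by linarith
qed

section \<open>Polygonal approximation of curves\<close>

text \<open>Only the projections of consecutive end points have to agree, so every segment may use
  its own lift.\<close>

fun path_ok :: "'n::finite torus \<Rightarrow> ((real ^ 'n) \<times> (real ^ 'n)) list \<Rightarrow> 'n torus \<Rightarrow> bool" where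
  "path_ok p [] q \<longleftrightarrow> p = q"
| "path_ok p (z # zs) q \<longleftrightarrow> proj_torus (fst z) = p \<and> path_ok (proj_torus (snd z)) zs q"

definition total :: "'n::finite tensor2 \<Rightarrow> ((real ^ 'n) \<times> (real ^ 'n)) list \<Rightarrow> real" where
  "total g zs = (\<Sum>z\<leftarrow>zs. seg g (fst z) (snd z))"

lemma path_ok_append: "path_ok p zs q \<Longrightarrow> path_ok q zs' r \<Longrightarrow> path_ok p (zs @ zs') r"
  by (induction zs arbitrary: p) auto

lemma total_append: "total g (zs @ zs') = total g zs + total g zs'"
  by (simp add: total_def)

lemma seg_local_le:
  assumes g: "cmetric g" and B: "\<And>y v. norm (y - x0) < \<rho> \<Longrightarrow> norm (v - v0) < \<rho> \<Longrightarrow> nrm g (proj_torus y) v \<le> B"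
    and y: "norm (y1 - x0) < \<rho>" "norm (y2 - x0) < \<rho>" and v: "y2 - y1 = r *\<^sub>R v" "norm (v - v0) < \<rho>"
  shows "seg g y1 y2 \<le> \<bar>r\<bar> * B"
proof -
  have "seg g y1 y2 \<le> integral {0..1} (\<lambda>t::real. \<bar>r\<bar> * B)"
    unfolding seg_def
  proof (rule integral_le[OF nrm_line_integrable[OF g]])
    fix t :: real assume t: "t \<in> {0..1}"
    have "y1 + t *\<^sub>R (y2 - y1) = (1 - t) *\<^sub>R y1 + t *\<^sub>R y2" by (simp add: algebra_simps)
    also have "\<dots> \<in> ball x0 \<rho>"
      by (rule convexD[OF convex_ball]) (use y t in \<open>auto simp: dist_norm norm_minus_commute\<close>)
    finally have "norm (y1 + t *\<^sub>R (y2 - y1) - x0) < \<rho>" by (simp add: dist_norm norm_minus_commute)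
    from B[OF this v(2)]
    show "nrm g (proj_torus (y1 + t *\<^sub>R (y2 - y1))) (y2 - y1) \<le> \<bar>r\<bar> * B"
      unfolding v(1) nrm_scale[OF g] by (intro mult_left_mono) auto
  qed (simp add: integrable_on_const)
  then show ?thesis by simp
qed

text \<open>Bisection in place of a uniform partition: the claim is additive over adjacent intervals
  and holds for all short intervals around a point \<open>x\<close>. There the segments from
  \<open>c s\<close> to \<open>c x\<close> and from \<open>c x\<close> to \<open>c t\<close> have
  directions near \<open>V x\<close>, so their total length exceeds \<open>(t - s) * n x\<close> by
  at most \<open>(t - s) * e / 2\<close>, and the integral falls short of it by no more.\<close>

lemma pc_base_chain:
  assumes g: "cmetric g" and V: "C1_data \<gamma> V a b" and e: "e > 0"
  shows "\<exists>zs. path_ok (\<gamma> a) zs (\<gamma> b) \<and> total g zs \<le> integral {a..b} (\<lambda>t. nrm g (\<gamma> t) (V t)) + e * (b - a)"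
proof -
  define n where "n t = nrm g (\<gamma> t) (V t)" for t
  have ab: "a \<le> b" using V by (simp add: C1_data_def)
  have cn: "continuous_on {a..b} n" unfolding n_def by (rule continuous_on_speed[OF g V])
  have int: "n integrable_on {s..t}" if "a \<le> s" "t \<le> b" for s t
    by (rule integrable_continuous_real, rule continuous_on_subset[OF cn]) (use that in auto)
  \<comment> \<open>The bisection rule also asks about intervals around \<open>x\<close> that stick
    out of \<open>{a..b}\<close>; for these the guard makes the claim vacuous.\<close>
  define P where "P s t \<longleftrightarrow> (a \<le> s \<and> t \<le> b \<longrightarrow>
     (\<exists>zs. path_ok (\<gamma> s) zs (\<gamma> t) \<and> total g zs \<le> integral {s..t} n + e * (t - s)))" for s t
  have "P a b"
    using ab
  proof (induction rule: Bolzano)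
    case (trans s r t)
    show ?case unfolding P_def
    proof (intro impI)
      assume st: "a \<le> s \<and> t \<le> b"
      then obtain zs where zs: "path_ok (\<gamma> s) zs (\<gamma> r)" "total g zs \<le> integral {s..r} n + e * (r - s)"
        using trans unfolding P_def by (meson order_trans)
      obtain zs' where zs': "path_ok (\<gamma> r) zs' (\<gamma> t)" "total g zs' \<le> integral {r..t} n + e * (t - r)"
        using trans st unfolding P_def by (meson order_trans)
      have "integral {s..r} n + integral {r..t} n = integral {s..t} n"
        by (rule Henstock_Kurzweil_Integration.integral_combine) (use trans st int in auto)
      then show "\<exists>zs. path_ok (\<gamma> s) zs (\<gamma> t) \<and> total g zs \<le> integral {s..t} n + e * (t - s)"
        using zs zs' by (intro exI[of _ "zs @ zs'"]) (simp add: total_append path_ok_append[OF zs(1) zs'(1)] algebra_simps)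
    qed
  next
    case (local x)
    then have x: "x \<in> {a..b}" by simp
    have "\<forall>t\<in>{a..b}. has_velocity \<gamma> (V t) t {a..b}" using V by (simp add: C1_data_def)
    from bspec[OF this x] obtain c where c: "proj_torus (c x) = \<gamma> x"
      "\<forall>\<^sub>F s in at x within {a..b}. proj_torus (c s) = \<gamma> s" "(c has_vector_derivative V x) (at x within {a..b})"
      unfolding has_velocity_def by blast
    let ?N = "\<lambda>z. nrm g (proj_torus (fst z)) (snd z)"
    have "e / 2 > 0" using e by simp
    then obtain \<rho>' where \<rho>': "\<rho>' > 0" "\<And>z. dist z (c x, V x) < \<rho>' \<Longrightarrow> dist (?N z) (?N (c x, V x)) < e / 2"
      using isCont_nrm[OF g, of "(c x, V x)"] unfolding continuous_at_eps_delta by (metis dist_commute)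
    define \<rho> where "\<rho> = \<rho>' / 2"
    have \<rho>: "\<rho> > 0" using \<rho>' by (simp add: \<rho>_def)
    have n: "n x = ?N (c x, V x)" by (simp add: n_def c(1))
    have B: "nrm g (proj_torus y) v \<le> n x + e / 2" if "norm (y - c x) < \<rho>" "norm (v - V x) < \<rho>" for y v
    proof -
      have "dist (y, v) (c x, V x) \<le> dist y (c x) + dist v (V x)"
        unfolding dist_Pair_Pair by (rule sqrt_sum_squares_le_sum) auto
      also have "\<dots> < \<rho>'" using that by (simp add: \<rho>_def dist_norm)
      finally have "dist (y, v) (c x, V x) < \<rho>'" .
      from \<rho>'(2)[OF this] have "\<bar>nrm g (proj_torus y) v - n x\<bar> < e / 2"
        unfolding n dist_real_def fst_conv snd_conv .
      then show ?thesis unfolding abs_less_iff by linarith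
    qed
    have "\<forall>\<^sub>F s in at x within {a..b}. norm (c s - c x - (s - x) *\<^sub>R V x) \<le> (\<rho> / 2) * norm (s - x)"
    proof -
      have "(c has_derivative (\<lambda>t. t *\<^sub>R V x)) (at x within {a..b})" using c(3) by (simp add: has_vector_derivative_def)
      then obtain d where "d > 0" "\<forall>s\<in>{a..b}. norm (s - x) < d \<longrightarrow> norm (c s - c x - (s - x) *\<^sub>R V x) \<le> (\<rho> / 2) * norm (s - x)"
        unfolding has_derivative_within_alt using \<rho> by (meson half_gt_zero)
      then show ?thesis unfolding eventually_at by (intro exI[of _ d]) (auto simp: dist_norm)
    qed
    moreover have "\<forall>\<^sub>F s in at x within {a..b}. norm (c s - c x) < \<rho>"
    proof -
      have "(c \<longlongrightarrow> c x) (at x within {a..b})"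
        using has_vector_derivative_continuous[OF c(3)] by (simp add: continuous_within)
      from tendstoD[OF this \<rho>] show ?thesis by (simp add: dist_norm)
    qed
    moreover have "\<forall>\<^sub>F s in at x within {a..b}. \<bar>n s - n x\<bar> < e / 2"
    proof -
      have "(n \<longlongrightarrow> n x) (at x within {a..b})" using cn x by (auto simp: continuous_on_def)
      from tendstoD[OF this \<open>e / 2 > 0\<close>] show ?thesis by (simp add: dist_real_def)
    qed
    ultimately have "\<forall>\<^sub>F s in at x within {a..b}. norm (c s - c x - (s - x) *\<^sub>R V x) \<le> (\<rho> / 2) * norm (s - x)
       \<and> norm (c s - c x) < \<rho> \<and> \<bar>n s - n x\<bar> < e / 2 \<and> proj_torus (c s) = \<gamma> s"
      using c(2) by eventually_elim simp
    then obtain d where d: "d > 0" "\<And>s. s \<in> {a..b} \<Longrightarrow> s \<noteq> x \<Longrightarrow> dist s x < d \<Longrightarrow>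
       norm (c s - c x - (s - x) *\<^sub>R V x) \<le> (\<rho> / 2) * norm (s - x)
       \<and> norm (c s - c x) < \<rho> \<and> \<bar>n s - n x\<bar> < e / 2 \<and> proj_torus (c s) = \<gamma> s"
      unfolding eventually_at by blast
    have near: "norm (c s - c x - (s - x) *\<^sub>R V x) \<le> (\<rho> / 2) * norm (s - x)"
       "norm (c s - c x) < \<rho>" "\<bar>n s - n x\<bar> < e / 2" "proj_torus (c s) = \<gamma> s"
      if "s \<in> {a..b}" "dist s x < d" for s
      using d(2)[of s] that c(1) \<rho> e by (cases "s = x"; simp)+
    \<comment> \<open>The secant at \<open>x\<close> is a multiple of a vector near
      \<open>V x\<close>, which puts it in the range of the bound \<open>B\<close>.\<close>
    have quot: "\<exists>v. c s - c x = (s - x) *\<^sub>R v \<and> norm (v - V x) < \<rho>" if "s \<in> {a..b}" "dist s x < d" for s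
    proof (cases "s = x")
      case True
      then show ?thesis using \<rho> by (intro exI[of _ "V x"]) simp
    next
      case False
      define v where "v = (1 / (s - x)) *\<^sub>R (c s - c x)"
      have v: "c s - c x = (s - x) *\<^sub>R v" using False by (simp add: v_def)
      have "\<bar>s - x\<bar> * norm (v - V x) = norm ((s - x) *\<^sub>R (v - V x))" by simp
      also have "\<dots> = norm (c s - c x - (s - x) *\<^sub>R V x)" unfolding v by (simp add: algebra_simps)
      also have "\<dots> \<le> \<bar>s - x\<bar> * (\<rho> / 2)" using near(1)[OF that] by (simp add: mult.commute)
      finally have "norm (v - V x) \<le> \<rho> / 2" using False by simp
      then show ?thesis using v \<rho> by (intro exI[of _ v]) auto
    qed
    have c0: "norm (c x - c x) < \<rho>" using \<rho> by simp
    have low: "(t - s) * (n x - e / 2) \<le> integral {s..t} n" if "a \<le> s" "s \<le> t" "t \<le> b" "\<And>r. s \<le> r \<Longrightarrow> r \<le> t \<Longrightarrow> dist r x < d" for s t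
    proof -
      have "integral {s..t} (\<lambda>r. n x - e / 2) \<le> integral {s..t} n"
      proof (rule integral_le)
        fix r assume "r \<in> {s..t}"
        then have "\<bar>n r - n x\<bar> < e / 2" using near(3)[of r] that by auto
        then show "n x - e / 2 \<le> n r" by linarith
      qed (use int that in auto)
      then show ?thesis using that by simp
    qed
    show ?case
    proof (intro exI[of _ d] conjI allI impI)
      show "d > 0" by fact
      fix s t assume st: "s \<le> x \<and> x \<le> t \<and> t - s < d"
      show "P s t"
        unfolding P_def
      proof (intro impI)
        assume ab: "a \<le> s \<and> t \<le> b"
        have s: "s \<in> {a..b}" "dist s x < d" and t: "t \<in> {a..b}" "dist t x < d"
          using st ab by (auto simp: dist_real_def)
        obtain v where v: "c s - c x = (s - x) *\<^sub>R v" "norm (v - V x) < \<rho>" using quot[OF s] by blast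
        obtain v' where v': "c t - c x = (t - x) *\<^sub>R v'" "norm (v' - V x) < \<rho>" using quot[OF t] by blast
        have "c x - c s = (x - s) *\<^sub>R v" using v(1) by (metis minus_diff_eq scaleR_minus_left)
        from seg_local_le[OF g B near(2)[OF s] c0 this v(2)]
        have 1: "seg g (c s) (c x) \<le> (x - s) * (n x + e / 2)" using st by simp
        from seg_local_le[OF g B c0 near(2)[OF t] v']
        have 2: "seg g (c x) (c t) \<le> (t - x) * (n x + e / 2)" using st by simp
        have "(t - s) * (n x - e / 2) \<le> integral {s..t} n"
          by (rule low) (use st ab in \<open>auto simp: dist_real_def\<close>)
        then have "seg g (c s) (c x) + seg g (c x) (c t) \<le> integral {s..t} n + e * (t - s)"
          using 1 2 by (simp add: algebra_simps diff_divide_distrib)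
        then show "\<exists>zs. path_ok (\<gamma> s) zs (\<gamma> t) \<and> total g zs \<le> integral {s..t} n + e * (t - s)"
          using near(4)[OF s] near(4)[OF t] c(1)
          by (intro exI[of _ "[(c s, c x), (c x, c t)]"]) (simp add: total_def)
      qed
    qed
  qed
  then show ?thesis unfolding P_def n_def by simp
qed

lemma pc_chain:
  assumes g: "cmetric g" and e: "e > 0"
  shows "pc g \<gamma> a b L \<Longrightarrow> \<exists>zs. path_ok (\<gamma> a) zs (\<gamma> b) \<and> total g zs \<le> L + e * (b - a)"
proof (induction rule: pc.induct)
  case (base V a b)
  show ?case by (rule pc_base_chain[OF g base e])
next
  case (join a b L c L')
  then obtain zs zs' where zs: "path_ok (\<gamma> a) zs (\<gamma> b)" "total g zs \<le> L + e * (b - a)"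
    "path_ok (\<gamma> b) zs' (\<gamma> c)" "total g zs' \<le> L' + e * (c - b)" by blast
  then show ?case
    by (intro exI[of _ "zs @ zs'"]) (simp add: total_append path_ok_append[OF zs(1,3)] algebra_simps)
qed

lemma dist_chain:
  assumes "cmetric g" "e > 0"
  obtains zs where "path_ok p zs q" "total g zs \<le> riemannian_dist g p q + e"
proof -
  have e: "e / 2 > 0" using assms by simp
  obtain \<gamma> L where \<gamma>: "pc g \<gamma> 0 1 L" "\<gamma> 0 = p" "\<gamma> 1 = q" "L < riemannian_dist g p q + e / 2"
    using dist_witness[OF assms(1) e] by blast
  obtain zs where "path_ok (\<gamma> 0) zs (\<gamma> 1)" "total g zs \<le> L + e / 2 * (1 - 0)"
    using pc_chain[OF assms(1) e \<gamma>(1)] by blast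
  then show ?thesis using that[of zs] \<gamma> by simp
qed

lemma dist_self: "cmetric g \<Longrightarrow> riemannian_dist g p p = 0"
proof -
  assume g: "cmetric g"
  obtain x where x: "p = proj_torus x" by (rule torus_cases)
  have "nrm g q 0 = 0" for q using nrm_scale[OF g, of q 0 0] by simp
  then have "seg g x x = 0" by (simp add: seg_def)
  then show ?thesis using dist_le_seg[OF g, of x x] dist_nonneg[OF g, of p p] x by simp
qed

lemma dist_path_le:
  assumes g: "cmetric g"
  shows "path_ok p zs q \<Longrightarrow> riemannian_dist g p q \<le> (\<Sum>z\<leftarrow>zs. riemannian_dist g (proj_torus (fst z)) (proj_torus (snd z)))"
proof (induction zs arbitrary: p)
  case Nil
  then show ?case using dist_self[OF g] by simp
next
  case (Cons z zs)
  then show ?case using riemannian_dist_triangle[OF g, of p q "proj_torus (snd z)"] by fastforce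
qed

section \<open>The unit cube as a compact set of representatives\<close>

lemma lattice_cube:
  fixes y :: "real ^ 'n::finite"
  obtains x where "x \<in> cbox 0 1" "lattice_rel y x"
proof
  let ?x = "\<chi> i. frac (y $ i)"
  show "?x \<in> cbox 0 1" by (auto simp: mem_box_cart frac_lt_1 less_imp_le)
  show "lattice_rel y ?x" by (simp add: lattice_rel_def frac_def)
qed

lemma torus_cube:
  obtains x :: "real ^ 'n::finite" where "x \<in> cbox 0 1" "p = proj_torus x"
proof -
  obtain y where y: "p = proj_torus y" by (rule torus_cases)
  obtain x where "x \<in> cbox 0 1" "lattice_rel y x" by (rule lattice_cube)
  then show ?thesis using that[of x] y by (simp add: proj_torus_eq_iff)
qed

lemma nrm_bound:
  fixes g :: "'n::finite tensor2"
  assumes g: "cmetric g"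
  obtains K where "K \<ge> 0" "\<And>p v. nrm g p v \<le> K * norm v"
proof -
  let ?A = "cbox (0::real ^ 'n) 1 \<times> sphere (0::real ^ 'n) 1"
  obtain K where K: "K \<ge> 0" "\<And>z. z \<in> ?A \<Longrightarrow> \<bar>nrm g (proj_torus (fst z)) (snd z)\<bar> \<le> K"
    using compact_abs_bound[OF compact_Times[OF compact_cbox compact_sphere] continuous_nrm[OF g]] by blast
  have "nrm g p v \<le> K * norm v" for p v
  proof (cases "v = 0")
    case True
    then show ?thesis using nrm_scale[OF g, of p 0 0] by simp
  next
    case False
    obtain x where x: "x \<in> cbox 0 1" "p = proj_torus x" by (rule torus_cube)
    have "nrm g p v = nrm g p (norm v *\<^sub>R (v /\<^sub>R norm v))" using False by simp
    also have "\<dots> = norm v * nrm g p (v /\<^sub>R norm v)" unfolding nrm_scale[OF g] by simp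
    also have "\<dots> \<le> norm v * K"
      using K(2)[of "(x, v /\<^sub>R norm v)"] x False by (intro mult_left_mono) auto
    finally show ?thesis by (simp add: mult.commute)
  qed
  then show ?thesis using that K(1) by blast
qed

lemma dist_proj_le:
  assumes g: "cmetric g" and K: "\<And>p v. nrm g p v \<le> K * norm v"
  shows "riemannian_dist g (proj_torus x) (proj_torus y) \<le> K * norm (y - x)"
  using dist_le_seg[OF g, of x y] seg_le[OF g K, of x y] by linarith

text \<open>Distances of metrics bounded by \<open>K\<close> are controlled by those between the
  points of a finite net. For every pair of net points a nearly shortest polygon of \<open>f\<close>
  is fixed; once \<open>g\<close> makes the end points of all these finitely many segments nearly as
  close, the triangle inequality extends the bound to all \<open>p\<close> and
  \<open>q\<close>.\<close>

lemma finite_network: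
  fixes f :: "'n::finite tensor2"
  assumes f: "cmetric f" and K: "\<And>p v. nrm f p v \<le> K * norm v" "K \<ge> 0" and e: "e > 0"
  obtains zs \<eta> where "\<eta> > 0"
    "\<And>g p q. cmetric g \<Longrightarrow> (\<And>p v. nrm g p v \<le> K * norm v) \<Longrightarrow>
      (\<And>z. z \<in> set zs \<Longrightarrow> riemannian_dist g (proj_torus (fst z)) (proj_torus (snd z)) \<le> seg f (fst z) (snd z) + \<eta>) \<Longrightarrow>
      riemannian_dist g p q \<le> riemannian_dist f p q + e"
proof -
  \<comment> \<open>Passing between a point and a net point happens four times, twice in each
    metric, at a cost of \<open>K * r\<close> each and at most \<open>e / 2\<close> in
    total.\<close>
  define r where "r = e / (8 * (K + 1))"
  have r: "r > 0" "4 * (K * r) \<le> e / 2" using e K by (auto simp: r_def field_simps)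
  obtain A where A: "finite A" "cbox (0::real ^ 'n) 1 \<subseteq> (\<Union>x\<in>A. ball x r)"
    using compact_cbox[of "0::real ^ 'n" 1] r(1) unfolding compact_eq_totally_bounded by blast
  have e4: "e / 4 > 0" using e by simp
  have "\<forall>w. \<exists>zs. path_ok (proj_torus (fst w)) zs (proj_torus (snd w)) \<and>
      total f zs \<le> riemannian_dist f (proj_torus (fst w)) (proj_torus (snd w)) + e / 4"
    using dist_chain[OF f e4] by blast
  from choice[OF this] obtain Z where Z: "\<And>a b. path_ok (proj_torus a) (Z (a, b)) (proj_torus b)"
      "\<And>a b. total f (Z (a, b)) \<le> riemannian_dist f (proj_torus a) (proj_torus b) + e / 4" by fastforce
  obtain ws where ws: "set ws = A \<times> A" using finite_list[OF finite_cartesian_product[OF A(1) A(1)]] by blast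
  define zs where "zs = concat (map Z ws)"
  \<comment> \<open>Every polygon has at most \<open>length zs\<close> segments, so the tolerances
    add up to at most \<open>e / 4\<close>.\<close>
  define \<eta> where "\<eta> = e / (4 * (real (length zs) + 1))"
  have \<eta>: "\<eta> > 0" using e by (simp add: \<eta>_def)
  show ?thesis
  proof
    show "\<eta> > 0" by fact
    fix g :: "'n tensor2" and p q :: "'n torus"
    assume g: "cmetric g" and gK: "\<And>p v. nrm g p v \<le> K * norm v"
      and gz: "\<And>z. z \<in> set zs \<Longrightarrow> riemannian_dist g (proj_torus (fst z)) (proj_torus (snd z)) \<le> seg f (fst z) (snd z) + \<eta>"
    obtain x where x: "x \<in> cbox 0 1" "p = proj_torus x" by (rule torus_cube)
    obtain y where y: "y \<in> cbox 0 1" "q = proj_torus y" by (rule torus_cube)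
    obtain a where a: "a \<in> A" "norm (x - a) < r" "norm (a - x) < r"
      using A(2) x(1) by (auto simp: dist_norm norm_minus_commute subset_iff)
    obtain b where b: "b \<in> A" "norm (y - b) < r" "norm (b - y) < r"
      using A(2) y(1) by (auto simp: dist_norm norm_minus_commute subset_iff)
    have small: "K * norm (v - v') \<le> K * r" if "norm (v - v') < r" for v v' :: "real ^ 'n"
      using that K(2) by (intro mult_left_mono) auto
    have ab: "(a, b) \<in> set ws" using a b ws by auto
    then have sub: "set (Z (a, b)) \<subseteq> set zs" by (auto simp: zs_def)
    have len: "length (Z (a, b)) \<le> length zs"
    proof -
      have "length (Z (a, b)) \<le> (\<Sum>w\<leftarrow>ws. length (Z w))"
        using member_le_sum_list[of "length (Z (a, b))" "map (\<lambda>w. length (Z w)) ws"] ab by force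
      then show ?thesis by (simp add: zs_def length_concat o_def)
    qed
    have "riemannian_dist g (proj_torus a) (proj_torus b) \<le> (\<Sum>z\<leftarrow>Z (a, b). riemannian_dist g (proj_torus (fst z)) (proj_torus (snd z)))"
      by (rule dist_path_le[OF g Z(1)])
    also have "\<dots> \<le> (\<Sum>z\<leftarrow>Z (a, b). seg f (fst z) (snd z) + \<eta>)"
      by (rule sum_list_mono) (use gz sub in auto)
    also have "\<dots> = total f (Z (a, b)) + real (length (Z (a, b))) * \<eta>"
      by (simp add: total_def sum_list_addf sum_list_triv)
    also have "\<dots> \<le> riemannian_dist f (proj_torus a) (proj_torus b) + e / 4 + e / 4"
    proof -
      have "real (length (Z (a, b))) * \<eta> \<le> (real (length zs) + 1) * \<eta>"
        using len \<eta> by (intro mult_right_mono) auto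
      also have "\<dots> = e / 4" by (simp add: \<eta>_def field_simps)
      finally show ?thesis using Z(2)[of a b] by linarith
    qed
    finally have 1: "riemannian_dist g (proj_torus a) (proj_torus b) \<le> riemannian_dist f (proj_torus a) (proj_torus b) + e / 2" by simp
    have 2: "riemannian_dist g p q \<le> riemannian_dist g p (proj_torus a) + (riemannian_dist g (proj_torus a) (proj_torus b) + riemannian_dist g (proj_torus b) q)"
      using riemannian_dist_triangle[OF g, of p q "proj_torus a"] riemannian_dist_triangle[OF g, of "proj_torus a" q "proj_torus b"] by linarith
    have 3: "riemannian_dist g p (proj_torus a) \<le> K * r" "riemannian_dist g (proj_torus b) q \<le> K * r"
      using dist_proj_le[OF g gK, of x a] dist_proj_le[OF g gK, of b y] small[OF a(3)] small[OF b(2)] x y by auto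
    have 4: "riemannian_dist f (proj_torus a) (proj_torus b) \<le> riemannian_dist f (proj_torus a) p + (riemannian_dist f p q + riemannian_dist f q (proj_torus b))"
      using riemannian_dist_triangle[OF f, of "proj_torus a" "proj_torus b" p] riemannian_dist_triangle[OF f, of p "proj_torus b" q] by linarith
    have 5: "riemannian_dist f (proj_torus a) p \<le> K * r" "riemannian_dist f q (proj_torus b) \<le> K * r"
      using dist_proj_le[OF f K(1), of a x] dist_proj_le[OF f K(1), of y b] small[OF a(2)] small[OF b(3)] x y by auto
    show "riemannian_dist g p q \<le> riemannian_dist f p q + e"
      using 1 2 3 4 5 r(2) by linarith
  qed
qed

section \<open>Closed lines in general position\<close>

text \<open>Rounding down the components of \<open>N * d\<close> gives an integer vector, and
  \<open>c = 1 / N\<close> makes the error of every component at most \<open>1 / N\<close>.\<close>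

lemma rational_direction:
  fixes d :: "real ^ 'n::finite"
  assumes "\<eta> > 0"
  obtains u c where "u \<noteq> 0" "\<And>i. u $ i \<in> \<int>" "norm (d - c *\<^sub>R u) < \<eta>"
proof -
  obtain N :: nat where N: "real CARD('n) / \<eta> < real N" using reals_Archimedean2 by blast
  have "0 \<le> real CARD('n) / \<eta>" using assms by simp
  then have N0: "real N > 0" using N by linarith
  define u :: "real ^ 'n" where "u = (\<chi> i. of_int \<lfloor>real N * d $ i\<rfloor>)"
  have "\<bar>(d - (1 / real N) *\<^sub>R u) $ i\<bar> \<le> 1 / real N" for i
  proof -
    have "\<bar>real N * d $ i - of_int \<lfloor>real N * d $ i\<rfloor>\<bar> \<le> 1" by linarith
    then have "\<bar>real N * d $ i - of_int \<lfloor>real N * d $ i\<rfloor>\<bar> / real N \<le> 1 / real N" by (intro divide_right_mono) auto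
    moreover have "(d - (1 / real N) *\<^sub>R u) $ i = (real N * d $ i - of_int \<lfloor>real N * d $ i\<rfloor>) / real N"
      using N0 by (simp add: u_def field_simps)
    ultimately show ?thesis by simp
  qed
  then have "norm (d - (1 / real N) *\<^sub>R u) \<le> (\<Sum>i\<in>(UNIV::'n set). 1 / real N)"
    by (intro order_trans[OF norm_le_l1_cart] sum_mono)
  also have "\<dots> < \<eta>" using N N0 assms by (simp add: field_simps)
  finally have a: "norm (d - (1 / real N) *\<^sub>R u) < \<eta>" .
  show ?thesis
  proof (cases "u = 0")
    case False
    then show ?thesis by (rule that[OF _ _ a]) (simp add: u_def)
  next
    case True
    \<comment> \<open>If all components round to 0, then \<open>d\<close> itself is small, and any
      nonzero integer direction serves with \<open>c = 0\<close>.\<close>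
    then have "norm (d - 0 *\<^sub>R axis undefined 1) < \<eta>" using a by simp
    then show ?thesis by (rule that[rotated 2]) (auto simp: axis_def vec_eq_iff)
  qed
qed

text \<open>Contains the zero set of \<open>qf p\<close> without reference to the chosen index
  \<open>piv\<close>: translates of the line through \<open>p\<close> by countably many
  vectors.\<close>

definition on_line :: "real ^ 'n::finite \<Rightarrow> real ^ 'n \<Rightarrow> real ^ 'n \<Rightarrow> bool" where
  "on_line u p x \<longleftrightarrow> (\<exists>i m s. u $ i \<noteq> 0 \<and> (\<forall>j. m $ j \<in> \<int>) \<and> x - p = (1 / u $ i) *\<^sub>R m + s *\<^sub>R u)"

lemma (in line_field) qf_zero_on_line:
  assumes "qf p x = 0"
  shows "on_line u p x"
proof -
  define m where "m = (\<chi> j. \<theta> p j x)"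
  have "x - p = (1 / u $ piv) *\<^sub>R m + ((x $ piv - p $ piv) / u $ piv) *\<^sub>R u"
    using u_piv by (simp add: vec_eq_iff m_def \<theta>_def field_simps)
  moreover have "\<forall>j. m $ j \<in> \<int>" using assms by (simp add: m_def qf_zero_iff)
  ultimately show ?thesis unfolding on_line_def using u_piv by blast
qed

lemma countable_integer_vectors: "countable {m :: real ^ 'n::finite. \<forall>j. m $ j \<in> \<int>}"
proof -
  have "{m :: real ^ 'n. \<forall>j. m $ j \<in> \<int>} \<subseteq> range (\<lambda>f :: 'n \<Rightarrow> int. \<chi> j. of_int (f j))"
  proof
    fix m :: "real ^ 'n" assume "m \<in> {m. \<forall>j. m $ j \<in> \<int>}"
    then have "m = (\<chi> j. of_int \<lfloor>m $ j\<rfloor>)" by (auto simp: vec_eq_iff elim!: Ints_cases)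
    then show "m \<in> range (\<lambda>f :: 'n \<Rightarrow> int. \<chi> j. of_int (f j))"
      by (rule range_eqI[of _ _ "\<lambda>j. \<lfloor>m $ j\<rfloor>"])
  qed
  then show ?thesis by (rule countable_subset) simp
qed

text \<open>The base points for which the lines meet lie in countably many planes.\<close>

lemma general_position:
  fixes u y :: "real ^ 'n::finite" and A :: "((real ^ 'n) \<times> (real ^ 'n)) set"
  assumes card: "CARD('n) \<ge> 3" and \<eta>: "\<eta> > 0" and A: "finite A"
  obtains p where "norm (p - y) < \<eta>" "\<And>z x. z \<in> A \<Longrightarrow> on_line u p x \<Longrightarrow> \<not> on_line (fst z) (snd z) x"
proof -
  define C where "C v = (\<Union>i. (\<lambda>m. (1 / v $ i) *\<^sub>R m) ` {m :: real ^ 'n. \<forall>j. m $ j \<in> \<int>})" for v :: "real ^ 'n"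
  have C: "countable (C v)" for v
    unfolding C_def by (intro countable_UN countable_image countable_integer_vectors) auto
  \<comment> \<open>Eliminating a common point of the two lines leaves \<open>p\<close> in a
    translate of the span of both directions. Its dimension is at most 2, so it is negligible in
    dimension at least 3.\<close>
  define X where "X z d d' = (+) (snd z + d' - d) ` span {u, fst z}" for z :: "(real ^ 'n) \<times> (real ^ 'n)" and d d' :: "real ^ 'n"
  have nX: "negligible (X z d d')" for z d d'
  proof -
    have "dim (span {u, fst z}) \<le> card {u, fst z}" using dim_le_card[of "span {u, fst z}" "{u, fst z}"] by simp
    also have "\<dots> \<le> 2" by (simp add: card_insert_if)
    finally have "negligible (span {u, fst z})" using card by (intro negligible_lowdim) simp
    then show ?thesis unfolding X_def by (rule negligible_translation)
  qed
  define B where "B = (\<Union>z\<in>A. \<Union>d\<in>C u. \<Union>d'\<in>C (fst z). X z d d')"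
  have nB: "negligible B"
  proof -
    have "negligible (\<Union>((\<lambda>(z, d, d'). X z d d') ` (SIGMA z:A. C u \<times> C (fst z))))"
      by (intro negligible_countable_Union countable_image countable_SIGMA countable_finite[OF A] C) (auto simp: nX)
    moreover have "B = \<Union>((\<lambda>(z, d, d'). X z d d') ` (SIGMA z:A. C u \<times> C (fst z)))"
      unfolding B_def by fastforce
    ultimately show ?thesis by simp
  qed
  have "\<not> ball y \<eta> \<subseteq> B"
    using negligible_subset[OF nB] open_not_negligible[of "ball y \<eta>"] \<eta> by auto
  then obtain p where p: "p \<in> ball y \<eta>" "p \<notin> B" by blast
  show ?thesis
  proof
    show "norm (p - y) < \<eta>" using p(1) by (simp add: dist_norm norm_minus_commute)
    fix z x assume z: "z \<in> A" and x: "on_line u p x"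
    show "\<not> on_line (fst z) (snd z) x"
    proof
      assume x': "on_line (fst z) (snd z) x"
      obtain i m s where 1: "\<forall>j. m $ j \<in> \<int>" "x - p = (1 / u $ i) *\<^sub>R m + s *\<^sub>R u"
        using x unfolding on_line_def by blast
      obtain i' m' s' where 2: "\<forall>j. m' $ j \<in> \<int>" "x - snd z = (1 / fst z $ i') *\<^sub>R m' + s' *\<^sub>R fst z"
        using x' unfolding on_line_def by blast
      define d where "d = (1 / u $ i) *\<^sub>R m"
      define d' where "d' = (1 / fst z $ i') *\<^sub>R m'"
      have d: "d \<in> C u" "d' \<in> C (fst z)" using 1(1) 2(1) unfolding C_def d_def d'_def by blast+
      have "x = p + d + s *\<^sub>R u" "x = snd z + d' + s' *\<^sub>R fst z"
        using 1(2) 2(2) by (simp_all add: d_def d'_def algebra_simps)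
      then have "p = (snd z + d' - d) + (s' *\<^sub>R fst z - s *\<^sub>R u)" by (simp add: algebra_simps)
      moreover have "s' *\<^sub>R fst z - s *\<^sub>R u \<in> span {u, fst z}"
        by (intro span_diff span_scale span_base) auto
      ultimately have "p \<in> X z d d'" unfolding X_def by blast
      then show False using p(2) z d unfolding B_def by blast
    qed
  qed
qed

text \<open>Lines are added one at a time, each in general position to the finitely many earlier
  ones. Half of \<open>\<eta>\<close> is spent on the base point and half on the integer
  direction.\<close>

lemma lines_near_segments:
  fixes zs :: "((real ^ 'n::finite) \<times> (real ^ 'n)) list"
  assumes card: "CARD('n) \<ge> 3" and \<eta>: "\<eta> > 0"
  shows "\<exists>u p c. \<forall>k<length zs. u k \<noteq> 0 \<and> (\<forall>i. u k $ i \<in> \<int>) \<and> norm (p k - fst (zs ! k)) < \<eta> \<and>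
     norm (p k + c k *\<^sub>R u k - snd (zs ! k)) < \<eta> \<and>
     (\<forall>l<length zs. l \<noteq> k \<longrightarrow> (\<forall>x. on_line (u k) (p k) x \<longrightarrow> \<not> on_line (u l) (p l) x))"
proof (induction zs rule: rev_induct)
  case (snoc z zs)
  then obtain u p c where IH: "\<And>k. k < length zs \<Longrightarrow> u k \<noteq> 0 \<and> (\<forall>i. u k $ i \<in> \<int>) \<and> norm (p k - fst (zs ! k)) < \<eta> \<and>
     norm (p k + c k *\<^sub>R u k - snd (zs ! k)) < \<eta> \<and>
     (\<forall>l<length zs. l \<noteq> k \<longrightarrow> (\<forall>x. on_line (u k) (p k) x \<longrightarrow> \<not> on_line (u l) (p l) x))" by blast
  let ?n = "length zs"
  have h: "\<eta> / 2 > 0" using \<eta> by simp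
  obtain u' c' where u': "u' \<noteq> 0" "\<And>i. u' $ i \<in> \<int>" "norm ((snd z - fst z) - c' *\<^sub>R u') < \<eta> / 2"
    using rational_direction[OF h] by blast
  obtain p' where p': "norm (p' - fst z) < \<eta> / 2"
    "\<And>w x. w \<in> (\<lambda>k. (u k, p k)) ` {..<?n} \<Longrightarrow> on_line u' p' x \<Longrightarrow> \<not> on_line (fst w) (snd w) x"
    using general_position[OF card h, of "(\<lambda>k. (u k, p k)) ` {..<?n}"] by blast
  have sep: "\<not> on_line (u k) (p k) x" if "k < ?n" "on_line u' p' x" for k x
    using p'(2)[of "(u k, p k)" x] that by auto
  have n2: "norm (p' + c' *\<^sub>R u' - snd z) < \<eta>"
  proof -
    have e: "p' + c' *\<^sub>R u' - snd z = (p' - fst z) - ((snd z - fst z) - c' *\<^sub>R u')" by simp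
    have "norm (p' + c' *\<^sub>R u' - snd z) \<le> norm (p' - fst z) + norm ((snd z - fst z) - c' *\<^sub>R u')"
      unfolding e by (rule norm_triangle_ineq4)
    then show ?thesis using p'(1) u'(3) by linarith
  qed
  have n1: "norm (p' - fst z) < \<eta>" using p'(1) \<eta> by simp
  show ?case
  proof (rule exI[of _ "u(?n := u')"], rule exI[of _ "p(?n := p')"], rule exI[of _ "c(?n := c')"], intro allI impI)
    fix k assume k: "k < length (zs @ [z])"
    show "(u(?n := u')) k \<noteq> 0 \<and> (\<forall>i. (u(?n := u')) k $ i \<in> \<int>) \<and> norm ((p(?n := p')) k - fst ((zs @ [z]) ! k)) < \<eta> \<and>
     norm ((p(?n := p')) k + (c(?n := c')) k *\<^sub>R (u(?n := u')) k - snd ((zs @ [z]) ! k)) < \<eta> \<and>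
     (\<forall>l<length (zs @ [z]). l \<noteq> k \<longrightarrow> (\<forall>x. on_line ((u(?n := u')) k) ((p(?n := p')) k) x \<longrightarrow> \<not> on_line ((u(?n := u')) l) ((p(?n := p')) l) x))"
    proof (cases "k = ?n")
      case True
      have "\<not> on_line ((u(?n := u')) l) ((p(?n := p')) l) x" if "l < length (zs @ [z])" "l \<noteq> k" "on_line u' p' x" for l x
        using sep[of l x] that True by simp
      then show ?thesis using True u' n1 n2 by simp
    next
      case False
      then have k': "k < ?n" using k by simp
      have "\<not> on_line ((u(?n := u')) l) ((p(?n := p')) l) x" if "l < length (zs @ [z])" "l \<noteq> k" "on_line (u k) (p k) x" for l x
      proof (cases "l = ?n")
        case True
        then show ?thesis using sep[OF k'] that(3) by auto
      next
        case False
        then show ?thesis using IH[OF k'] that by simp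
      qed
      then show ?thesis using IH[OF k'] k' by (simp add: nth_append)
    qed
  qed
qed simp

section \<open>Smooth approximation on the torus\<close>

lemma continuous_on_torus_iff:
  fixes F :: "'n::finite torus \<Rightarrow> 'b::topological_space"
  shows "continuous_on UNIV F \<longleftrightarrow> continuous_on UNIV (\<lambda>x. F (proj_torus x))"
  by (simp add: continuous_on_open_vimage open_torus_def vimage_comp o_def)

lemma compact_torus: "compact (UNIV :: 'n::finite torus set)"
proof -
  have c: "continuous_on UNIV (proj_torus :: real ^ 'n \<Rightarrow> 'n torus)"
    by (simp add: continuous_on_open_vimage open_torus_def)
  have "UNIV = proj_torus ` (cbox 0 1 :: (real ^ 'n) set)"
    using torus_cube by blast
  then show ?thesis
    using compact_continuous_image[OF continuous_on_subset[OF c subset_UNIV] compact_cbox[of 0 1]] by simp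
qed

text \<open>Cosine and sine of \<open>2 * pi * x $ i\<close> determine \<open>x $ i\<close> modulo
  1. Serves both the Hausdorff property and the Stone-Weierstrass theorem.\<close>

lemma torus_separation:
  fixes p q :: "'n::finite torus"
  assumes "p \<noteq> q"
  obtains F :: "'n torus \<Rightarrow> real" where "smooth (\<lambda>x. F (proj_torus x))" "F p \<noteq> F q"
proof -
  have per: "cos (2 * pi * rep_torus (proj_torus x) $ i) = cos (2 * pi * x $ i)"
    "sin (2 * pi * rep_torus (proj_torus x) $ i) = sin (2 * pi * x $ i)" for x :: "real ^ 'n" and i
  proof -
    have "lattice_rel (rep_torus (proj_torus x)) x"
      by (simp add: proj_rep_torus flip: proj_torus_eq_iff)
    then obtain n where "rep_torus (proj_torus x) $ i - x $ i = of_int n"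
      unfolding lattice_rel_def by (auto elim: Ints_cases)
    then have "2 * pi * rep_torus (proj_torus x) $ i = 2 * pi * x $ i + 2 * pi * of_int n"
      by (simp add: algebra_simps)
    then show "cos (2 * pi * rep_torus (proj_torus x) $ i) = cos (2 * pi * x $ i)"
      "sin (2 * pi * rep_torus (proj_torus x) $ i) = sin (2 * pi * x $ i)"
      by (simp_all add: sin_add cos_add sin_int_2pin cos_int_2pin)
  qed
  have "\<exists>i. cos (2 * pi * rep_torus p $ i) \<noteq> cos (2 * pi * rep_torus q $ i) \<or> sin (2 * pi * rep_torus p $ i) \<noteq> sin (2 * pi * rep_torus q $ i)"
  proof (rule ccontr)
    assume neg: "\<not> ?thesis"
    have "lattice_rel (rep_torus p) (rep_torus q)"
      unfolding lattice_rel_def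
    proof
      fix i
      have "cos (2 * pi * rep_torus p $ i - 2 * pi * rep_torus q $ i) = 1"
        using neg sin_cos_squared_add[of "2 * pi * rep_torus q $ i"] by (simp add: cos_diff power2_eq_square add.commute)
      then obtain n :: int where "2 * pi * rep_torus p $ i - 2 * pi * rep_torus q $ i = of_int n * 2 * pi"
        using cos_one_2pi_int by blast
      then have "2 * pi * (rep_torus p $ i - rep_torus q $ i) = 2 * pi * of_int n" by (simp add: algebra_simps)
      then show "rep_torus p $ i - rep_torus q $ i \<in> \<int>" by simp
    qed
    then have "proj_torus (rep_torus p) = proj_torus (rep_torus q)" by (simp add: proj_torus_eq_iff)
    then show False using assms by (simp add: proj_rep_torus)
  qed
  then obtain i where "cos (2 * pi * rep_torus p $ i) \<noteq> cos (2 * pi * rep_torus q $ i) \<or> sin (2 * pi * rep_torus p $ i) \<noteq> sin (2 * pi * rep_torus q $ i)" ..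
  then show ?thesis
  proof
    assume "cos (2 * pi * rep_torus p $ i) \<noteq> cos (2 * pi * rep_torus q $ i)"
    then show ?thesis by (intro that[of "\<lambda>p. cos (2 * pi * rep_torus p $ i)"]) (unfold per, intro smooth_intros)
  next
    assume "sin (2 * pi * rep_torus p $ i) \<noteq> sin (2 * pi * rep_torus q $ i)"
    then show ?thesis by (intro that[of "\<lambda>p. sin (2 * pi * rep_torus p $ i)"]) (unfold per, intro smooth_intros)
  qed
qed

instance torus :: (finite) t2_space
proof
  fix p q :: "'a torus" assume "p \<noteq> q"
  then obtain F :: "'a torus \<Rightarrow> real" where F: "smooth (\<lambda>x. F (proj_torus x))" "F p \<noteq> F q"
    by (rule torus_separation)
  have c: "continuous_on UNIV F" unfolding continuous_on_torus_iff by (rule smooth_continuous[OF F(1)])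
  obtain U V where UV: "open U" "open V" "F p \<in> U" "F q \<in> V" "U \<inter> V = {}" using hausdorff[OF F(2)] by blast
  have "open (F -` U)" "open (F -` V)" using c UV by (simp_all add: continuous_on_open_vimage)
  then show "\<exists>U V. open U \<and> open V \<and> p \<in> U \<and> q \<in> V \<and> U \<inter> V = {}"
    using UV by (intro exI[of _ "F -` U"] exI[of _ "F -` V"]) auto
qed

text \<open>\<open>f\<close> is merely continuous while the exponent \<open>b\<close> has to be
  smooth. The algebra of smooth functions separates points, so the Stone-Weierstrass theorem
  applies.\<close>

lemma smooth_approximation:
  fixes f :: "'n::finite torus \<Rightarrow> real"
  assumes f: "continuous_on UNIV f" and e: "e > 0"
  obtains F where "smooth (\<lambda>x. F (proj_torus x))" "\<And>p. \<bar>f p - F p\<bar> < e"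
proof -
  interpret function_ring_on "{F :: 'n torus \<Rightarrow> real. smooth (\<lambda>x. F (proj_torus x))}" UNIV
  proof
    show "compact (UNIV :: 'n torus set)" by (rule compact_torus)
    fix p q :: "'n torus" assume "p \<noteq> q"
    then obtain F :: "'n torus \<Rightarrow> real" where "smooth (\<lambda>x. F (proj_torus x))" "F p \<noteq> F q"
      by (rule torus_separation)
    then show "\<exists>F\<in>{F. smooth (\<lambda>x. F (proj_torus x))}. F p \<noteq> F q" by blast
  qed (auto simp: continuous_on_torus_iff intro: smooth_continuous smooth_intros)
  show ?thesis using Stone_Weierstrass_basic[OF f e] that by auto
qed

section \<open>Metrics on the torus\<close>

lemma riemannian_metric_cmetric: "riemannian_metric g \<Longrightarrow> cmetric g"
proof -
  assume g: "riemannian_metric g"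
  have "g p v v \<ge> 0" for p v
  proof (cases "v = 0")
    case True
    have "linear (g p 0)" using g by (auto simp: riemannian_metric_def bilinear_def)
    then show ?thesis using True by (simp add: linear_0)
  next
    case False
    then show ?thesis using g by (auto simp: riemannian_metric_def intro: less_imp_le)
  qed
  then show "cmetric g" using g by (auto simp: riemannian_metric_def cmetric_def intro: smooth_continuous)
qed

lemma cmetric_inner:
  assumes "cmetric g"
  shows "g (proj_torus x) v w = v \<bullet> (comp_mat g x *v w)"
proof -
  have "bilinear (g (proj_torus x))" using assms by (simp add: cmetric_def)
  then show ?thesis
    by (simp add: cmetric_components inner_vec_def matrix_vector_mult_def sum_distrib_left mult_ac)
qed

lemma bilinear_scale: "bilinear B \<Longrightarrow> bilinear (\<lambda>v w. (r::real) * B v w)"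
  unfolding bilinear_def linear_iff by (simp add: algebra_simps)

lemma cmetric_conformal:
  assumes g: "cmetric g" and f: "continuous_on UNIV f"
  shows "cmetric (conformal f g)"
proof -
  have "continuous_on UNIV (\<lambda>x. comp_mat (conformal f g) x $ i $ j)" for i j
  proof -
    have "continuous_on UNIV (\<lambda>x. exp (2 * f (proj_torus x)) * comp_mat g x $ i $ j)"
      using f g unfolding continuous_on_torus_iff[of f] cmetric_def
      by (intro continuous_on_mult continuous_on_exp continuous_on_const) simp_all
    then show ?thesis by (simp add: comp_mat_def conformal_def)
  qed
  moreover have "conformal f g p = (\<lambda>v w. exp (2 * f p) * g p v w)" for p
    by (intro ext) (simp add: conformal_def)
  ultimately show ?thesis
    using g unfolding cmetric_def by (simp add: bilinear_scale)
qed

lemma nrm_conformal: "nrm (conformal f g) p v = exp (f p) * nrm g p v"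
proof -
  have "exp (2 * f p) = (exp (f p))\<^sup>2" by (simp add: exp_double)
  then show ?thesis by (simp add: nrm_def conformal_def real_sqrt_mult)
qed

text \<open>A constant factor cancels in the Christoffel symbols, so flatness passes to the
  multiple, and with it the vanishing of the scalar curvature.\<close>

lemma metric_field_scale:
  fixes g0 :: "'n::finite tensor2"
  assumes g0: "riemannian_metric g0" and fl: "flat g0" and r: "r > 0"
  shows "metric_field (\<lambda>x. r *\<^sub>R comp_mat g0 x)"
proof -
  define g where "g p v w = r * g0 p v w" for p v w
  have cm: "comp_mat g = (\<lambda>x. r *\<^sub>R comp_mat g0 x)"
    by (intro ext) (simp add: comp_mat_def g_def vec_eq_iff)
  have s0: "smooth (\<lambda>x. comp_mat g0 x $ i $ j)" for i j using g0 by (simp add: riemannian_metric_def)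
  have s: "smooth (\<lambda>x. (r *\<^sub>R comp_mat g0 x) $ i $ j)" for i j
    using smooth_mult[OF smooth_const[of r] s0[of i j]] by simp
  have pos0: "v \<bullet> (comp_mat g0 x *v v) > 0" if "v \<noteq> 0" for x v
  proof -
    have "g0 (proj_torus x) v v > 0" using g0 that by (simp add: riemannian_metric_def)
    then show ?thesis by (simp add: cmetric_inner[OF riemannian_metric_cmetric[OF g0]])
  qed
  have pos: "v \<bullet> ((r *\<^sub>R comp_mat g0 x) *v v) > 0" if "v \<noteq> 0" for x v
    using pos0[OF that] r by (simp add: scaleR_matrix_vector_assoc[symmetric])
  have inv: "matrix_inv (r *\<^sub>R comp_mat g0 x) = (1 / r) *\<^sub>R matrix_inv (comp_mat g0 x)" for x
  proof (rule matrix_inv_eqI)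
    show "(1 / r) *\<^sub>R matrix_inv (comp_mat g0 x) ** (r *\<^sub>R comp_mat g0 x) = mat 1"
      using matrix_inv_mult(2)[OF det_nz_posdef[OF pos0]] r
      by (simp add: scalar_matrix_assoc[symmetric] matrix_scalar_ac)
  qed
  have ch: "christoffel g k i j = christoffel g0 k i j" for k i j
  proof
    fix x
    have p: "partial a (\<lambda>y. (r *\<^sub>R comp_mat g0 y) $ b $ d) x = r * partial a (\<lambda>y. comp_mat g0 y $ b $ d) x" for a b d
      using partial_cmult[OF s0[of b d], of a r x] by simp
    show "christoffel g k i j x = christoffel g0 k i j x"
      unfolding christoffel_def cm p inv using r
      by (intro arg_cong[where f = "(*) (1 / 2)"] sum.cong refl) (simp add: field_simps)
  qed
  have "riemann g l k i j x = 0" for l k i j x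
    using fl unfolding flat_def riemann_def ch by simp
  then have "scalar_curvature g (proj_torus x) = 0" for x
    by (simp add: scalar_curvature_proj ricci_def)
  moreover have "scalar_curvature g (proj_torus x) = curv (comp_mat g) x" for x
    by (rule scalar_curvature_curv) (use s det_nz_posdef[OF pos] in \<open>simp_all add: cm\<close>)
  ultimately have curv: "curv (\<lambda>x. r *\<^sub>R comp_mat g0 x) x = 0" for x by (simp add: cm)
  show ?thesis
  proof
    show "smooth (\<lambda>x. (r *\<^sub>R comp_mat g0 x) $ i $ j)" for i j by (rule s)
    show "r *\<^sub>R comp_mat g0 x = r *\<^sub>R comp_mat g0 y" if "lattice_rel x y" for x y
      using comp_mat_periodic[OF that, of g0] by simp
    show "(r *\<^sub>R comp_mat g0 x) $ i $ j = (r *\<^sub>R comp_mat g0 x) $ j $ i" for x i j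
      using g0 by (simp add: riemannian_metric_def comp_mat_def)
    show "0 < v \<bullet> ((r *\<^sub>R comp_mat g0 x) *v v)" if "v \<noteq> 0" for v x by (rule pos[OF that])
    show "curv (\<lambda>x. r *\<^sub>R comp_mat g0 x) x = 0" for x by (rule curv)
  qed
qed

text \<open>Allows the segments of the network to be moved slightly onto the lines.\<close>

lemma continuous_seg:
  fixes g :: "'n::finite tensor2"
  assumes g: "cmetric g"
  shows "continuous_on UNIV (\<lambda>z. seg g (fst z) (snd z))"
proof -
  have "continuous_on ((UNIV :: ((real ^ 'n) \<times> (real ^ 'n)) set) \<times> cbox 0 (1::real)) (\<lambda>w. (fst (fst w) + snd w *\<^sub>R (snd (fst w) - fst (fst w)), snd (fst w) - fst (fst w)))"
    by (intro continuous_intros)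
  from continuous_on_compose2[OF continuous_nrm[OF g, of UNIV] this]
  have "continuous_on (UNIV \<times> cbox 0 (1::real)) (\<lambda>(z, t). nrm g (proj_torus (fst z + t *\<^sub>R (snd z - fst z))) (snd z - fst z))"
    by (simp add: case_prod_unfold)
  from integral_continuous_on_param[OF this] show ?thesis by (simp add: seg_def)
qed

text \<open>Periodicity makes the field independent of the representative and reduces positivity to
  the unit cube.\<close>

lemma metric_from_field:
  fixes m :: "real ^ 'n::finite \<Rightarrow> real ^ 'n ^ 'n"
  assumes s: "\<And>i j. smooth (\<lambda>x. m x $ i $ j)" and per: "\<And>x y. lattice_rel x y \<Longrightarrow> m x = m y"
    and sym: "\<And>x i j. m x $ i $ j = m x $ j $ i" and pos: "\<And>x v. x \<in> cbox 0 1 \<Longrightarrow> v \<noteq> 0 \<Longrightarrow> v \<bullet> (m x *v v) > 0"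
  obtains g where "riemannian_metric g" "comp_mat g = m" "\<And>x v. g (proj_torus x) v v = v \<bullet> (m x *v v)"
    "\<And>x. scalar_curvature g (proj_torus x) = curv m x"
proof -
  define g :: "'n tensor2" where "g p v w = v \<bullet> (m (rep_torus p) *v w)" for p v w
  have rep: "m (rep_torus (proj_torus x)) = m x" for x
    by (rule per) (simp add: proj_rep_torus flip: proj_torus_eq_iff)
  have posx: "v \<bullet> (m x *v v) > 0" if "v \<noteq> 0" for x v
  proof -
    obtain y where y: "y \<in> cbox 0 1" "lattice_rel x y" by (rule lattice_cube)
    show ?thesis using pos[OF y(1) that] per[OF y(2)] by simp
  qed
  have cm: "comp_mat g = m"
    by (intro ext) (simp add: vec_eq_iff comp_mat_def g_def rep inner_axis' matrix_vector_mult_basis column_def)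
  have "v \<bullet> (m x *v w) = w \<bullet> (m x *v v)" for x v w by (rule inner_matrix_sym) (rule sym)
  then have "riemannian_metric g"
    unfolding riemannian_metric_def cm using posx s
    by (auto simp: g_def bilinear_def linear_iff inner_add_left inner_add_right matrix_vector_right_distrib
        matrix_vector_mult_scaleR)
  moreover have "scalar_curvature g (proj_torus x) = curv m x" for x
    using scalar_curvature_curv[of g x] s det_nz_posdef[OF posx] by (simp add: cm)
  ultimately show ?thesis using that cm by (auto simp: g_def rep)
qed

section \<open>The approximating metrics\<close>

text \<open>The segments with their tolerance \<open>\<eta>\<close>, the closeness
  \<open>\<eta>2\<close> of lines to segments, and the accuracy \<open>e1\<close> of the smooth
  exponent are chosen in this order. The constants \<open>l\<close>, \<open>M\<close> and
  \<open>\<beta>\<close> depend on \<open>B\<close> alone, so the constant of equivalence with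
  \<open>g0\<close> is independent of \<open>\<epsilon>\<close>.\<close>

lemma approximating_metric:
  fixes g0 :: "'n::finite tensor2" and f :: "'n torus \<Rightarrow> real"
  assumes card: "CARD('n) \<ge> 4" and g0: "riemannian_metric g0" and fl: "flat g0"
    and f: "continuous_on UNIV f" and B: "\<And>p. \<bar>f p\<bar> \<le> B" and \<epsilon>: "\<epsilon> > 0"
  obtains g where "riemannian_metric g" "\<And>p. scalar_curvature g p > - \<epsilon>"
    "\<And>p q. \<bar>riemannian_dist g p q - riemannian_dist (conformal f g0) p q\<bar> \<le> \<epsilon>"
    "\<And>p v. g0 p v v / exp (6 * B + 8) \<le> g p v v" "\<And>p v. g p v v \<le> exp (6 * B + 8) * g0 p v v"
proof -
  let ?fc = "conformal f g0"
  \<comment> \<open>The smooth exponent \<open>F\<close> will stay within 1 of \<open>f\<close>, so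
    \<open>b = F - l\<close> lies between \<open>- M\<close> and 0; \<open>\<beta> = M + 1\<close>
    is large enough because \<open>n - 2 \<ge> 1\<close>.\<close>
  define l where "l = B + 1"
  define M where "M = 2 * B + 2"
  define \<beta> where "\<beta> = M + 1"
  have B0: "B \<ge> 0" using B[of undefined] by linarith
  have cg0: "cmetric g0" by (rule riemannian_metric_cmetric[OF g0])
  have cfc: "cmetric ?fc" by (rule cmetric_conformal[OF cg0 f])
  obtain K0 where K0: "K0 \<ge> 0" "\<And>p v. nrm g0 p v \<le> K0 * norm v" using nrm_bound[OF cg0] by blast
  \<comment> \<open>\<open>exp (\<beta> + l)\<close> bounds the stretching of \<open>g0\<close> in
    the metric to be built, so one \<open>K\<close> serves for it and for
    \<open>conformal f g0\<close>.\<close>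
  define K where "K = exp (\<beta> + l) * K0"
  have K: "K \<ge> 0" using K0 by (simp add: K_def)
  have fcK: "nrm ?fc p v \<le> K * norm v" for p v
  proof -
    have "f p \<le> \<beta> + l" using B[of p] B0 by (simp add: \<beta>_def M_def l_def)
    then show ?thesis unfolding nrm_conformal K_def mult.assoc
      using K0 nrm_nonneg[OF cg0] by (intro mult_mono) auto
  qed
  define D where "D = K * real CARD('n)"
  have D: "riemannian_dist ?fc p q \<le> D" for p q
  proof -
    obtain x where x: "x \<in> cbox 0 1" "p = proj_torus x" by (rule torus_cube)
    obtain y where y: "y \<in> cbox 0 1" "q = proj_torus y" by (rule torus_cube)
    have "norm (y - x) \<le> (\<Sum>i\<in>UNIV. \<bar>(y - x) $ i\<bar>)" by (rule norm_le_l1_cart)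
    also have "\<dots> \<le> (\<Sum>i\<in>(UNIV::'n set). 1)"
    proof (rule sum_mono)
      fix i
      have "0 \<le> x $ i" "x $ i \<le> 1" "0 \<le> y $ i" "y $ i \<le> 1" using x(1) y(1) by (simp_all add: mem_box_cart)
      then show "\<bar>(y - x) $ i\<bar> \<le> 1" by simp
    qed
    finally have "K * norm (y - x) \<le> D" using K by (auto simp: D_def intro: mult_left_mono)
    then show ?thesis using dist_proj_le[OF cfc fcK, of x y] x y by simp
  qed
  have D0: "D \<ge> 0" using K by (simp add: D_def)
  define near where "near zs \<eta> \<longleftrightarrow> (\<forall>g p q. cmetric g \<longrightarrow> (\<forall>p v. nrm g p v \<le> K * norm v) \<longrightarrow>
      (\<forall>z\<in>set zs. riemannian_dist g (proj_torus (fst z)) (proj_torus (snd z)) \<le> seg ?fc (fst z) (snd z) + \<eta>) \<longrightarrow>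
      riemannian_dist g p q \<le> riemannian_dist ?fc p q + \<epsilon>)" for zs \<eta>
  have "\<exists>zs \<eta>. \<eta> > 0 \<and> near zs \<eta>"
  proof (rule finite_network[OF cfc fcK K \<epsilon>])
    fix zs \<eta>
    assume a: "\<eta> > 0" "\<And>g p q. cmetric g \<Longrightarrow> (\<And>p v. nrm g p v \<le> K * norm v) \<Longrightarrow>
      (\<And>z. z \<in> set zs \<Longrightarrow> riemannian_dist g (proj_torus (fst z)) (proj_torus (snd z)) \<le> seg ?fc (fst z) (snd z) + \<eta>) \<Longrightarrow>
      riemannian_dist g p q \<le> riemannian_dist ?fc p q + \<epsilon>"
    have "near zs \<eta>" unfolding near_def by (intro allI impI a(2)) auto
    then show ?thesis using a(1) by blast
  qed
  then obtain zs \<eta> where \<eta>: "\<eta> > 0" and near: "near zs \<eta>" by blast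
  have net: "riemannian_dist g p q \<le> riemannian_dist ?fc p q + \<epsilon>"
    if "cmetric g" "\<And>p v. nrm g p v \<le> K * norm v"
      "\<And>z. z \<in> set zs \<Longrightarrow> riemannian_dist g (proj_torus (fst z)) (proj_torus (snd z)) \<le> seg ?fc (fst z) (snd z) + \<eta>" for g p q
    using near that unfolding near_def by simp
  have \<eta>4: "\<eta> / 4 > 0" using \<eta> by simp
  have "\<forall>z\<in>set zs. \<exists>d>0. \<forall>w. dist w z < d \<longrightarrow> seg ?fc (fst w) (snd w) < seg ?fc (fst z) (snd z) + \<eta> / 4"
  proof
    fix z assume "z \<in> set zs"
    have "isCont (\<lambda>z. seg ?fc (fst z) (snd z)) z"
      using continuous_seg[OF cfc] by (simp add: continuous_on_eq_continuous_at del: split_paired_All)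
    then obtain d where d: "d > 0" "\<And>w. dist w z < d \<Longrightarrow> dist (seg ?fc (fst w) (snd w)) (seg ?fc (fst z) (snd z)) < \<eta> / 4"
      unfolding continuous_at_eps_delta using \<eta>4 by blast
    show "\<exists>d>0. \<forall>w. dist w z < d \<longrightarrow> seg ?fc (fst w) (snd w) < seg ?fc (fst z) (snd z) + \<eta> / 4"
    proof (intro exI[of _ d] conjI allI impI)
      fix w assume "dist w z < d"
      from d(2)[OF this] show "seg ?fc (fst w) (snd w) < seg ?fc (fst z) (snd z) + \<eta> / 4"
        unfolding dist_real_def abs_less_iff by linarith
    qed (rule d(1))
  qed
  from bchoice[OF this] obtain d where d: "\<And>z. z \<in> set zs \<Longrightarrow> d z > 0"
    "\<And>z w. z \<in> set zs \<Longrightarrow> dist w z < d z \<Longrightarrow> seg ?fc (fst w) (snd w) < seg ?fc (fst z) (snd z) + \<eta> / 4" by blast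
  obtain d0 where d0: "d0 > 0" "\<And>z. z \<in> set zs \<Longrightarrow> d0 \<le> d z"
    using finite_pos_lower_bound[of "set zs" d] d(1) by auto
  \<comment> \<open>The first bound keeps the change of \<open>seg\<close> under moving a segment
    below \<open>\<eta> / 4\<close>; the second lets moving each end point cost at most
    \<open>\<eta> / 4\<close>.\<close>
  define \<eta>2 where "\<eta>2 = min (d0 / 2) (\<eta> / (4 * (K + 1)))"
  have \<eta>2: "\<eta>2 > 0" "2 * \<eta>2 \<le> d0" using d0 \<eta> K by (auto simp: \<eta>2_def)
  have K\<eta>2: "K * \<eta>2 \<le> \<eta> / 4"
  proof -
    have "K * \<eta>2 \<le> (K + 1) * (\<eta> / (4 * (K + 1)))" using K \<eta>2 by (intro mult_mono) (auto simp: \<eta>2_def)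
    also have "\<dots> = \<eta> / 4"
    proof -
      have *: "x * (\<eta> / (4 * x)) = \<eta> / 4" if "x \<noteq> 0" for x using that by simp
      show ?thesis by (rule *) (use K in linarith)
    qed
    finally show ?thesis .
  qed
  define S where "S = (\<Sum>z\<leftarrow>zs. \<bar>seg ?fc (fst z) (snd z)\<bar> + \<eta>)"
  have S: "seg ?fc (fst z) (snd z) + \<eta> / 4 \<le> S" if "z \<in> set zs" for z
  proof -
    have "\<bar>seg ?fc (fst z) (snd z)\<bar> + \<eta> \<le> S"
      unfolding S_def by (rule member_le_sum_list) (use that \<eta> in auto)
    then show ?thesis using \<eta> by linarith
  qed
  have S0: "S \<ge> 0" unfolding S_def using \<eta> by (intro sum_list_nonneg) auto
  \<comment> \<open>A relative error of order \<open>e1\<close> must cost at most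
    \<open>\<epsilon>\<close> up to the diameter bound \<open>D\<close> for the lower estimate, and
    at most \<open>\<eta> / 4\<close> on segments of length at most \<open>S\<close> for the upper
    one.\<close>
  define e1 where "e1 = min 1 (min (\<epsilon> / (D + 1)) (\<eta> / (8 * (S + 1))))"
  have e1: "e1 > 0" "e1 \<le> 1" "e1 \<le> \<epsilon> / (D + 1)" "e1 \<le> \<eta> / (8 * (S + 1))"
    using \<epsilon> D0 S0 \<eta> by (auto simp: e1_def)
  have e1D: "e1 * D \<le> \<epsilon>"
  proof -
    have "e1 * D \<le> \<epsilon> / (D + 1) * (D + 1)" using e1 D0 \<epsilon> by (intro mult_mono) auto
    then show ?thesis using D0 by simp
  qed
  have e1S: "2 * e1 * S \<le> \<eta> / 4"
  proof -
    have "e1 * S \<le> \<eta> / (8 * (S + 1)) * (S + 1)" using e1 S0 \<eta> by (intro mult_mono) auto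
    also have "\<dots> = \<eta> / 8"
    proof -
      have *: "\<eta> / (8 * x) * x = \<eta> / 8" if "x \<noteq> 0" for x using that by simp
      show ?thesis by (rule *) (use S0 in linarith)
    qed
    finally show ?thesis by simp
  qed
  obtain F where F: "smooth (\<lambda>x. F (proj_torus x))" "\<And>p. \<bar>f p - F p\<bar> < e1"
    using smooth_approximation[OF f e1(1)] by blast
  define b where "b x = F (proj_torus x) - l" for x :: "real ^ 'n"
  have Fb: "\<bar>F p\<bar> \<le> B + 1" for p using F(2)[of p] B[of p] e1(2) by linarith
  have sb: "smooth b" unfolding b_def by (intro smooth_intros F)
  have perb: "b x = b y" if "lattice_rel x y" for x y using that by (simp add: b_def flip: proj_torus_eq_iff)
  have b: "- M \<le> b x" "b x \<le> 0" for x using Fb[of "proj_torus x"] by (auto simp: b_def M_def l_def)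
  have \<beta>: "\<beta> \<ge> 0" "\<beta> * (real CARD('n) - 2) \<ge> M + 1"
  proof -
    show "\<beta> \<ge> 0" using B0 by (simp add: \<beta>_def M_def)
    have "\<beta> * 1 \<le> \<beta> * (real CARD('n) - 2)" using \<open>\<beta> \<ge> 0\<close> card by (intro mult_left_mono) auto
    then show "\<beta> * (real CARD('n) - 2) \<ge> M + 1" by (simp add: \<beta>_def)
  qed
  \<comment> \<open>With \<open>h = exp (2 * l) * g0\<close>, the form
    \<open>exp (2 * b) * h\<close> is \<open>exp (2 * F) * g0\<close>.\<close>
  define r where "r = exp (2 * l)"
  interpret h: metric_field "\<lambda>x. r *\<^sub>R comp_mat g0 x"
    by (rule metric_field_scale[OF g0 fl]) (simp add: r_def)
  let ?h = "\<lambda>x. r *\<^sub>R comp_mat g0 x"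
  have h: "v \<bullet> (?h x *v v) = exp (2 * l) * g0 (proj_torus x) v v" for x v
    by (simp add: r_def cmetric_inner[OF cg0] scaleR_matrix_vector_assoc[symmetric])
  have card3: "CARD('n) \<ge> 3" using card by simp
  obtain u p c where upc: "\<And>k. k < length zs \<Longrightarrow> u k \<noteq> 0 \<and> (\<forall>i. u k $ i \<in> \<int>) \<and> norm (p k - fst (zs ! k)) < \<eta>2 \<and>
     norm (p k + c k *\<^sub>R u k - snd (zs ! k)) < \<eta>2 \<and>
     (\<forall>j<length zs. j \<noteq> k \<longrightarrow> (\<forall>x. on_line (u k) (p k) x \<longrightarrow> \<not> on_line (u j) (p j) x))"
    using lines_near_segments[OF card3 \<eta>2(1), of zs] by blast
  have lf: "line_field ?h (u k) b" if "k < length zs" for k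
    by unfold_locales (rule conjunct1[OF upc[OF that]], rule sb)
  have disj: "line_field.qf ?h (u j) (p j) x \<noteq> 0"
    if "k < length zs" "j < length zs" "k \<noteq> j" "line_field.qf ?h (u k) (p k) x = 0" for k j x
  proof
    assume "line_field.qf ?h (u j) (p j) x = 0"
    then have "on_line (u j) (p j) x" by (rule line_field.qf_zero_on_line[OF lf[OF that(2)]])
    moreover have "on_line (u k) (p k) x" by (rule line_field.qf_zero_on_line[OF lf[OF that(1)] that(4)])
    moreover have "\<not> on_line (u j) (p j) x" if "on_line (u k) (p k) x"
      using conjunct2[OF conjunct2[OF conjunct2[OF conjunct2[OF upc[OF \<open>k < length zs\<close>]]]]]
        \<open>j < length zs\<close> \<open>k \<noteq> j\<close> that by (auto dest: not_sym)
    ultimately show False by simp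
  qed
  have u0: "\<And>k. k < length zs \<Longrightarrow> u k \<noteq> 0" "\<And>k i. k < length zs \<Longrightarrow> u k $ i \<in> \<int>"
    using conjunct1[OF upc] conjunct1[OF conjunct2[OF upc]] by simp_all
  obtain m :: "real ^ 'n \<Rightarrow> real ^ 'n ^ 'n" where m: "\<And>i j. smooth (\<lambda>x. m x $ i $ j)"
    "\<And>x y. lattice_rel x y \<Longrightarrow> m x = m y" "\<And>x i j. m x $ i $ j = m x $ j $ i"
    "\<And>x v. x \<in> cbox 0 1 \<Longrightarrow> exp (2 * b x) * (v \<bullet> (?h x *v v)) \<le> v \<bullet> (m x *v v)"
    "\<And>x v. x \<in> cbox 0 1 \<Longrightarrow> v \<bullet> (m x *v v) \<le> exp (2 * \<beta>) * (v \<bullet> (?h x *v v))"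
    "\<And>x k. x \<in> cbox 0 1 \<Longrightarrow> k < length zs \<Longrightarrow> line_field.qf ?h (u k) (p k) x = 0 \<Longrightarrow>
        u k \<bullet> (m x *v u k) = exp (2 * b x) * (u k \<bullet> (?h x *v u k))"
    "\<And>x. x \<in> cbox 0 1 \<Longrightarrow> curv m x > - \<epsilon>"
  proof (rule h.lines_metric[where K = "cbox 0 1" and b = b and M = M and \<beta> = \<beta> and N = "length zs" and u = u and p = p and \<epsilon> = \<epsilon>,
        OF card compact_cbox sb perb b \<beta> u0 disj \<epsilon>])
    fix m :: "real ^ 'n \<Rightarrow> real ^ 'n ^ 'n"
    assume m: "\<And>i j. smooth (\<lambda>x. m x $ i $ j)"
    "\<And>x y. lattice_rel x y \<Longrightarrow> m x = m y" "\<And>x i j. m x $ i $ j = m x $ j $ i"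
    "\<And>x v. x \<in> cbox 0 1 \<Longrightarrow> exp (2 * b x) * (v \<bullet> (?h x *v v)) \<le> v \<bullet> (m x *v v)"
    "\<And>x v. x \<in> cbox 0 1 \<Longrightarrow> v \<bullet> (m x *v v) \<le> exp (2 * \<beta>) * (v \<bullet> (?h x *v v))"
    "\<And>x k. x \<in> cbox 0 1 \<Longrightarrow> k < length zs \<Longrightarrow> line_field.qf ?h (u k) (p k) x = 0 \<Longrightarrow>
        u k \<bullet> (m x *v u k) = exp (2 * b x) * (u k \<bullet> (?h x *v u k))"
    "\<And>x. x \<in> cbox 0 1 \<Longrightarrow> curv m x > - \<epsilon>"
    show thesis by (rule that) (fact m)+
  qed
  have mpos: "v \<bullet> (m x *v v) > 0" if "x \<in> cbox 0 1" "v \<noteq> 0" for x v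
  proof -
    have "0 < exp (2 * b x) * (v \<bullet> (?h x *v v))" using h.pos_h[OF that(2), of x] by simp
    then show ?thesis using m(4)[OF that(1), of v] by linarith
  qed
  obtain g where g: "riemannian_metric g" "comp_mat g = m" "\<And>x v. g (proj_torus x) v v = v \<bullet> (m x *v v)"
    "\<And>x. scalar_curvature g (proj_torus x) = curv m x"
  proof (rule metric_from_field[OF m(1-3) mpos])
    fix g assume g: "riemannian_metric g" "comp_mat g = m" "\<And>x v. g (proj_torus x) v v = v \<bullet> (m x *v v)"
      "\<And>x. scalar_curvature g (proj_torus x) = curv m x"
    show thesis by (rule that) (fact g)+
  qed
  have cg: "cmetric g" by (rule riemannian_metric_cmetric[OF g(1)])
  have gle: "exp (2 * F p) * g0 p v v \<le> g p v v" "g p v v \<le> exp (2 * (\<beta> + l)) * g0 p v v" for p v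
  proof -
    obtain x where x: "x \<in> cbox 0 1" "p = proj_torus x" by (rule torus_cube)
    have "exp (2 * b x) * exp (2 * l) = exp (2 * F p)" by (simp add: b_def x(2) exp_add[symmetric])
    then show "exp (2 * F p) * g0 p v v \<le> g p v v" using m(4)[OF x(1), of v] by (simp add: h g(3) x(2) mult.assoc[symmetric])
    have "exp (2 * \<beta>) * exp (2 * l) = exp (2 * (\<beta> + l))" by (simp add: exp_add[symmetric])
    then show "g p v v \<le> exp (2 * (\<beta> + l)) * g0 p v v" using m(5)[OF x(1), of v] by (simp add: h g(3) x(2) mult.assoc[symmetric])
  qed
  have g0n: "g0 p v v \<ge> 0" for p v using cg0 by (simp add: cmetric_def)
  have e2: "sqrt (exp (2 * t) * g0 p v v) = exp t * nrm g0 p v" for t p v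
    by (simp add: nrm_def real_sqrt_mult exp_double)
  have glen: "exp (F p) * nrm g0 p v \<le> nrm g p v" "nrm g p v \<le> exp (\<beta> + l) * nrm g0 p v" for p v
    using real_sqrt_le_mono[OF gle(1)[of p v]] real_sqrt_le_mono[OF gle(2)[of p v]] unfolding e2 by (simp_all add: nrm_def)
  have gK: "nrm g p v \<le> K * norm v" for p v
    using order_trans[OF glen(2)[of p v] mult_left_mono[OF K0(2)[of p v]]] by (simp add: K_def mult.assoc)
  \<comment> \<open>Everywhere \<open>g\<close> is at least \<open>exp (2 * F) * g0\<close>, hence
    at least \<open>exp (- 2 * e1)\<close> times \<open>conformal f g0\<close>.\<close>
  have lower: "riemannian_dist ?fc p q - \<epsilon> \<le> riemannian_dist g p q" for p q
  proof -
    have "exp (- e1) * nrm ?fc p v \<le> nrm g p v" for p v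
    proof -
      have "f p - e1 \<le> F p" using F(2)[of p] by (simp add: abs_less_iff)
      then have "exp (f p - e1) * nrm g0 p v \<le> exp (F p) * nrm g0 p v"
        using nrm_nonneg[OF cg0] by (intro mult_right_mono) auto
      moreover have "exp (- e1) * nrm ?fc p v = exp (f p - e1) * nrm g0 p v"
        by (simp add: nrm_conformal exp_diff exp_minus divide_inverse)
      ultimately show ?thesis using glen(1)[of p v] by linarith
    qed
    from dist_mono[OF cfc cg this] have 1: "exp (- e1) * riemannian_dist ?fc p q \<le> riemannian_dist g p q" by simp
    have "1 - e1 \<le> exp (- e1)" using exp_ge_add_one_self[of "- e1"] by simp
    then have "(1 - e1) * riemannian_dist ?fc p q \<le> exp (- e1) * riemannian_dist ?fc p q"
      using dist_nonneg[OF cfc] by (intro mult_right_mono) auto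
    moreover have "e1 * riemannian_dist ?fc p q \<le> e1 * D" using D e1(1) by (intro mult_left_mono) auto
    ultimately show ?thesis using 1 e1D by (simp add: algebra_simps)
  qed
  \<comment> \<open>The identity on the lines is available in the unit cube, so the point is first
    moved there by a lattice translation, under which \<open>qf\<close> is invariant because
    \<open>u k\<close> has integer entries.\<close>
  have on_core: "nrm g (proj_torus (p k + t *\<^sub>R u k)) (s *\<^sub>R u k) \<le> exp e1 * nrm ?fc (proj_torus (p k + t *\<^sub>R u k)) (s *\<^sub>R u k)"
    if k: "k < length zs" for k t s
  proof -
    let ?x = "p k + t *\<^sub>R u k"
    obtain y where y: "y \<in> cbox 0 1" "lattice_rel ?x y" by (rule lattice_cube)
    have q: "proj_torus ?x = proj_torus y" using y(2) by (simp add: proj_torus_eq_iff)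
    have "line_field.qf ?h (u k) (p k) y = line_field.qf ?h (u k) (p k) ?x"
      using line_field.qf_periodic[OF lf[OF k] u0(2)[OF k] y(2)] by simp
    also have "\<dots> = 0" by (rule line_field.qf_line[OF lf[OF k]])
    finally have "u k \<bullet> (m y *v u k) = exp (2 * b y) * (u k \<bullet> (?h y *v u k))" by (rule m(6)[OF y(1) k])
    then have "g (proj_torus y) (u k) (u k) = exp (2 * F (proj_torus y)) * g0 (proj_torus y) (u k) (u k)"
      by (simp add: g(3) h b_def exp_add[symmetric] mult.assoc[symmetric])
    then have "nrm g (proj_torus y) (u k) = exp (F (proj_torus y)) * nrm g0 (proj_torus y) (u k)"
      unfolding nrm_def[of g] using e2 by simp
    also have "\<dots> \<le> exp (e1 + f (proj_torus y)) * nrm g0 (proj_torus y) (u k)"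
    proof -
      have "F (proj_torus y) \<le> e1 + f (proj_torus y)" using F(2)[of "proj_torus y"] by (simp add: abs_less_iff)
      then show ?thesis using nrm_nonneg[OF cg0] by (intro mult_right_mono) auto
    qed
    also have "\<dots> = exp e1 * nrm ?fc (proj_torus y) (u k)" by (simp add: nrm_conformal exp_add)
    finally have "nrm g (proj_torus y) (u k) \<le> exp e1 * nrm ?fc (proj_torus y) (u k)" .
    then have "\<bar>s\<bar> * nrm g (proj_torus y) (u k) \<le> \<bar>s\<bar> * (exp e1 * nrm ?fc (proj_torus y) (u k))"
      by (rule mult_left_mono) simp
    then show ?thesis unfolding q nrm_scale[OF cg] nrm_scale[OF cfc] by (simp add: mult.left_commute)
  qed
  \<comment> \<open>Each of four effects takes a quarter of \<open>\<eta>\<close>: moving the two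
    end points onto the line, moving the segment for \<open>conformal f g0\<close>, and the factor
    \<open>exp e1\<close>.\<close>
  have upper: "riemannian_dist g p' q' \<le> riemannian_dist ?fc p' q' + \<epsilon>" for p' q'
  proof (rule net[OF cg gK])
    fix z assume "z \<in> set zs"
    then obtain k where k: "k < length zs" "z = zs ! k" by (auto simp: in_set_conv_nth)
    have z: "z \<in> set zs" by fact
    let ?y = "p k" and ?z = "p k + c k *\<^sub>R u k"
    have near: "norm (?y - fst z) < \<eta>2" "norm (?z - snd z) < \<eta>2" using upc[OF k(1)] k(2) by auto
    have small: "K * norm v \<le> \<eta> / 4" if "norm v < \<eta>2" for v :: "real ^ 'n"
      using order_trans[OF mult_left_mono[of "norm v" \<eta>2 K] K\<eta>2] that K by simp
    have 1: "riemannian_dist g (proj_torus (fst z)) (proj_torus ?y) \<le> \<eta> / 4"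
      using dist_proj_le[OF cg gK, of "fst z" ?y] small[OF near(1)] by linarith
    have 2: "riemannian_dist g (proj_torus ?z) (proj_torus (snd z)) \<le> \<eta> / 4"
      using dist_proj_le[OF cg gK, of ?z "snd z"] small[of "snd z - ?z"] near(2) by (simp add: norm_minus_commute)
    have "seg g ?y ?z \<le> exp e1 * seg ?fc ?y ?z"
    proof -
      have "seg g ?y ?z \<le> integral {0..1} (\<lambda>t. exp e1 * nrm ?fc (proj_torus (?y + t *\<^sub>R (?z - ?y))) (?z - ?y))"
        unfolding seg_def
      proof (rule integral_le[OF nrm_line_integrable[OF cg]])
        show "(\<lambda>t. exp e1 * nrm ?fc (proj_torus (?y + t *\<^sub>R (?z - ?y))) (?z - ?y)) integrable_on {0..1}"
          using integrable_cmul[where c = "exp e1", OF nrm_line_integrable[OF cfc, of ?y ?z]]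
          by (simp only: real_scaleR_def)
        fix t :: real
        show "nrm g (proj_torus (?y + t *\<^sub>R (?z - ?y))) (?z - ?y) \<le> exp e1 * nrm ?fc (proj_torus (?y + t *\<^sub>R (?z - ?y))) (?z - ?y)"
          using on_core[OF k(1), of "t * c k" "c k"] by simp
      qed
      then show ?thesis by (simp add: seg_def)
    qed
    moreover have sz: "seg ?fc ?y ?z < seg ?fc (fst z) (snd z) + \<eta> / 4"
    proof -
      have "dist (?y, ?z) z \<le> dist ?y (fst z) + dist ?z (snd z)"
        unfolding dist_prod_def fst_conv snd_conv by (rule sqrt_sum_squares_le_sum) auto
      also have "\<dots> < d0" using near \<eta>2(2) by (simp add: dist_norm)
      also have "\<dots> \<le> d z" by (rule d0(2)[OF z])
      finally show ?thesis using d(2)[OF z, of "(?y, ?z)"] by simp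
    qed
    moreover have "exp e1 * seg ?fc ?y ?z \<le> seg ?fc ?y ?z + \<eta> / 4"
    proof -
      have "exp e1 \<le> 1 + 2 * e1"
      proof -
        have "exp e1 \<le> 1 + e1 + e1\<^sup>2" by (rule exp_bound) (use e1 in auto)
        moreover have "e1\<^sup>2 \<le> e1 * 1" unfolding power2_eq_square using e1 by (intro mult_left_mono) auto
        ultimately show ?thesis by simp
      qed
      moreover have "0 \<le> seg ?fc ?y ?z" by (rule pc_nonneg[OF cfc pc_seg])
      ultimately have "exp e1 * seg ?fc ?y ?z \<le> (1 + 2 * e1) * seg ?fc ?y ?z" by (rule mult_right_mono)
      moreover have "2 * e1 * seg ?fc ?y ?z \<le> 2 * e1 * S" using S[OF z] sz e1(1) by (intro mult_left_mono) auto
      ultimately show ?thesis using e1S by (simp add: algebra_simps)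
    qed
    ultimately have "seg g ?y ?z \<le> seg ?fc (fst z) (snd z) + \<eta> / 2" by linarith
    moreover have "riemannian_dist g (proj_torus ?y) (proj_torus ?z) \<le> seg g ?y ?z" by (rule dist_le_seg[OF cg])
    ultimately show "riemannian_dist g (proj_torus (fst z)) (proj_torus (snd z)) \<le> seg ?fc (fst z) (snd z) + \<eta>"
      using 1 2 riemannian_dist_triangle[OF cg, of "proj_torus (fst z)" "proj_torus (snd z)" "proj_torus ?y"]
        riemannian_dist_triangle[OF cg, of "proj_torus ?y" "proj_torus (snd z)" "proj_torus ?z"] by linarith
  qed
  show ?thesis
  proof
    show "riemannian_metric g" by fact
    show "scalar_curvature g p' > - \<epsilon>" for p'
    proof -
      obtain x where x: "x \<in> cbox 0 1" "p' = proj_torus x" by (rule torus_cube)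
      show ?thesis using m(7)[OF x(1)] by (simp add: x(2) g(4))
    qed
    show "\<bar>riemannian_dist g p' q' - riemannian_dist ?fc p' q'\<bar> \<le> \<epsilon>" for p' q'
      using lower[of p' q'] upper[of p' q'] by (simp add: abs_le_iff)
    fix p' v
    \<comment> \<open>The constant is \<open>2 * (\<beta> + l) = 6 * B + 8\<close>, which also
      exceeds the bound \<open>2 * (B + 1)\<close> for \<open>\<bar>2 * F\<bar>\<close>.\<close>
    have "exp (- (6 * B + 8)) * g0 p' v v \<le> exp (2 * F p') * g0 p' v v"
      using Fb[of p'] B0 g0n by (intro mult_right_mono) (auto simp: abs_le_iff)
    moreover have "exp (- (6 * B + 8)) * g0 p' v v = g0 p' v v / exp (6 * B + 8)"
      unfolding exp_minus divide_inverse by (rule mult.commute)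
    ultimately show "g0 p' v v / exp (6 * B + 8) \<le> g p' v v"
      using gle(1)[of p' v] by linarith
    have "2 * (\<beta> + l) = 6 * B + 8" by (simp add: \<beta>_def M_def l_def)
    then show "g p' v v \<le> exp (6 * B + 8) * g0 p' v v" using gle(2)[of p' v] by simp
  qed
qed

theorem theorem1p2:
  fixes g0 :: "'n::finite tensor2"
    and f :: "'n torus \<Rightarrow> real"
  assumes "CARD('n) \<ge> 4"
    and "riemannian_metric g0"
    and "flat g0"
    and "continuous_on UNIV f"
  shows "\<exists>g :: nat \<Rightarrow> 'n tensor2.
      (\<forall>i\<ge>1. riemannian_metric (g i)) \<and>
      (\<forall>i\<ge>1. \<forall>p. scalar_curvature (g i) p > - 1 / real i) \<and>
      uniform_limit UNIV
        (\<lambda>i (p, q). riemannian_dist (g i) p q)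
        (\<lambda>(p, q). riemannian_dist (conformal f g0) p q) sequentially \<and>
      (\<exists>C>0. \<forall>i\<ge>1. metric_le (\<lambda>p v w. g0 p v w / C) (g i) \<and>
                    metric_le (g i) (\<lambda>p v w. C * g0 p v w))"
proof -
  obtain B where B: "B \<ge> 0" "\<And>p. \<bar>f p\<bar> \<le> B"
  proof (rule compact_abs_bound[OF compact_torus assms(4)])
    fix C assume C: "C \<ge> 0" "\<And>x. x \<in> UNIV \<Longrightarrow> \<bar>f x\<bar> \<le> C"
    show thesis by (rule that[OF C(1)]) (simp add: C(2))
  qed
  define approx where "approx e g \<longleftrightarrow> riemannian_metric g \<and> (\<forall>p. scalar_curvature g p > - e) \<and>
    (\<forall>p q. \<bar>riemannian_dist g p q - riemannian_dist (conformal f g0) p q\<bar> \<le> e) \<and>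
    (\<forall>p v. g0 p v v / exp (6 * B + 8) \<le> g p v v) \<and> (\<forall>p v. g p v v \<le> exp (6 * B + 8) * g0 p v v)" for e g
  have ex: "\<exists>g. approx e g" if e: "e > 0" for e
  proof (rule approximating_metric[OF assms B(2) e])
    fix g
    assume a: "riemannian_metric g" "\<And>p. scalar_curvature g p > - e"
      "\<And>p q. \<bar>riemannian_dist g p q - riemannian_dist (conformal f g0) p q\<bar> \<le> e"
      "\<And>p v. g0 p v v / exp (6 * B + 8) \<le> g p v v" "\<And>p v. g p v v \<le> exp (6 * B + 8) * g0 p v v"
    have "approx e g" unfolding approx_def by (intro conjI allI a)
    then show "\<exists>g. approx e g" by blast
  qed
  \<comment> \<open>For \<open>i = 0\<close> the tolerance \<open>1 / real i\<close> is 0 by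
    convention and outside the scope of \<open>ex\<close>, so \<open>g 0\<close> stays
    arbitrary.\<close>
  have "\<forall>i. \<exists>g. i \<ge> 1 \<longrightarrow> approx (1 / real i) g"
  proof
    fix i :: nat
    show "\<exists>g. i \<ge> 1 \<longrightarrow> approx (1 / real i) g"
      using ex[of "1 / real i"] by (cases "i \<ge> 1") auto
  qed
  from choice[OF this] obtain g where ap: "\<forall>i::nat. i \<ge> 1 \<longrightarrow> approx (1 / real i) (g i)" ..
  have g: "riemannian_metric (g i)" "scalar_curvature (g i) p > - (1 / real i)"
    "\<bar>riemannian_dist (g i) p q - riemannian_dist (conformal f g0) p q\<bar> \<le> 1 / real i"
    "g0 p v v / exp (6 * B + 8) \<le> g i p v v" "g i p v v \<le> exp (6 * B + 8) * g0 p v v"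
    if "i \<ge> 1" for i p q v
    using ap that by (simp_all add: approx_def)
  have "uniform_limit UNIV (\<lambda>i (p, q). riemannian_dist (g i) p q)
      (\<lambda>(p, q). riemannian_dist (conformal f g0) p q) sequentially"
  proof (rule uniform_limitI)
    fix e :: real assume e: "e > 0"
    have "\<forall>\<^sub>F i in sequentially. 1 / real i < e"
      using order_tendstoD(2)[OF lim_1_over_n e] .
    then show "\<forall>\<^sub>F i in sequentially. \<forall>z\<in>UNIV. dist (case z of (p, q) \<Rightarrow> riemannian_dist (g i) p q)
        (case z of (p, q) \<Rightarrow> riemannian_dist (conformal f g0) p q) < e"
      using eventually_ge_at_top[of 1]
    proof eventually_elim
      case (elim i)
      have "\<bar>riemannian_dist (g i) p q - riemannian_dist (conformal f g0) p q\<bar> \<le> 1 / real i" for p q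
        by (rule g(3)[OF elim(2)])
      then have "\<bar>riemannian_dist (g i) p q - riemannian_dist (conformal f g0) p q\<bar> < e" for p q
        using elim(1) by (rule le_less_trans)
      then show ?case by (simp add: dist_real_def split: prod.split)
    qed
  qed
  moreover have "\<exists>C>0. \<forall>i\<ge>1. metric_le (\<lambda>p v w. g0 p v w / C) (g i) \<and> metric_le (g i) (\<lambda>p v w. C * g0 p v w)"
    using g(4,5) by (intro exI[of _ "exp (6 * B + 8)"]) (simp add: metric_le_def)
  ultimately show ?thesis using g(1,2) by (intro exI[of _ g]) simp
qed

end
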